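(* For each $n\in\mathbb{N}$ let $d=d(n)\in\mathbb{N}$ with $d<n^{1/2}$, $N=N(n)=\binom{n}{d}$, $p=p(n)\in\mathbb{N}$, and suppose $\gamma_n=\frac{N}{p}\to\gamma$ as $n\to\infty$ for some $\gamma\in(0,\infty)$. Let $x_1=x(n)$ be a real random variable (whose law may depend on $n$) such that $$x_1\overset{d}{=}-x_1,\qquad \mathbb{E}[x_1^2]=1,\qquad \mathbb{E}[x_1^{2k}]\le (Ck)^k\ \ (k\in\mathbb{N}),\qquad \lim_{n\to\infty}\frac{\log C}{\log\frac{n^{1/2}}{d}}=0$$ for some $C=C(n)\ge 2$. Let $T=T(n)\in\mathbb{R}^{N\times N}$ be deterministic, symmetric, positive semidefinite, with $\sup_{n\in\mathbb{N}}\|T(n)\|<\infty$ and with empirical spectral distribution converging weakly to a deterministic probability distribution $H$. Let $\tilde Z\in\mathbb{R}^{N\times p}$ be a random matrix with i.i.d. columns equal in law to $T^{1/2}Z_0$, where $Z_0\in\mathbb{R}^N$ is the random tensor product vector of order $d$ built from i.i.d. copies $x_1,\dots,x_n$ of $x_1$ (defined in the context). Then the empirical spectral distribution of $\tilde S=\frac1p\tilde Z\tilde Z^T$ converges weakly to a probability measure $\mu$ almost surely, and the Stieltjes transform of $\mu$ satisfies $$m(z)=\int_{\mathbb{R}}\frac{1}{z-t}\,d\mu(t)=\int_{\mathbb{R}}\frac{1}{z-t\,(1-\gamma+\gamma z\,m(z))}\,dH(t)\qquad (z\in\mathbb{C}^+).$$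
   Context: $\mathbb{N}=\{1,2,\dots\}$, $\mathbb{C}^+=\{z\in\mathbb{C}:\mathrm{Im}(z)>0\}$, and $\|\cdot\|$ is the operator norm on matrices. Random tensor product vector: given i.i.d. $x_1,\dots,x_n$ with $\mathbb{E}[x_1]=0$, $\mathbb{E}[x_1^2]=1$, the vector $Z_0\in\mathbb{R}^{\binom nd}$ has entries $Z_{0,i_1,\dots,i_d}=x_{i_1}x_{i_2}\cdots x_{i_d}$, $1\le i_1<i_2<\dots<i_d\le n$, where the index tuples are identified with $\{1,\dots,\binom nd\}$ via a fixed bijection. Empirical spectral distribution: for a symmetric $A\in\mathbb{R}^{r\times r}$ with eigenvalues $\lambda_1(A)\ge\dots\ge\lambda_r(A)$, $F_A(x)=\frac1r|\{1\le j\le r:\lambda_j(A)\le x\}|$. The Stieltjes transform of a probability measure $\mu$ on $\mathbb{R}$ is taken with the sign convention $m(z)=\int_{\mathbb{R}}\frac{1}{z-t}d\mu(t)$, $z\in\mathbb{C}^+$. The matrices $\tilde Z=\tilde Z(n)$ are defined on a common probability space; "almost surely" means that with probability one the (random) empirical spectral distributions converge weakly. *)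

theory Defs
  imports
    "HOL-Probability.Probability"
    "Jordan_Normal_Form.Char_Poly"
begin

text \<open>
  The dimensions of the matrices depend on a natural number, so vectors and matrices are those of
  \<open>Jordan_Normal_Form.Matrix\<close>. Scalar products and components are written in prefix form
  because \<open>HOL-Analysis\<close> uses the same infix symbols for its own vectors.
\<close>

definition sym_mat :: "real mat \<Rightarrow> bool" where
  "sym_mat A \<longleftrightarrow> square_mat A \<and> transpose_mat A = A"

definition psd_mat :: "real mat \<Rightarrow> bool" where
  "psd_mat A \<longleftrightarrow>
     sym_mat A \<and> (\<forall>v \<in> carrier_vec (dim_row A). 0 \<le> scalar_prod v (A *\<^sub>v v))"

text \<open>The unique positive semidefinite square root; meaningful for positive semidefinite \<open>A\<close>.\<close>

definition psd_sqrt :: "real mat \<Rightarrow> real mat" where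
  "psd_sqrt A = (THE B. B \<in> carrier_mat (dim_row A) (dim_row A) \<and> psd_mat B \<and> B * B = A)"

definition vec_l2norm :: "real Matrix.vec \<Rightarrow> real" where
  "vec_l2norm v = sqrt (scalar_prod v v)"

text \<open>Meaningful for \<open>dim_col A \<ge> 1\<close>, where the set of unit vectors is nonempty.\<close>

definition op_norm :: "real mat \<Rightarrow> real" where
  "op_norm A = (SUP v \<in> {v \<in> carrier_vec (dim_col A). vec_l2norm v = 1}. vec_l2norm (A *\<^sub>v v))"

text \<open>
  Distribution function of the empirical spectral distribution. For a real symmetric matrix the
  characteristic polynomial splits over the reals, so the multiset of its roots is the multiset of
  all eigenvalues, counted with multiplicity.
\<close>

definition esd :: "real mat \<Rightarrow> real \<Rightarrow> real" where
  "esd A x = real (size {#t \<in># proots (char_poly A). t \<le> x#}) / real (dim_row A)"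

text \<open>The Borel sigma-algebra on real vectors of dimension \<open>N\<close>, generated by the coordinates.\<close>

definition borel_vec :: "nat \<Rightarrow> real Matrix.vec measure" where
  "borel_vec N = vimage_algebra (carrier_vec N) (\<lambda>v. \<lambda>i\<in>{..<N}. vec_index v i)
                   (\<Pi>\<^sub>M i\<in>{..<N}. borel)"

definition index_tuples :: "nat \<Rightarrow> nat \<Rightarrow> nat list set" where
  "index_tuples n d = {is. length is = d \<and> sorted_wrt (<) is \<and> set is \<subseteq> {1..n}}"

text \<open>
  The tensor product vector with entries \<open>x\<^sub>i\<^sub>1 \<cdots> x\<^sub>i\<^sub>d\<close>; the function \<open>e\<close> enumerates the index
  tuples by the positions \<open>0, \<dots>, N - 1\<close>.
\<close>

definition tensor_vec :: "nat \<Rightarrow> (nat \<Rightarrow> nat list) \<Rightarrow> (nat \<Rightarrow> real) \<Rightarrow> real Matrix.vec" where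
  "tensor_vec N e x = Matrix.vec N (\<lambda>k. \<Prod>i\<leftarrow>e k. x i)"

text \<open>The Stieltjes transform, with the sign convention \<open>1 / (z - t)\<close>.\<close>

definition stieltjes :: "real measure \<Rightarrow> complex \<Rightarrow> complex" where
  "stieltjes \<mu> z = (\<integral>t. 1 / (z - complex_of_real t) \<partial>\<mu>)"

end

theory Submission
  imports Defs "HOL-Computational_Algebra.Fundamental_Theorem_Algebra" "HOL-Complex_Analysis.Conformal_Mappings"
begin

no_notation vec_nth (infixl \<open>$\<close> 90)
no_notation inner (infix \<open>\<bullet>\<close> 70)

text \<open>
  The limit is found with the resolvent. Let \<open>S\<close> be the sample covariance matrix,
  \<open>G = (z - S)\<^sup>-\<^sup>1\<close> its resolvent at a point of the upper half-plane, and \<open>m = tr G / N\<close> the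
  Stieltjes transform of its empirical spectral distribution.

  The probabilistic input is that a quadratic form \<open>y \<bullet> M y\<close> in a column \<open>y\<close> of the data matrix is close to
  \<open>tr (T M)\<close>, on the scale \<open>N\<close>, for every fixed \<open>M\<close> of bounded operator norm. The coordinates of the tensor
  product vector are the products \<open>x\<^sub>I\<close> of the variables over the sets \<open>I\<close> of size \<open>d\<close>. By symmetry the
  covariance of \<open>x\<^sub>I x\<^sub>J\<close> and \<open>x\<^sub>K x\<^sub>L\<close> vanishes unless the symmetric differences of \<open>I, J\<close> and of \<open>K, L\<close>
  agree, so \<open>I\<close>, \<open>J\<close>, \<open>K\<close> leave at most one \<open>L\<close>; and the covariance is small unless \<open>K\<close> meets
  \<open>I \<union> J\<close>, where each common point costs at most a factor \<open>(2 C)\<^sup>2\<close> from the fourth moment. A random \<open>K\<close>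
  meets \<open>I \<union> J\<close> in about \<open>d\<^sup>2 / n\<close> points, and Schur's test turns the resulting row sums into a variance
  bound (\<open>quadratic_form_variance\<close>). The assumption on \<open>log C\<close> makes \<open>C\<^sup>2 d\<^sup>2 / n\<close> tend to \<open>0\<close>,
  and with it the relative variance (\<open>overlap_excess_tendsto_0\<close>).

  To use this, one column is left out: that is a perturbation of rank one, it changes \<open>tr G\<close> by at most
  \<open>1 / Im z\<close>, and the remaining resolvent is independent of the column (\<open>rank_one_perturbation\<close>). Comparing
  \<open>G\<close> with \<open>(z - b T)\<^sup>-\<^sup>1\<close>, where \<open>b = 1 - \<gamma> + \<gamma> z E m\<close>, shows that \<open>E m\<close> solves the
  Marchenko--Pastur equation up to an error that tends to \<open>0\<close> (\<open>resolvent_sample_cov_estimate\<close>,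
  \<open>mean_trace_equation\<close>). The same bound \<open>1 / Im z\<close> is a bounded difference property of \<open>m\<close> as a function of
  the \<open>p\<close> independent columns, so \<open>m - E m\<close> exceeds \<open>\<delta>\<close> with a probability that decays exponentially
  in \<open>N\<^sup>2 / p\<close>, hence in \<open>n\<close> (\<open>normalized_trace_concentration\<close>). By Borel--Cantelli,
  \<open>m - E m\<close> tends to \<open>0\<close> almost surely, simultaneously for a countable dense set of \<open>z\<close>.

  What remains concerns one realisation (\<open>mp_limit\<close>). High up on the imaginary axis the approximate equation
  forces \<open>z m(z)\<close> to be near \<open>1\<close>, which makes the spectral distributions tight, and every limit point
  satisfies the exact equation. The equation has only one solution among the measures on the half-line: for \<open>z\<close>
  with large imaginary part it is a contraction in \<open>m(z)\<close>, analytic continuation extends the uniqueness to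
  all \<open>z\<close>, and the Stieltjes transform determines the measure (\<open>mp_unique\<close>, \<open>stieltjes_unique\<close>). So all
  limit points coincide, and the limit is the same for almost every realisation.
\<close>

section \<open>The spectral theorem for real symmetric matrices\<close>

lemma mat_entry_mult:
  assumes "A \<in> carrier_mat n k" "B \<in> carrier_mat k m" "i < n" "j < m"
  shows "(A * B) $$ (i,j) = (\<Sum>l<k. A $$ (i,l) * B $$ (l,j))"
  using assms by (auto simp: scalar_prod_def lessThan_atLeast0 intro!: sum.cong)

lemma mat_vec_entry:
  assumes "A \<in> carrier_mat n k" "v \<in> carrier_vec k" "i < n"
  shows "(A *\<^sub>v v) $ i = (\<Sum>l<k. A $$ (i,l) * v $ l)"
  using assms by (auto simp: scalar_prod_def lessThan_atLeast0 intro!: sum.cong)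

text \<open>The fundamental theorem of algebra provides a complex eigenvalue. It is real because the Hermitian
  form \<open>w \<mapsto> w\<^sup>* A w\<close> of a symmetric matrix takes real values.\<close>

lemma symmetric_real_eigenvalue:
  fixes A :: "real mat"
  assumes A: "A \<in> carrier_mat n n" and sym: "A\<^sup>T = A" and n: "n > 0"
  shows "\<exists>k. eigenvalue A k"
proof -
  let ?c = "of_real :: real \<Rightarrow> complex"
  let ?A = "map_mat ?c A"
  have cA: "?A \<in> carrier_mat n n" using A by auto
  have dp: "degree (char_poly ?A) = n" using degree_monic_char_poly[OF cA] by simp
  have "\<not> constant (poly (char_poly ?A))"
    unfolding constant_degree dp using n by (rule gr_implies_not_zero)
  then obtain z where z: "poly (char_poly ?A) z = 0" using Fundamental_Theorem_Algebra.fundamental_theorem_of_algebra by blast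
  then have "eigenvalue ?A z" by (rule iffD2[OF eigenvalue_root_char_poly[OF cA]])
  then obtain w where w: "w \<in> carrier_vec n" "w \<noteq> 0\<^sub>v n" "?A *\<^sub>v w = z \<cdot>\<^sub>v w"
    using cA unfolding eigenvalue_def eigenvector_def by auto
  have ent: "(\<Sum>l<n. of_real (A $$ (i,l)) * w $ l) = z * w $ i" if "i < n" for i
    using mat_vec_entry[OF cA w(1) that] w that A by simp
  have symij: "A $$ (j,i) = A $$ (i,j)" if "i < n" "j < n" for i j
    using arg_cong[OF sym, of "\<lambda>M. M $$ (i,j)"] A that by auto
  let ?q = "\<Sum>i<n. \<Sum>l<n. cnj (w $ i) * of_real (A $$ (i,l)) * w $ l"
  have q1: "?q = z * (\<Sum>i<n. cnj (w $ i) * w $ i)"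
  proof -
    have "?q = (\<Sum>i<n. cnj (w $ i) * (\<Sum>l<n. of_real (A $$ (i,l)) * w $ l))"
      by (simp only: sum_distrib_left mult.assoc)
    also have "\<dots> = (\<Sum>i<n. cnj (w $ i) * (z * w $ i))"
      by (intro sum.cong refl) (simp add: ent)
    finally show ?thesis by (simp add: sum_distrib_left mult_ac)
  qed
  have "cnj ?q = (\<Sum>i<n. \<Sum>l<n. w $ i * of_real (A $$ (i,l)) * cnj (w $ l))"
    by simp
  also have "\<dots> = (\<Sum>l<n. \<Sum>i<n. w $ i * of_real (A $$ (i,l)) * cnj (w $ l))"
    by (rule sum.swap)
  also have "\<dots> = ?q"
    by (intro sum.cong refl) (auto simp: symij)
  finally have q2: "cnj ?q = ?q" .
  have nw: "(\<Sum>i<n. cnj (w $ i) * w $ i) = of_real (\<Sum>i<n. (cmod (w $ i))\<^sup>2)"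
  proof -
    have "cnj (w $ i) * w $ i = of_real ((cmod (w $ i))\<^sup>2)" for i
      by (subst complex_norm_square) (rule mult.commute)
    then show ?thesis by simp
  qed
  obtain i where "i < n" "w $ i \<noteq> 0" using w by (metis carrier_vecD eq_vecI index_zero_vec)
  then have pos: "(\<Sum>i<n. (cmod (w $ i))\<^sup>2) > 0"
    by (intro sum_pos2[of _ i]) auto
  have "cnj z * of_real (\<Sum>i<n. (cmod (w $ i))\<^sup>2) = z * of_real (\<Sum>i<n. (cmod (w $ i))\<^sup>2)"
    using q2 unfolding q1 nw by simp
  then have "cnj z = z" using pos by (metis mult_right_cancel of_real_eq_0_iff order_less_irrefl)
  then obtain r where r: "z = of_real r" by (metis Reals_cases Reals_cnj_iff)
  have "char_poly ?A = map_poly ?c (char_poly A)"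
    using of_real_hom.char_poly_hom[OF A] by blast
  then have "?c (poly (char_poly A) r) = 0" using z r by simp
  then have "poly (char_poly A) r = 0" by simp
  then show ?thesis using eigenvalue_root_char_poly[OF A] by blast
qed

text \<open>The reflection that exchanges a given unit vector with the first basis vector; it is the identity
  if the two agree, because then the coefficient is \<open>2 / 0 = 0\<close>.\<close>

lemma householder_exists:
  fixes v :: "real Matrix.vec"
  assumes v: "v \<in> carrier_vec n" and n: "n > 0" and unit: "(\<Sum>i<n. (v $ i)\<^sup>2) = 1"
  shows "\<exists>U. U \<in> carrier_mat n n \<and> U\<^sup>T = U \<and> U * U = 1\<^sub>m n \<and> (\<forall>i<n. U $$ (i,0) = v $ i)"
proof -
  define w where "w i = v $ i - (if i = 0 then 1 else 0)" for i
  define W where "W = (\<Sum>i<n. (w i)\<^sup>2)"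
  define c where "c = 2 / W"
  define U where "U = Matrix.mat n n (\<lambda>(i,j). (if i = j then 1 else 0) - c * w i * w j)"
  have U: "U \<in> carrier_mat n n" by (simp add: U_def)
  have ccW: "c * c * W = 2 * c" by (simp add: c_def)
  have "W = (\<Sum>i<n. (v $ i)\<^sup>2 - (if i = 0 then 2 * v $ 0 - 1 else 0))"
    unfolding W_def w_def by (intro sum.cong) (auto simp: power2_eq_square algebra_simps)
  also have "\<dots> = 1 - (2 * v $ 0 - 1)"
    using n by (simp add: sum_subtractf unit)
  finally have W: "W = - 2 * w 0" by (simp add: w_def)
  have "U * U = 1\<^sub>m n"
  proof (rule eq_matI)
    fix i j assume ij: "i < dim_row (1\<^sub>m n :: real mat)" "j < dim_col (1\<^sub>m n :: real mat)"
    then have i: "i < n" and j: "j < n" by auto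
    have "(U * U) $$ (i,j) = (\<Sum>k<n. ((if i = k then 1 else 0) - c * w i * w k) * ((if k = j then 1 else 0) - c * w k * w j))"
      using mat_entry_mult[OF U U i j] i j by (simp add: U_def)
    also have "\<dots> = (\<Sum>k<n. (if k = i then (if i = j then 1 else 0) else 0) - (if k = i then c * w i * w j else 0)
        - (if k = j then c * w i * w j else 0) + c * c * w i * w j * (w k)\<^sup>2)"
      by (intro sum.cong) (auto simp: algebra_simps power2_eq_square)
    also have "\<dots> = (if i = j then 1 else 0) - 2 * c * w i * w j + (c * c * W) * w i * w j"
      using i j unfolding W_def
      by (simp add: sum.distrib sum_subtractf sum_distrib_left[symmetric] mult_ac)
    also have "\<dots> = (if i = j then 1 else 0)" unfolding ccW by simp
    finally show "(U * U) $$ (i,j) = (1\<^sub>m n) $$ (i,j)" using i j by simp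
  qed (use U in auto)
  moreover have "U\<^sup>T = U" by (rule eq_matI) (auto simp: U_def)
  moreover have "U $$ (i,0) = v $ i" if i: "i < n" for i
  proof -
    have "U $$ (i,0) = (if i = 0 then 1 else 0) - c * w i * w 0" using i n by (simp add: U_def)
    also have "c * w i * w 0 = - w i"
    proof (cases "W = 0")
      case True
      then have "w i = 0" using i unfolding W_def by (subst (asm) sum_nonneg_eq_0_iff) auto
      then show ?thesis by simp
    next
      case False then show ?thesis using W by (simp add: c_def field_simps)
    qed
    finally show ?thesis by (simp add: w_def)
  qed
  ultimately show ?thesis using U by blast
qed

definition diagonalizes :: "nat \<Rightarrow> real mat \<Rightarrow> (nat \<Rightarrow> real) \<Rightarrow> real mat \<Rightarrow> bool" where
  "diagonalizes n Q l A \<longleftrightarrow> Q \<in> carrier_mat n n \<and> Q\<^sup>T * Q = 1\<^sub>m n \<and> Q * Q\<^sup>T = 1\<^sub>m n \<and>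
     A = Q * mat_diag n l * Q\<^sup>T"

text \<open>A reflection that carries the first basis vector to a unit eigenvector brings the matrix into block
  form, with the eigenvalue in one corner and a smaller symmetric matrix in the other.\<close>

theorem symmetric_diagonalizable:
  fixes A :: "real mat"
  assumes "A \<in> carrier_mat n n" and "A\<^sup>T = A"
  shows "\<exists>Q l. diagonalizes n Q l A"
  using assms
proof (induction n arbitrary: A)
  case 0
  then have "diagonalizes 0 (1\<^sub>m 0) (\<lambda>_. 0) A" unfolding diagonalizes_def by (auto intro!: eq_matI)
  then show ?case by blast
next
  case (Suc m)
  let ?n = "Suc m"
  note A = Suc.prems(1)
  obtain k where "eigenvalue A k" using symmetric_real_eigenvalue[OF Suc.prems] by auto
  then obtain u where u: "u \<in> carrier_vec ?n" "u \<noteq> 0\<^sub>v ?n" "A *\<^sub>v u = k \<cdot>\<^sub>v u"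
    using A unfolding eigenvalue_def eigenvector_def by auto
  define s where "s = (\<Sum>i<?n. (u $ i)\<^sup>2)"
  obtain i where "i < ?n" "u $ i \<noteq> 0" using u by (metis carrier_vecD eq_vecI index_zero_vec)
  then have s: "s > 0" unfolding s_def by (intro sum_pos2[of _ i]) auto
  define v where "v = (1 / sqrt s) \<cdot>\<^sub>v u"
  have v: "v \<in> carrier_vec ?n" using u by (simp add: v_def)
  have vi: "v $ i = u $ i / sqrt s" if "i < ?n" for i using u that by (simp add: v_def)
  have "(\<Sum>i<?n. (v $ i)\<^sup>2) = (\<Sum>i<?n. (u $ i)\<^sup>2 / s)"
    using s by (intro sum.cong) (auto simp: vi power_divide)
  also have "\<dots> = 1" using s by (simp add: s_def sum_divide_distrib[symmetric] del: sum.lessThan_Suc)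
  finally have "(\<Sum>i<?n. (v $ i)\<^sup>2) = 1" .
  from householder_exists[OF v _ this] obtain U where
    U: "U \<in> carrier_mat ?n ?n" "U\<^sup>T = U" "U * U = 1\<^sub>m ?n" and Uc: "\<And>i. i < ?n \<Longrightarrow> U $$ (i,0) = v $ i"
    by auto
  define B where "B = U * A * U"
  have B: "B \<in> carrier_mat ?n ?n" using U A by (simp add: B_def)
  have UBU: "U * B * U = A"
  proof -
    have "U * B * U = (U * U) * A * (U * U)" unfolding B_def
      using U(1) A by (simp add: assoc_mult_mat[of _ ?n ?n _ ?n _ ?n])
    then show ?thesis using U A by simp
  qed
  have Bsym: "B\<^sup>T = B" unfolding B_def
    using U A Suc.prems(2) by (simp add: transpose_mult[of _ ?n ?n _ ?n] assoc_mult_mat[of _ ?n ?n _ ?n _ ?n])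
  have Bij: "B $$ (i,j) = B $$ (j,i)" if "i < ?n" "j < ?n" for i j
    using arg_cong[OF Bsym, of "\<lambda>M. M $$ (i,j)"] B that by auto
  have AUc: "(A * U) $$ (i,0) = k * U $$ (i,0)" if i: "i < ?n" for i
  proof -
    have "(A * U) $$ (i,0) = (\<Sum>l<?n. A $$ (i,l) * u $ l) / sqrt s"
      unfolding sum_divide_distrib mat_entry_mult[OF A U(1) i zero_less_Suc]
      by (intro sum.cong) (auto simp: Uc vi)
    also have "(\<Sum>l<?n. A $$ (i,l) * u $ l) = k * u $ i"
      using mat_vec_entry[OF A u(1) i] u i by simp
    finally show ?thesis using i by (simp add: Uc vi)
  qed
  have Bc: "B $$ (i,0) = (if i = 0 then k else 0)" if i: "i < ?n" for i
  proof -
    have "B = U * (A * U)" unfolding B_def using U A by (simp add: assoc_mult_mat[of _ ?n ?n _ ?n _ ?n])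
    then have "B $$ (i,0) = (\<Sum>l<?n. U $$ (i,l) * (k * U $$ (l,0)))"
      using mat_entry_mult[OF U(1) mult_carrier_mat[OF A U(1)] i zero_less_Suc] AUc by simp
    also have "\<dots> = k * (U * U) $$ (i,0)"
      unfolding sum_distrib_left mat_entry_mult[OF U(1) U(1) i zero_less_Suc] by (simp add: mult_ac)
    finally show ?thesis using i U by simp
  qed
  define A' where "A' = Matrix.mat m m (\<lambda>(i,j). B $$ (Suc i, Suc j))"
  have A': "A' \<in> carrier_mat m m" "A'\<^sup>T = A'"
    using Bij by (auto simp: A'_def intro!: eq_matI)
  from Suc.IH[OF this] obtain P l where "diagonalizes m P l A'" by blast
  then have P: "P \<in> carrier_mat m m" "P\<^sup>T * P = 1\<^sub>m m" "P * P\<^sup>T = 1\<^sub>m m" "A' = P * mat_diag m l * P\<^sup>T"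
    unfolding diagonalizes_def by auto
  define R where "R = Matrix.mat ?n ?n (\<lambda>(i,j). if i = 0 \<and> j = 0 then 1 else if i = 0 \<or> j = 0 then 0 else P $$ (i-1,j-1))"
  have R: "R \<in> carrier_mat ?n ?n" by (simp add: R_def)
  have PPT: "(\<Sum>j<m. P $$ (i,j) * P $$ (i',j)) = (if i = i' then 1 else 0)" if "i < m" "i' < m" for i i'
    using arg_cong[OF P(3), of "\<lambda>M. M $$ (i,i')"] P(1) that
      mat_entry_mult[of P m m "P\<^sup>T" m i i'] by simp
  have RRT: "R * R\<^sup>T = 1\<^sub>m ?n"
  proof (rule eq_matI)
    fix i i' assume ii: "i < dim_row (1\<^sub>m ?n :: real mat)" "i' < dim_col (1\<^sub>m ?n :: real mat)"
    have "(R * R\<^sup>T) $$ (i,i') = (\<Sum>j<?n. R $$ (i,j) * R $$ (i',j))"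
      using mat_entry_mult[of R ?n ?n "R\<^sup>T" ?n i i'] R ii by simp
    also have "\<dots> = R $$ (i,0) * R $$ (i',0) + (\<Sum>j<m. R $$ (i,Suc j) * R $$ (i',Suc j))"
      by (rule sum.lessThan_Suc_shift)
    also have "\<dots> = (if i = i' then 1 else 0)"
    proof -
      consider "i = 0" | a where "i = Suc a" "i' = 0" | a b where "i = Suc a" "i' = Suc b"
        by (cases i; cases i') auto
      then show ?thesis
        using ii PPT by cases (auto simp: R_def)
    qed
    finally show "(R * R\<^sup>T) $$ (i,i') = 1\<^sub>m ?n $$ (i,i')" using ii by simp
  qed (use R in auto)
  have RTR: "R\<^sup>T * R = 1\<^sub>m ?n"
    using mat_mult_left_right_inverse[OF R _ RRT] R by simp
  define l' where "l' i = (if i = 0 then k else l (i-1))" for i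
  have PL: "(\<Sum>j<m. P $$ (i,j) * l j * P $$ (i',j)) = A' $$ (i,i')" if "i < m" "i' < m" for i i'
    unfolding P(4) using P(1) that mat_entry_mult[of "P * mat_diag m l" m m "P\<^sup>T" m i i']
    by (simp add: mat_diag_mult_right[OF P(1)])
  have BR: "B = R * mat_diag ?n l' * R\<^sup>T"
  proof (rule eq_matI)
    fix i i' assume ii: "i < dim_row (R * mat_diag ?n l' * R\<^sup>T)" "i' < dim_col (R * mat_diag ?n l' * R\<^sup>T)"
    then have ii: "i < ?n" "i' < ?n" using R by auto
    have "(R * mat_diag ?n l' * R\<^sup>T) $$ (i,i') = (\<Sum>j<?n. R $$ (i,j) * l' j * R $$ (i',j))"
      using mat_entry_mult[of "R * mat_diag ?n l'" ?n ?n "R\<^sup>T" ?n i i'] R ii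
      by (simp add: mat_diag_mult_right[OF R] del: sum.lessThan_Suc)
    also have "\<dots> = R $$ (i,0) * k * R $$ (i',0) + (\<Sum>j<m. R $$ (i,Suc j) * l j * R $$ (i',Suc j))"
      unfolding sum.lessThan_Suc_shift by (simp add: l'_def)
    also have "\<dots> = B $$ (i,i')"
    proof -
      consider "i = 0" "i' = 0" | b where "i = 0" "i' = Suc b" | a where "i = Suc a" "i' = 0" | a b where "i = Suc a" "i' = Suc b"
        by (cases i; cases i') auto
      then show ?thesis
        using ii PL Bc Bij[of 0] by cases (auto simp: R_def A'_def)
    qed
    finally show "B $$ (i,i') = (R * mat_diag ?n l' * R\<^sup>T) $$ (i,i')" by simp
  qed (use R B in auto)
  have D: "mat_diag ?n l' \<in> carrier_mat ?n ?n" by simp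
  have RT: "R\<^sup>T \<in> carrier_mat ?n ?n" using R by simp
  note cl = mult_carrier_mat[of _ ?n ?n _ ?n]
  have asc: "X * Y * Z = X * (Y * Z)" if "X \<in> carrier_mat ?n ?n" "Y \<in> carrier_mat ?n ?n" "Z \<in> carrier_mat ?n ?n" for X Y Z :: "real mat"
    using that by (rule assoc_mult_mat)
  have T: "(U * R)\<^sup>T = R\<^sup>T * U" using transpose_mult[OF U(1) R] U by simp
  have "(U * R) * (U * R)\<^sup>T = U * ((R * R\<^sup>T) * U)" unfolding T using U(1) R RT by (simp add: asc cl)
  also have "\<dots> = 1\<^sub>m ?n" unfolding RRT using U by simp
  finally have 1: "(U * R) * (U * R)\<^sup>T = 1\<^sub>m ?n" .
  have "(U * R)\<^sup>T * (U * R) = R\<^sup>T * ((U * U) * R)" unfolding T using U(1) R RT by (simp add: asc cl)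
  also have "\<dots> = 1\<^sub>m ?n" unfolding U(3) using R RTR by simp
  finally have 2: "(U * R)\<^sup>T * (U * R) = 1\<^sub>m ?n" .
  have "A = U * B * U" using UBU by simp
  also have "\<dots> = (U * R) * mat_diag ?n l' * (U * R)\<^sup>T" unfolding T BR
    using U(1) R RT D by (simp add: asc cl)
  finally have "diagonalizes ?n (U * R) l' A"
    unfolding diagonalizes_def using 1 2 U(1) R by auto
  then show ?case by blast
qed

section \<open>Functional calculus and operator bounds\<close>

definition mtrace :: "'a::comm_ring_1 mat \<Rightarrow> 'a" where
  "mtrace A = (\<Sum>i<dim_row A. A $$ (i,i))"

lemma mtrace_mult_commute:
  assumes A: "A \<in> carrier_mat n m" and B: "B \<in> carrier_mat m n"
  shows "mtrace (A * B) = mtrace (B * A)"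
proof -
  have "mtrace (A * B) = (\<Sum>i<n. \<Sum>j<m. A $$ (i,j) * B $$ (j,i))"
    unfolding mtrace_def using A B mat_entry_mult[OF A B] by simp
  also have "\<dots> = (\<Sum>j<m. \<Sum>i<n. A $$ (i,j) * B $$ (j,i))" by (rule sum.swap)
  also have "\<dots> = mtrace (B * A)"
    unfolding mtrace_def using A B mat_entry_mult[OF B A] by (simp add: mult.commute)
  finally show ?thesis .
qed

lemma mtrace_minus: "A \<in> carrier_mat n n \<Longrightarrow> B \<in> carrier_mat n n \<Longrightarrow> mtrace (A - B) = mtrace A - mtrace B"
  by (auto simp: mtrace_def sum_subtractf)

lemma mtrace_smult: "A \<in> carrier_mat n n \<Longrightarrow> mtrace (c \<cdot>\<^sub>m A) = c * mtrace A"
  by (auto simp: mtrace_def sum_distrib_left)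

lemma mtrace_one: "mtrace (1\<^sub>m n) = of_nat n"
  by (simp add: mtrace_def)

lemma mtrace_diag: "mtrace (mat_diag n f) = (\<Sum>i<n. f i)"
  by (simp add: mtrace_def mat_diag_def)

text \<open>Both notions are polymorphic: a complex function of a real symmetric matrix is diagonalised by the same real
  orthogonal matrix as the matrix itself.\<close>

definition orth_mat :: "nat \<Rightarrow> 'a::comm_ring_1 mat \<Rightarrow> bool" where
  "orth_mat n Q \<longleftrightarrow> Q \<in> carrier_mat n n \<and> Q\<^sup>T * Q = 1\<^sub>m n \<and> Q * Q\<^sup>T = 1\<^sub>m n"

definition spec_mat :: "nat \<Rightarrow> 'a::comm_ring_1 mat \<Rightarrow> (nat \<Rightarrow> 'a) \<Rightarrow> 'a mat" where
  "spec_mat n Q f = Q * mat_diag n f * Q\<^sup>T"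

lemma diagonalizes_iff: "diagonalizes n Q l A \<longleftrightarrow> orth_mat n Q \<and> A = spec_mat n Q l"
  by (auto simp: diagonalizes_def orth_mat_def spec_mat_def)

lemma spec_mat_carrier [simp]: "orth_mat n Q \<Longrightarrow> spec_mat n Q f \<in> carrier_mat n n"
  by (auto simp: spec_mat_def orth_mat_def)

lemma spec_mat_dim [simp]:
  "orth_mat n Q \<Longrightarrow> dim_row (spec_mat n Q f) = n" "orth_mat n Q \<Longrightarrow> dim_col (spec_mat n Q f) = n"
  using spec_mat_carrier[of n Q f] by blast+

lemma spec_mat_entry:
  assumes "orth_mat n Q" "i < n" "j < n"
  shows "spec_mat n Q f $$ (i,j) = (\<Sum>k<n. Q $$ (i,k) * f k * Q $$ (j,k))"
proof -
  have Q: "Q \<in> carrier_mat n n" using assms by (simp add: orth_mat_def)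
  show ?thesis
    unfolding spec_mat_def mat_diag_mult_right[OF Q]
    using assms(2,3) Q mat_entry_mult[of "Matrix.mat n n (\<lambda>(i, j). Q $$ (i, j) * f j)" n n "Q\<^sup>T" n i j]
    by (simp cong: sum.cong_simp)
qed

lemma orth_mat_rows:
  assumes "orth_mat n Q" "i < n" "j < n"
  shows "(\<Sum>k<n. Q $$ (i,k) * Q $$ (j,k)) = of_bool (i = j)"
proof -
  have "(Q * Q\<^sup>T) $$ (i,j) = (\<Sum>k<n. Q $$ (i,k) * Q $$ (j,k))"
    using assms mat_entry_mult[of Q n n "Q\<^sup>T" n i j] by (auto simp: orth_mat_def intro!: sum.cong)
  moreover have "(Q * Q\<^sup>T) $$ (i,j) = of_bool (i = j)" using assms by (simp add: orth_mat_def)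
  ultimately show ?thesis by simp
qed

lemma orth_mat_cols:
  assumes "orth_mat n Q" "i < n" "j < n"
  shows "(\<Sum>k<n. Q $$ (k,i) * Q $$ (k,j)) = of_bool (i = j)"
proof -
  have "(Q\<^sup>T * Q) $$ (i,j) = (\<Sum>k<n. Q $$ (k,i) * Q $$ (k,j))"
    using assms mat_entry_mult[of "Q\<^sup>T" n n Q n i j] by (auto simp: orth_mat_def intro!: sum.cong)
  moreover have "(Q\<^sup>T * Q) $$ (i,j) = of_bool (i = j)" using assms by (simp add: orth_mat_def)
  ultimately show ?thesis by simp
qed

lemma spec_mat_mult:
  assumes Q: "orth_mat n Q"
  shows "spec_mat n Q f * spec_mat n Q g = spec_mat n Q (\<lambda>i. f i * g i)"
proof -
  have c: "Q \<in> carrier_mat n n" "Q\<^sup>T \<in> carrier_mat n n" "Q\<^sup>T * Q = 1\<^sub>m n" using Q by (auto simp: orth_mat_def)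
  have d: "mat_diag n h \<in> carrier_mat n n" for h :: "nat \<Rightarrow> 'a" by simp
  have "spec_mat n Q f * spec_mat n Q g = Q * (mat_diag n f * ((Q\<^sup>T * Q) * (mat_diag n g * Q\<^sup>T)))"
    unfolding spec_mat_def using c(1,2) d by (simp add: assoc_mult_mat[of _ n n _ n _ n] mult_carrier_mat[of _ n n _ n])
  also have "\<dots> = Q * ((mat_diag n f * mat_diag n g) * Q\<^sup>T)"
    unfolding c(3) left_mult_one_mat[OF mult_carrier_mat[OF d c(2)]] assoc_mult_mat[OF d d c(2)] ..
  also have "\<dots> = spec_mat n Q (\<lambda>i. f i * g i)"
    unfolding spec_mat_def mat_diag_diag using c(1,2) d by (simp add: assoc_mult_mat[of _ n n _ n _ n])
  finally show ?thesis .
qed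

lemma spec_mat_cong: "(\<And>i. i < n \<Longrightarrow> f i = g i) \<Longrightarrow> spec_mat n Q f = spec_mat n Q g"
  unfolding spec_mat_def mat_diag_def
  by (rule arg_cong[where f = "\<lambda>D. Q * D * Q\<^sup>T"], rule cong_mat) auto

lemma spec_mat_one: "orth_mat n Q \<Longrightarrow> spec_mat n Q (\<lambda>_. 1) = 1\<^sub>m n"
  by (auto simp: spec_mat_def orth_mat_def)

lemma spec_mat_affine:
  assumes Q: "orth_mat n Q"
  shows "a \<cdot>\<^sub>m 1\<^sub>m n - b \<cdot>\<^sub>m spec_mat n Q f = spec_mat n Q (\<lambda>i. a - b * f i)"
proof (rule eq_matI)
  fix i j assume "i < dim_row (spec_mat n Q (\<lambda>i. a - b * f i))" "j < dim_col (spec_mat n Q (\<lambda>i. a - b * f i))"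
  then have ij: "i < n" "j < n" using spec_mat_carrier[OF Q, of "\<lambda>i. a - b * f i"] by auto
  have "spec_mat n Q (\<lambda>i. a - b * f i) $$ (i,j)
      = a * (\<Sum>k<n. Q $$ (i,k) * Q $$ (j,k)) - b * (\<Sum>k<n. Q $$ (i,k) * f k * Q $$ (j,k))"
    unfolding spec_mat_entry[OF Q ij] by (simp add: sum_distrib_left sum_subtractf[symmetric] algebra_simps)
  also have "\<dots> = a * of_bool (i = j) - b * spec_mat n Q f $$ (i,j)"
    unfolding orth_mat_rows[OF Q ij] spec_mat_entry[OF Q ij] ..
  finally show "(a \<cdot>\<^sub>m 1\<^sub>m n - b \<cdot>\<^sub>m spec_mat n Q f) $$ (i,j) = spec_mat n Q (\<lambda>i. a - b * f i) $$ (i,j)"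
    using ij spec_mat_carrier[OF Q, of f] by simp
qed (use Q in auto)

lemma spec_mat_transpose: "orth_mat n Q \<Longrightarrow> (spec_mat n Q f)\<^sup>T = spec_mat n Q f"
  by (intro eq_matI) (auto simp: spec_mat_entry mult_ac)

lemma mtrace_spec_mat:
  assumes Q: "orth_mat n Q"
  shows "mtrace (spec_mat n Q f) = (\<Sum>i<n. f i)"
proof -
  have c: "Q \<in> carrier_mat n n" "Q\<^sup>T \<in> carrier_mat n n" "Q\<^sup>T * Q = 1\<^sub>m n" using Q by (auto simp: orth_mat_def)
  have "mtrace (spec_mat n Q f) = mtrace (Q\<^sup>T * (Q * mat_diag n f))"
    unfolding spec_mat_def using c by (intro mtrace_mult_commute[of _ n n]) auto
  also have "Q\<^sup>T * (Q * mat_diag n f) = (Q\<^sup>T * Q) * mat_diag n f"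
    using c(1,2) by (simp add: assoc_mult_mat[of _ n n _ n _ n])
  also have "\<dots> = mat_diag n f" unfolding c(3) by (rule left_mult_one_mat[of _ n n]) simp
  finally show ?thesis by (simp add: mtrace_diag)
qed

abbreviation cmat :: "real mat \<Rightarrow> complex mat" where "cmat \<equiv> map_mat of_real"
abbreviation cvec :: "real Matrix.vec \<Rightarrow> complex Matrix.vec" where "cvec \<equiv> map_vec of_real"

lemma orth_mat_cmat: "orth_mat n Q \<Longrightarrow> orth_mat n (cmat Q)"
proof -
  assume "orth_mat n Q"
  then have c: "Q \<in> carrier_mat n n" "Q\<^sup>T \<in> carrier_mat n n" "Q\<^sup>T * Q = 1\<^sub>m n" "Q * Q\<^sup>T = 1\<^sub>m n" by (auto simp: orth_mat_def)
  have t: "(cmat Q)\<^sup>T = cmat (Q\<^sup>T)" by (rule map_mat_transpose)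
  have "(cmat Q)\<^sup>T * cmat Q = 1\<^sub>m n" "cmat Q * (cmat Q)\<^sup>T = 1\<^sub>m n"
    unfolding t of_real_hom.mat_hom_mult[OF c(2,1), symmetric] of_real_hom.mat_hom_mult[OF c(1,2), symmetric] c(3,4)
    by (rule of_real_hom.mat_hom_one)+
  then show "orth_mat n (cmat Q)" using c(1) by (simp add: orth_mat_def)
qed

lemma cmat_spec_mat:
  assumes "orth_mat n Q"
  shows "cmat (spec_mat n Q f) = spec_mat n (cmat Q) (\<lambda>i. of_real (f i))"
proof (rule eq_matI)
  have Q: "Q \<in> carrier_mat n n" using assms by (simp add: orth_mat_def)
  fix i j assume "i < dim_row (spec_mat n (cmat Q) (\<lambda>i. of_real (f i)))" "j < dim_col (spec_mat n (cmat Q) (\<lambda>i. of_real (f i)))"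
  then have ij: "i < n" "j < n" by (auto simp: orth_mat_cmat[OF assms])
  show "cmat (spec_mat n Q f) $$ (i,j) = spec_mat n (cmat Q) (\<lambda>i. of_real (f i)) $$ (i,j)"
    using ij Q assms by (simp add: spec_mat_entry[OF assms] spec_mat_entry[OF orth_mat_cmat[OF assms]] cong: sum.cong_simp)
qed (simp_all add: assms orth_mat_cmat[OF assms])

definition cnorm :: "complex Matrix.vec \<Rightarrow> real" where
  "cnorm v = L2_set (\<lambda>i. cmod (v $ i)) {..<dim_vec v}"

lemma cnorm_nonneg [simp]: "0 \<le> cnorm v" by (simp add: cnorm_def L2_set_nonneg)

lemma cnorm_square: "(cnorm v)\<^sup>2 = (\<Sum>i<dim_vec v. (cmod (v $ i))\<^sup>2)"
  by (simp add: cnorm_def L2_set_def sum_nonneg)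

lemma scalar_prod_cnorm_le:
  assumes "u \<in> carrier_vec n" "v \<in> carrier_vec n"
  shows "cmod (u \<bullet> v) \<le> cnorm u * cnorm v"
proof -
  have "cmod (u \<bullet> v) \<le> (\<Sum>i<n. cmod (u $ i) * cmod (v $ i))"
    using assms by (auto simp: scalar_prod_def lessThan_atLeast0 norm_mult[symmetric] intro: norm_sum)
  also have "\<dots> \<le> cnorm u * cnorm v"
    using L2_set_mult_ineq[of "\<lambda>i. cmod (u $ i)" "\<lambda>i. cmod (v $ i)" "{..<n}"] assms
    by (simp add: cnorm_def)
  finally show ?thesis .
qed

lemma cnorm_orth_transpose:
  assumes Q: "orth_mat n Q" and v: "v \<in> carrier_vec n"
  shows "cnorm ((cmat Q)\<^sup>T *\<^sub>v v) = cnorm v"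
proof -
  have c: "Q \<in> carrier_mat n n" using Q by (simp add: orth_mat_def)
  let ?w = "(cmat Q)\<^sup>T *\<^sub>v v"
  have w: "?w $ i = (\<Sum>a<n. of_real (Q $$ (a,i)) * v $ a)" if "i < n" for i
    using mat_vec_entry[of "(cmat Q)\<^sup>T" n n v i] c v that by simp
  have "complex_of_real ((cnorm ?w)\<^sup>2) = (\<Sum>i<n. ?w $ i * cnj (?w $ i))"
    using c by (simp add: cnorm_square complex_norm_square[symmetric])
  also have "\<dots> = (\<Sum>i<n. \<Sum>a<n. \<Sum>b<n. (v $ a * cnj (v $ b)) * of_real (Q $$ (a,i) * Q $$ (b,i)))"
    by (intro sum.cong refl) (simp add: w sum_product mult_ac)
  also have "\<dots> = (\<Sum>a<n. \<Sum>b<n. \<Sum>i<n. (v $ a * cnj (v $ b)) * of_real (Q $$ (a,i) * Q $$ (b,i)))"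
    by (rule trans[OF sum.swap]) (rule sum.cong[OF refl], rule sum.swap)
  also have "\<dots> = (\<Sum>a<n. \<Sum>b<n. (v $ a * cnj (v $ b)) * of_real (of_bool (a = b)))"
    by (intro sum.cong refl) (simp add: sum_distrib_left[symmetric] of_real_sum[symmetric] orth_mat_rows[OF Q] del: of_real_sum of_real_mult)
  also have "\<dots> = (\<Sum>a<n. v $ a * cnj (v $ a))"
    by (intro sum.cong refl) (simp add: of_bool_def if_distrib[of "\<lambda>u. _ * u"] if_distrib[of of_real] cong: if_cong)
  also have "\<dots> = complex_of_real ((cnorm v)\<^sup>2)"
    using v by (simp add: cnorm_square complex_norm_square[symmetric])
  finally have "(cnorm ?w)\<^sup>2 = (cnorm v)\<^sup>2" by (simp only: of_real_eq_iff)
  then show ?thesis by simp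
qed

lemma spec_mat_vec:
  assumes Q: "orth_mat n Q" and v: "v \<in> carrier_vec n"
  shows "cnorm (spec_mat n (cmat Q) f *\<^sub>v v) = L2_set (\<lambda>i. cmod (f i) * cmod (((cmat Q)\<^sup>T *\<^sub>v v) $ i)) {..<n}"
proof -
  have cQ: "orth_mat n (cmat Q)" by (rule orth_mat_cmat[OF Q])
  then have c: "cmat Q \<in> carrier_mat n n" "(cmat Q)\<^sup>T \<in> carrier_mat n n" "(cmat Q)\<^sup>T * cmat Q = 1\<^sub>m n" by (auto simp: orth_mat_def)
  let ?w = "(cmat Q)\<^sup>T *\<^sub>v v"
  have "(cmat Q)\<^sup>T *\<^sub>v (spec_mat n (cmat Q) f *\<^sub>v v) = ((cmat Q)\<^sup>T * cmat Q) *\<^sub>v (mat_diag n f *\<^sub>v ?w)"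
    unfolding spec_mat_def using c(1,2) v
    by (simp add: assoc_mult_mat_vec[of _ n n _ n] assoc_mult_mat[of _ n n _ n _ n] mult_carrier_mat[of _ n n _ n] mult_mat_vec_carrier[of _ n n])
  also have "\<dots> = mat_diag n f *\<^sub>v ?w" unfolding c(3) using c v by (intro one_mult_mat_vec mult_mat_vec_carrier[of _ n n]) auto
  finally have e: "(cmat Q)\<^sup>T *\<^sub>v (spec_mat n (cmat Q) f *\<^sub>v v) = mat_diag n f *\<^sub>v ?w" .
  have "cnorm (spec_mat n (cmat Q) f *\<^sub>v v) = cnorm (mat_diag n f *\<^sub>v ?w)"
    using cnorm_orth_transpose[OF Q mult_mat_vec_carrier[OF spec_mat_carrier[OF cQ] v], of f] e by simp
  also have "\<dots> = L2_set (\<lambda>i. cmod (f i) * cmod (?w $ i)) {..<n}"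
  proof -
    have "(mat_diag n f *\<^sub>v ?w) $ i = f i * ?w $ i" if "i < n" for i
    proof -
      have "(mat_diag n f *\<^sub>v ?w) $ i = (\<Sum>l<n. (if i = l then f l else 0) * ?w $ l)"
        using mat_vec_entry[of "mat_diag n f" n n ?w i] c v that by (simp add: mat_diag_def)
      also have "\<dots> = (\<Sum>l<n. if l = i then f i * ?w $ i else 0)" by (intro sum.cong) auto
      finally show ?thesis using that by simp
    qed
    then show ?thesis unfolding cnorm_def L2_set_def by (simp add: norm_mult mat_diag_def)
  qed
  finally show ?thesis .
qed

text \<open>A predicate instead of the number, since only upper bounds of operator norms of complex matrices occur.\<close>

definition op_bounded :: "nat \<Rightarrow> real \<Rightarrow> complex mat \<Rightarrow> bool" where
  "op_bounded n c M \<longleftrightarrow> M \<in> carrier_mat n n \<and> 0 \<le> c \<and> (\<forall>v \<in> carrier_vec n. cnorm (M *\<^sub>v v) \<le> c * cnorm v)"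

lemma op_boundedD:
  assumes "op_bounded n c M"
  shows "M \<in> carrier_mat n n" "0 \<le> c" "v \<in> carrier_vec n \<Longrightarrow> cnorm (M *\<^sub>v v) \<le> c * cnorm v"
  using assms by (auto simp: op_bounded_def)

lemma op_bounded_spec_mat:
  assumes Q: "orth_mat n Q" and f: "\<And>i. i < n \<Longrightarrow> cmod (f i) \<le> c" and c: "0 \<le> c"
  shows "op_bounded n c (spec_mat n (cmat Q) f)"
  unfolding op_bounded_def
proof (intro conjI ballI)
  show "spec_mat n (cmat Q) f \<in> carrier_mat n n" by (simp add: orth_mat_cmat[OF Q])
  fix v :: "complex Matrix.vec" assume v: "v \<in> carrier_vec n"
  let ?w = "(cmat Q)\<^sup>T *\<^sub>v v"
  have "cnorm (spec_mat n (cmat Q) f *\<^sub>v v) \<le> L2_set (\<lambda>i. c * cmod (?w $ i)) {..<n}"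
    unfolding spec_mat_vec[OF Q v] using f by (intro L2_set_mono mult_right_mono) auto
  also have "\<dots> = c * cnorm ?w"
    unfolding cnorm_def using Q by (auto simp: L2_set_right_distrib c orth_mat_def)
  finally show "cnorm (spec_mat n (cmat Q) f *\<^sub>v v) \<le> c * cnorm v"
    unfolding cnorm_orth_transpose[OF Q v] .
qed (rule c)

lemma op_bounded_mult:
  assumes A: "op_bounded n a A" and B: "op_bounded n b B"
  shows "op_bounded n (a * b) (A * B)"
  unfolding op_bounded_def
proof (intro conjI ballI)
  note A' = op_boundedD[OF A] note B' = op_boundedD[OF B]
  show "A * B \<in> carrier_mat n n" "0 \<le> a * b" using A' B' by auto
  fix v :: "complex Matrix.vec" assume v: "v \<in> carrier_vec n"
  have Bv: "B *\<^sub>v v \<in> carrier_vec n" using B' v by simp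
  have "cnorm (A * B *\<^sub>v v) = cnorm (A *\<^sub>v (B *\<^sub>v v))"
    using assoc_mult_mat_vec[OF A'(1) B'(1) v] by simp
  also have "\<dots> \<le> a * cnorm (B *\<^sub>v v)" by (rule A'(3)[OF Bv])
  also have "\<dots> \<le> a * (b * cnorm v)" by (intro mult_left_mono B'(3)[OF v] A'(2))
  finally show "cnorm (A * B *\<^sub>v v) \<le> a * b * cnorm v" by simp
qed

lemma op_bounded_column:
  assumes M: "op_bounded n c M" and j: "j < n"
  shows "(\<Sum>i<n. (cmod (M $$ (i,j)))\<^sup>2) \<le> c\<^sup>2"
proof -
  note M' = op_boundedD[OF M]
  have e: "(M *\<^sub>v unit_vec n j) $ i = M $$ (i,j)" if "i < n" for i
  proof -
    have "(M *\<^sub>v unit_vec n j) $ i = (\<Sum>l<n. if l = j then M $$ (i,j) else 0)"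
      unfolding mat_vec_entry[OF M'(1) unit_vec_carrier that] using j by (intro sum.cong) auto
    then show ?thesis using j by simp
  qed
  have "cnorm (unit_vec n j) = 1"
  proof -
    have "(\<Sum>i<n. (cmod (unit_vec n j $ i))\<^sup>2) = (\<Sum>i<n. if i = j then 1 else 0)"
      using j by (intro sum.cong) auto
    then have "(cnorm (unit_vec n j))\<^sup>2 = 1" using j by (simp add: cnorm_square)
    then show ?thesis using cnorm_nonneg[of "unit_vec n j"] by (metis one_power2 power2_eq_iff_nonneg zero_le_one)
  qed
  then have "cnorm (M *\<^sub>v unit_vec n j) \<le> c" using M'(3)[of "unit_vec n j"] by simp
  then have "(cnorm (M *\<^sub>v unit_vec n j))\<^sup>2 \<le> c\<^sup>2" by (intro power_mono) auto
  then show ?thesis using M'(1) by (simp add: cnorm_square e del: index_mult_mat_vec)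
qed

text \<open>Every column is the image of a unit vector.\<close>

lemma op_bounded_frobenius:
  assumes M: "op_bounded n c M"
  shows "(\<Sum>i<n. \<Sum>j<n. (cmod (M $$ (i,j)))\<^sup>2) \<le> real n * c\<^sup>2"
proof -
  have "(\<Sum>i<n. \<Sum>j<n. (cmod (M $$ (i,j)))\<^sup>2) = (\<Sum>j<n. \<Sum>i<n. (cmod (M $$ (i,j)))\<^sup>2)" by (rule sum.swap)
  also have "\<dots> \<le> (\<Sum>j<n. c\<^sup>2)" by (intro sum_mono op_bounded_column[OF M]) auto
  finally show ?thesis by simp
qed

lemma op_bounded_mtrace:
  assumes M: "op_bounded n c M"
  shows "cmod (mtrace M) \<le> real n * c"
proof -
  note M' = op_boundedD[OF M]
  have "cmod (M $$ (j,j)) \<le> c" if "j < n" for j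
  proof -
    have "(cmod (M $$ (j,j)))\<^sup>2 \<le> (\<Sum>i<n. (cmod (M $$ (i,j)))\<^sup>2)"
      using that by (intro member_le_sum) auto
    also have "\<dots> \<le> c\<^sup>2" by (rule op_bounded_column[OF M that])
    finally show ?thesis using M'(2) by (simp add: power2_le_iff_abs_le)
  qed
  then have "(\<Sum>i<n. cmod (M $$ (i,i))) \<le> (\<Sum>i<n. c)" by (intro sum_mono) auto
  then show ?thesis unfolding mtrace_def using M'(1) by (simp add: order_trans[OF norm_sum])
qed

lemma op_bounded_bilinear:
  assumes M: "op_bounded n c M" and "u \<in> carrier_vec n" "v \<in> carrier_vec n"
  shows "cmod (u \<bullet> (M *\<^sub>v v)) \<le> c * cnorm u * cnorm v"
proof -
  note M' = op_boundedD[OF M]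
  have "cmod (u \<bullet> (M *\<^sub>v v)) \<le> cnorm u * cnorm (M *\<^sub>v v)"
    using M' assms by (intro scalar_prod_cnorm_le[of _ n]) auto
  also have "\<dots> \<le> cnorm u * (c * cnorm v)" using M' assms by (intro mult_left_mono) auto
  finally show ?thesis by (simp add: mult_ac)
qed

lemma spec_mat_quadratic:
  fixes Q :: "'a::comm_ring_1 mat"
  assumes Q: "orth_mat n Q" and y: "y \<in> carrier_vec n"
  shows "y \<bullet> (spec_mat n Q f *\<^sub>v y) = (\<Sum>i<n. f i * (\<Sum>a<n. Q $$ (a,i) * y $ a)\<^sup>2)"
proof -
  have "y \<bullet> (spec_mat n Q f *\<^sub>v y) = (\<Sum>a<n. y $ a * (spec_mat n Q f *\<^sub>v y) $ a)"
    using Q by (simp add: scalar_prod_def lessThan_atLeast0)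
  also have "\<dots> = (\<Sum>a<n. \<Sum>b<n. \<Sum>i<n. f i * (Q $$ (a,i) * y $ a * (Q $$ (b,i) * y $ b)))"
    by (intro sum.cong refl, subst mat_vec_entry[OF spec_mat_carrier[OF Q] y])
      (simp_all add: spec_mat_entry[OF Q] sum_distrib_left sum_distrib_right mult_ac)
  also have "\<dots> = (\<Sum>i<n. \<Sum>a<n. \<Sum>b<n. f i * (Q $$ (a,i) * y $ a * (Q $$ (b,i) * y $ b)))"
    by (rule trans[OF sum.cong[OF refl sum.swap] sum.swap])
  also have "\<dots> = (\<Sum>i<n. f i * (\<Sum>a<n. Q $$ (a,i) * y $ a)\<^sup>2)"
    unfolding power2_eq_square sum_product by (simp add: sum_distrib_left)
  finally show ?thesis .
qed

lemma spec_mat_quadratic_real: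
  assumes Q: "orth_mat n Q" and y: "y \<in> carrier_vec n"
  defines "w \<equiv> \<lambda>i. \<Sum>a<n. Q $$ (a,i) * y $ a"
  shows "cvec y \<bullet> (spec_mat n (cmat Q) f *\<^sub>v cvec y) = (\<Sum>i<n. f i * of_real ((w i)\<^sup>2))"
    and "(cnorm (spec_mat n (cmat Q) f *\<^sub>v cvec y))\<^sup>2 = (\<Sum>i<n. (cmod (f i))\<^sup>2 * (w i)\<^sup>2)"
proof -
  have cQ: "orth_mat n (cmat Q)" by (rule orth_mat_cmat[OF Q])
  have c: "Q \<in> carrier_mat n n" "cmat Q \<in> carrier_mat n n" using Q by (auto simp: orth_mat_def)
  have y': "cvec y \<in> carrier_vec n" using y by simp
  have w: "(\<Sum>a<n. cmat Q $$ (a,i) * cvec y $ a) = of_real (w i)" if "i < n" for i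
    using c y that by (simp add: w_def cong: sum.cong_simp)
  show "cvec y \<bullet> (spec_mat n (cmat Q) f *\<^sub>v cvec y) = (\<Sum>i<n. f i * of_real ((w i)\<^sup>2))"
    unfolding spec_mat_quadratic[OF cQ y'] by (intro sum.cong refl) (simp add: w)
  have "((cmat Q)\<^sup>T *\<^sub>v cvec y) $ i = of_real (w i)" if "i < n" for i
    unfolding w[OF that, symmetric] using mat_vec_entry[of "(cmat Q)\<^sup>T" n n "cvec y" i] c y that
    by (simp cong: sum.cong_simp)
  then show "(cnorm (spec_mat n (cmat Q) f *\<^sub>v cvec y))\<^sup>2 = (\<Sum>i<n. (cmod (f i))\<^sup>2 * (w i)\<^sup>2)"
    unfolding spec_mat_vec[OF Q y'] L2_set_def
    by (simp add: sum_nonneg power_mult_distrib)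
qed

section \<open>Positive semidefinite matrices, square roots and spectral distributions\<close>

lemma psd_spec_mat:
  assumes Q: "orth_mat n Q" and f: "\<And>i. i < n \<Longrightarrow> 0 \<le> f i"
  shows "psd_mat (spec_mat n Q f)"
  unfolding psd_mat_def sym_mat_def
  using Q by (auto simp: spec_mat_transpose spec_mat_quadratic intro!: sum_nonneg mult_nonneg_nonneg f)

lemma orth_mat_col:
  assumes Q: "orth_mat n Q" and i: "i < n"
  shows "col Q i \<in> carrier_vec n" "k < n \<Longrightarrow> (\<Sum>a<n. Q $$ (a,k) * col Q i $ a) = of_bool (k = i)"
proof -
  have c: "Q \<in> carrier_mat n n" using Q by (simp add: orth_mat_def)
  then show "col Q i \<in> carrier_vec n" using i by auto
  show "(\<Sum>a<n. Q $$ (a,k) * col Q i $ a) = of_bool (k = i)" if "k < n"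
    using orth_mat_cols[OF Q that i] c i by (simp cong: sum.cong_simp)
qed

lemma spec_mat_col_quadratic:
  assumes Q: "orth_mat n Q" and i: "i < n"
  shows "col Q i \<bullet> (spec_mat n Q f *\<^sub>v col Q i) = f i"
proof -
  have "col Q i \<bullet> (spec_mat n Q f *\<^sub>v col Q i) = (\<Sum>k<n. f k * (of_bool (k = i))\<^sup>2)"
    unfolding spec_mat_quadratic[OF Q orth_mat_col(1)[OF Q i]]
    by (intro sum.cong refl) (simp add: orth_mat_col(2)[OF Q i])
  also have "\<dots> = (\<Sum>k<n. if k = i then f i else 0)" by (intro sum.cong) auto
  finally show ?thesis using i by simp
qed

lemma psd_diagonalizable:
  assumes A: "A \<in> carrier_mat n n" and psd: "psd_mat A"
  obtains Q l where "orth_mat n Q" "A = spec_mat n Q l" "\<And>i. i < n \<Longrightarrow> 0 \<le> l i"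
proof -
  have "A\<^sup>T = A" using psd by (simp add: psd_mat_def sym_mat_def)
  from symmetric_diagonalizable[OF A this] obtain Q l where Q: "orth_mat n Q" "A = spec_mat n Q l"
    by (auto simp: diagonalizes_iff)
  have "0 \<le> l i" if "i < n" for i
    using psd A orth_mat_col(1)[OF Q(1) that] spec_mat_col_quadratic[OF Q(1) that, of l]
    unfolding psd_mat_def Q(2)[symmetric] by auto
  then show ?thesis using that Q by blast
qed

lemma vec_l2norm_cnorm: "vec_l2norm v = cnorm (cvec v)"
  by (simp add: vec_l2norm_def cnorm_def L2_set_def scalar_prod_def lessThan_atLeast0 power2_eq_square)

text \<open>A unit eigenvector is one of the vectors over which the supremum is taken.\<close>

lemma eigenvalue_le_op_norm:
  assumes Q: "orth_mat n Q" and i: "i < n"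
  shows "\<bar>l i\<bar> \<le> op_norm (spec_mat n Q l)"
proof -
  have c: "Q \<in> carrier_mat n n" using Q by (simp add: orth_mat_def)
  let ?A = "spec_mat n Q l"
  let ?U = "{v \<in> carrier_vec (dim_col ?A). vec_l2norm v = 1}"
  define K where "K = (\<Sum>i<n. \<bar>l i\<bar>)"
  have "cmod (complex_of_real (l k)) \<le> K" if "k < n" for k
    unfolding K_def using that member_le_sum[of k "{..<n}" "\<lambda>i. \<bar>l i\<bar>"] by simp
  then have b: "op_bounded n K (spec_mat n (cmat Q) (\<lambda>i. of_real (l i)))"
    by (intro op_bounded_spec_mat[OF Q]) (auto simp: K_def sum_nonneg)
  have e: "cvec (?A *\<^sub>v v) = spec_mat n (cmat Q) (\<lambda>i. of_real (l i)) *\<^sub>v cvec v" if "v \<in> carrier_vec n" for v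
    unfolding cmat_spec_mat[OF Q, symmetric] by (rule of_real_hom.mult_mat_vec_hom[OF spec_mat_carrier[OF Q] that])
  have bdd: "bdd_above ((\<lambda>v. vec_l2norm (?A *\<^sub>v v)) ` ?U)"
  proof (rule bdd_aboveI2)
    fix v assume v: "v \<in> ?U"
    then have "cvec v \<in> carrier_vec n" "v \<in> carrier_vec n" using Q by auto
    then show "vec_l2norm (?A *\<^sub>v v) \<le> K"
      using op_boundedD(3)[OF b, of "cvec v"] v by (simp add: vec_l2norm_cnorm e)
  qed
  have ci: "col Q i \<in> carrier_vec n" by (rule orth_mat_col[OF Q i])
  have "(vec_l2norm (col Q i))\<^sup>2 = 1"
    using orth_mat_col(2)[OF Q i i] c i
    by (simp add: vec_l2norm_def scalar_prod_def lessThan_atLeast0 sum_nonneg cong: sum.cong_simp)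
  then have "vec_l2norm (col Q i) = 1"
    using cnorm_nonneg[of "cvec (col Q i)"] by (auto simp: vec_l2norm_cnorm power2_eq_1_iff)
  then have u: "col Q i \<in> ?U" using ci Q by simp
  have "(vec_l2norm (?A *\<^sub>v col Q i))\<^sup>2 = (\<Sum>k<n. (cmod (of_real (l k)))\<^sup>2 * (of_bool (k = i))\<^sup>2)"
    unfolding vec_l2norm_cnorm e[OF ci] spec_mat_quadratic_real(2)[OF Q ci]
    by (intro sum.cong refl) (simp add: orth_mat_col(2)[OF Q i])
  also have "\<dots> = (\<Sum>k<n. if k = i then (l i)\<^sup>2 else 0)" by (intro sum.cong) auto
  also have "\<dots> = \<bar>l i\<bar>\<^sup>2" using i by simp
  finally have "vec_l2norm (?A *\<^sub>v col Q i) = \<bar>l i\<bar>"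
    by (subst (asm) power2_eq_iff_nonneg) (simp_all add: vec_l2norm_cnorm)
  then show ?thesis unfolding op_norm_def using cSUP_upper[OF u bdd] by simp
qed

text \<open>Let \<open>v\<close> be an eigenvector of \<open>B - C\<close> with eigenvalue \<open>l\<close>. Expanding \<open>v \<bullet> (B B - C C) v = 0\<close> gives
  \<open>l (v \<bullet> B v + v \<bullet> C v) = 0\<close>. Either \<open>l = 0\<close>, or both nonnegative terms vanish and with them their difference,
  which is a multiple of \<open>l\<close>.\<close>

lemma psd_square_root_unique:
  fixes B C :: "real mat"
  assumes B: "B \<in> carrier_mat n n" "psd_mat B" and C: "C \<in> carrier_mat n n" "psd_mat C" and eq: "B * B = C * C"
  shows "B = C"
proof -
  have sym: "B\<^sup>T = B" "C\<^sup>T = C" using B C by (auto simp: psd_mat_def sym_mat_def)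
  define X where "X = B - C"
  have X: "X \<in> carrier_mat n n" using B C by (auto simp: X_def)
  have "X\<^sup>T = X" unfolding X_def using B C sym by (simp add: transpose_minus)
  from symmetric_diagonalizable[OF X this] obtain R l where R: "orth_mat n R" "X = spec_mat n R l"
    by (auto simp: diagonalizes_iff)
  have "l k = 0" if k: "k < n" for k
  proof -
    define v where "v = col R k"
    have v: "v \<in> carrier_vec n" unfolding v_def by (rule orth_mat_col[OF R(1) k])
    have vXv: "v \<bullet> (X *\<^sub>v v) = l k" unfolding v_def R(2) by (rule spec_mat_col_quadratic[OF R(1) k])
    have Xv: "X *\<^sub>v v = l k \<cdot>\<^sub>v v"
    proof (rule eq_vecI)
      fix i assume "i < dim_vec (l k \<cdot>\<^sub>v v)"
      then have i: "i < n" using v by simp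
      have "(X *\<^sub>v v) $ i = (\<Sum>b<n. (\<Sum>m<n. R $$ (i,m) * l m * R $$ (b,m)) * v $ b)"
        unfolding mat_vec_entry[OF X v i] by (intro sum.cong refl) (simp add: R(2) spec_mat_entry[OF R(1) i])
      also have "\<dots> = (\<Sum>b<n. \<Sum>m<n. R $$ (i,m) * l m * (R $$ (b,m) * v $ b))"
        by (simp add: sum_distrib_right mult.assoc)
      also have "\<dots> = (\<Sum>m<n. R $$ (i,m) * l m * (\<Sum>b<n. R $$ (b,m) * v $ b))"
        by (subst sum.swap) (simp add: sum_distrib_left)
      also have "\<dots> = (\<Sum>m<n. if m = k then R $$ (i,k) * l k else 0)"
        unfolding v_def by (intro sum.cong refl) (simp add: orth_mat_col(2)[OF R(1) k])
      also have "\<dots> = l k * v $ i" using k i R(1) unfolding v_def by (auto simp: orth_mat_def)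
      finally show "(X *\<^sub>v v) $ i = (l k \<cdot>\<^sub>v v) $ i" using v i by simp
    qed (use X v in auto)
    have 0: "0 \<le> v \<bullet> (B *\<^sub>v v)" "0 \<le> v \<bullet> (C *\<^sub>v v)" using B C v by (auto simp: psd_mat_def)
    have "(B * B) *\<^sub>v v = (C * C) *\<^sub>v v" by (simp add: eq)
    then have BC: "B *\<^sub>v (B *\<^sub>v v) = C *\<^sub>v (C *\<^sub>v v)"
      using B(1) C(1) v by (simp add: assoc_mult_mat_vec[of _ n n _ n])
    have Bv: "B *\<^sub>v v \<in> carrier_vec n" and Cv: "C *\<^sub>v v \<in> carrier_vec n" using B C v by auto
    have Bd: "B *\<^sub>v v = C *\<^sub>v v + l k \<cdot>\<^sub>v v"
      unfolding Xv[symmetric] X_def using B(1) C(1) v Bv Cv by (auto simp: minus_mult_distrib_mat_vec[of _ n n])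
    have adj: "u \<bullet> (D *\<^sub>v w) = (D *\<^sub>v u) \<bullet> w" if "D \<in> carrier_mat n n" "D\<^sup>T = D" "u \<in> carrier_vec n" "w \<in> carrier_vec n" for D :: "real mat" and u w
      using transpose_vec_mult_scalar[OF that(1,4,3)] that(2) by simp
    have "(B *\<^sub>v v) \<bullet> (B *\<^sub>v v) = (C *\<^sub>v v) \<bullet> (C *\<^sub>v v)"
      using adj[OF B(1) sym(1) v Bv] adj[OF C(1) sym(2) v Cv] BC by simp
    moreover have "(B *\<^sub>v v) \<bullet> (B *\<^sub>v v) = (C *\<^sub>v v) \<bullet> (B *\<^sub>v v) + l k * (v \<bullet> (B *\<^sub>v v))"
      by (subst (1) Bd) (use Bv Cv v in \<open>simp add: add_scalar_prod_distrib[of _ n]\<close>)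
    moreover have "(C *\<^sub>v v) \<bullet> (B *\<^sub>v v) = (C *\<^sub>v v) \<bullet> (C *\<^sub>v v) + l k * ((C *\<^sub>v v) \<bullet> v)"
      by (subst (1) Bd) (use Bv Cv v in \<open>simp add: scalar_prod_add_distrib[of _ n]\<close>)
    moreover have "(C *\<^sub>v v) \<bullet> v = v \<bullet> (C *\<^sub>v v)" using Cv v by (rule comm_scalar_prod)
    ultimately have "l k * (v \<bullet> (B *\<^sub>v v) + v \<bullet> (C *\<^sub>v v)) = 0" by (simp add: algebra_simps)
    moreover have "v \<bullet> (X *\<^sub>v v) = v \<bullet> (B *\<^sub>v v) - v \<bullet> (C *\<^sub>v v)"
      unfolding X_def using B(1) C(1) v Bv Cv by (simp add: minus_mult_distrib_mat_vec[of _ n n] scalar_prod_minus_distrib[of _ n])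
    ultimately show "l k = 0" using 0 vXv by (auto simp: add_nonneg_eq_0_iff)
  qed
  then have "X $$ (i,j) = 0" if "i < n" "j < n" for i j
    unfolding R(2) using that by (simp add: spec_mat_entry[OF R(1)])
  then show "B = C" using B(1) C(1) unfolding X_def by (intro eq_matI) auto
qed

text \<open>Uniqueness is what makes the definite description of the square root computable.\<close>

lemma psd_sqrt_spec_mat:
  assumes Q: "orth_mat n Q" and l: "\<And>i. i < n \<Longrightarrow> 0 \<le> l i"
  shows "psd_sqrt (spec_mat n Q l) = spec_mat n Q (\<lambda>i. sqrt (l i))"
proof -
  let ?A = "spec_mat n Q l" and ?B = "spec_mat n Q (\<lambda>i. sqrt (l i))"
  have BB: "?B * ?B = ?A"
    unfolding spec_mat_mult[OF Q] by (intro eq_matI) (use Q l in \<open>auto simp: spec_mat_entry intro!: sum.cong\<close>)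
  have B: "?B \<in> carrier_mat n n" "psd_mat ?B" using Q l by (auto intro!: psd_spec_mat)
  show ?thesis
    unfolding psd_sqrt_def
  proof (rule the_equality)
    show "?B \<in> carrier_mat (dim_row ?A) (dim_row ?A) \<and> psd_mat ?B \<and> ?B * ?B = ?A" using B BB Q by simp
    fix C assume "C \<in> carrier_mat (dim_row ?A) (dim_row ?A) \<and> psd_mat C \<and> C * C = ?A"
    then show "C = ?B" using psd_square_root_unique[of C n ?B] B BB Q by simp
  qed
qed

text \<open>The measure whose distribution function is the empirical spectral distribution of a matrix with
  eigenvalues \<open>l 0, \<dots>, l (n - 1)\<close>.\<close>

definition point_distribution :: "nat \<Rightarrow> (nat \<Rightarrow> real) \<Rightarrow> real measure" where
  "point_distribution n l = distr (measure_pmf (pmf_of_set {..<n})) borel l"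

lemma point_distribution_real: "real_distribution (point_distribution n l)"
  unfolding point_distribution_def by (intro prob_space.real_distribution_distr measure_pmf.prob_space_axioms) simp

lemma point_distribution_integral:
  fixes f :: "real \<Rightarrow> 'b::{banach, second_countable_topology}"
  assumes "n > 0" and f: "f \<in> borel_measurable borel"
  shows "(\<integral>t. f t \<partial>point_distribution n l) = (\<Sum>i<n. f (l i)) /\<^sub>R real n"
proof -
  have "(\<integral>t. f t \<partial>point_distribution n l) = (\<integral>i. f (l i) \<partial>measure_pmf (pmf_of_set {..<n}))"
    unfolding point_distribution_def using f by (intro integral_distr) auto
  also have "\<dots> = (\<Sum>i<n. f (l i)) /\<^sub>R real n"
    using assms by (subst integral_measure_pmf[of "{..<n}"])
      (auto simp: lessThan_empty_iff sum_distrib_left scaleR_right.sum divide_inverse)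
  finally show ?thesis .
qed

lemma char_poly_spec_mat:
  fixes Q :: "'a::idom mat"
  assumes Q: "orth_mat n Q"
  shows "char_poly (spec_mat n Q l) = (\<Prod>i<n. [:- l i, 1:])"
proof -
  have "similar_mat (spec_mat n Q l) (mat_diag n l)"
    using Q by (intro similar_matI[of _ _ Q "Q\<^sup>T" n]) (auto simp: spec_mat_def orth_mat_def)
  then have "char_poly (spec_mat n Q l) = char_poly (mat_diag n l)" by (rule char_poly_similar)
  also have "\<dots> = (\<Prod>a\<leftarrow>diag_mat (mat_diag n l). [:- a, 1:])"
    by (rule char_poly_upper_triangular[of _ n]) (auto simp: mat_diag_def upper_triangular_def)
  also have "diag_mat (mat_diag n l) = map l [0..<n]"
    by (auto simp: diag_mat_def mat_diag_def)
  also have "(\<Prod>a\<leftarrow>map l [0..<n]. [:- a, 1:]) = (\<Prod>i<n. [:- l i, 1:])"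
    by (simp add: prod.distinct_set_conv_list[symmetric] lessThan_atLeast0 o_def)
  finally show ?thesis .
qed

lemma esd_spec_mat:
  assumes Q: "orth_mat n Q" and n: "n > 0"
  shows "esd (spec_mat n Q l) = cdf (point_distribution n l)"
proof -
  have nz: "(\<Prod>i<m. [:- l i, 1:]) \<noteq> 0" for m by simp
  have pr: "proots (\<Prod>i<m. [:- l i, 1:]) = image_mset l (mset_set {..<m})" for m
  proof (induction m)
    case (Suc m)
    have "proots ((\<Prod>i<m. [:- l i, 1:]) * [:- l m, 1:]) = proots (\<Prod>i<m. [:- l i, 1:]) + proots [:- l m, 1:]"
      by (rule proots_mult) (use nz in auto)
    also have "(\<Prod>i<m. [:- l i, 1:]) * [:- l m, 1:] = (\<Prod>i<Suc m. [:- l i, 1:])"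
      by (rule prod.lessThan_Suc[symmetric])
    finally show ?case unfolding Suc by (simp only: lessThan_Suc) simp
  qed simp
  show ?thesis
  proof
    fix x
    have "{#t \<in># image_mset l (mset_set {..<n}). t \<le> x#} = image_mset l (mset_set {i \<in> {..<n}. l i \<le> x})"
      by (simp add: filter_mset_image_mset filter_mset_mset_set)
    then have "esd (spec_mat n Q l) x = real (card {i \<in> {..<n}. l i \<le> x}) / real n"
      unfolding esd_def char_poly_spec_mat[OF Q] pr using Q by simp
    also have "\<dots> = measure (measure_pmf (pmf_of_set {..<n})) {i. l i \<le> x}"
      using n by (subst measure_pmf_of_set) (auto simp: lessThan_empty_iff intro!: arg_cong[where f = card])
    also have "\<dots> = cdf (point_distribution n l) x"
      unfolding cdf_def point_distribution_def by (subst measure_distr) (auto simp: vimage_def)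
    finally show "esd (spec_mat n Q l) x = cdf (point_distribution n l) x" .
  qed
qed

section \<open>Resolvents and rank-one perturbations\<close>

definition shifted :: "real mat \<Rightarrow> complex \<Rightarrow> complex mat" where
  "shifted A z = z \<cdot>\<^sub>m 1\<^sub>m (dim_row A) - cmat A"

text \<open>Cramer's rule is used as the definition because it exhibits the entries as rational functions of the entries
  of \<open>A\<close>, hence as random variables when \<open>A\<close> is random.\<close>

definition resolvent :: "real mat \<Rightarrow> complex \<Rightarrow> complex mat" where
  "resolvent A z = (1 / Determinant.det (shifted A z)) \<cdot>\<^sub>m adj_mat (shifted A z)"

lemma resolvent_spec_mat:
  fixes l :: "nat \<Rightarrow> real"
  assumes Q: "orth_mat n Q" and z: "Im z > 0"
  defines "W \<equiv> spec_mat n (cmat Q) (\<lambda>i. 1 / (z - of_real (l i)))"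
  shows "resolvent (spec_mat n Q l) z = W" "shifted (spec_mat n Q l) z * W = 1\<^sub>m n" "W * shifted (spec_mat n Q l) z = 1\<^sub>m n"
proof -
  let ?K = "shifted (spec_mat n Q l) z"
  have cQ: "orth_mat n (cmat Q)" by (rule orth_mat_cmat[OF Q])
  have nz: "z - of_real (l i) \<noteq> 0" for i using z by (auto simp: complex_eq_iff)
  have one_smult_mat: "1 \<cdot>\<^sub>m M = M" for M :: "complex mat" by (rule eq_matI) auto
  have K: "?K = spec_mat n (cmat Q) (\<lambda>i. z - of_real (l i))"
    using spec_mat_affine[OF cQ, of z 1 "\<lambda>i. of_real (l i)"] Q
    by (simp add: shifted_def cmat_spec_mat[OF Q] one_smult_mat)
  have one: "spec_mat n (cmat Q) (\<lambda>i. (z - of_real (l i)) * (1 / (z - of_real (l i)))) = 1\<^sub>m n"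
    "spec_mat n (cmat Q) (\<lambda>i. 1 / (z - of_real (l i)) * (z - of_real (l i))) = 1\<^sub>m n"
    using spec_mat_one[OF cQ] nz by simp_all
  show KW: "?K * W = 1\<^sub>m n" and "W * ?K = 1\<^sub>m n"
    unfolding K W_def spec_mat_mult[OF cQ] by (rule one)+
  have Kc: "?K \<in> carrier_mat n n" and Wc: "W \<in> carrier_mat n n" unfolding K W_def using cQ by auto
  have "Determinant.det ?K * Determinant.det W = 1"
    using det_mult[OF Kc Wc] KW by simp
  then have d: "Determinant.det ?K \<noteq> 0" by auto
  have scale: "(1 / c) \<cdot>\<^sub>m (c \<cdot>\<^sub>m 1\<^sub>m n) = 1\<^sub>m n" if "c \<noteq> 0" for c :: complex
    using that by (intro eq_matI) auto
  have R: "resolvent (spec_mat n Q l) z \<in> carrier_mat n n" "resolvent (spec_mat n Q l) z * ?K = 1\<^sub>m n"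
    unfolding resolvent_def using adj_mat[OF Kc] Kc scale[OF d] by (simp_all add: mult_smult_assoc_mat[of _ n n _ n])
  have "resolvent (spec_mat n Q l) z = resolvent (spec_mat n Q l) z * (?K * W)" unfolding KW using R by simp
  also have "\<dots> = (resolvent (spec_mat n Q l) z * ?K) * W" by (rule assoc_mult_mat[OF R(1) Kc Wc, symmetric])
  also have "\<dots> = W" unfolding R(2) using Wc by simp
  finally show "resolvent (spec_mat n Q l) z = W" .
qed

text \<open>Everything is read off from the eigenvalues \<open>1 / (z - l)\<close> of the resolvent. Their modulus is at most
  \<open>1 / Im z\<close>; since \<open>l \<ge> 0\<close>, also \<open>Im (z / (z - l)) \<le> 0\<close>, and this sign keeps the denominators of the
  leave-one-out formulas and of the Marchenko--Pastur equation away from \<open>0\<close>.\<close>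

lemma resolvent_psd:
  assumes S: "S \<in> carrier_mat n n" "psd_mat S" and z: "Im z > 0"
  shows "resolvent S z \<in> carrier_mat n n"
    and "resolvent S z * shifted S z = 1\<^sub>m n" "shifted S z * resolvent S z = 1\<^sub>m n"
    and "(resolvent S z)\<^sup>T = resolvent S z"
    and "op_bounded n (1 / Im z) (resolvent S z)"
    and "y \<in> carrier_vec n \<Longrightarrow> Im (cvec y \<bullet> (resolvent S z *\<^sub>v cvec y)) = - Im z * (cnorm (resolvent S z *\<^sub>v cvec y))\<^sup>2"
    and "y \<in> carrier_vec n \<Longrightarrow> Im (z * (cvec y \<bullet> (resolvent S z *\<^sub>v cvec y))) \<le> 0"
    and "Im (z * mtrace (resolvent S z)) \<le> 0"
proof -
  obtain Q l where Q: "orth_mat n Q" "S = spec_mat n Q l" and l: "\<And>i. i < n \<Longrightarrow> 0 \<le> l i"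
    using psd_diagonalizable[OF S] by blast
  have cQ: "orth_mat n (cmat Q)" by (rule orth_mat_cmat[OF Q(1)])
  define f where "f i = 1 / (z - of_real (l i))" for i
  have G: "resolvent S z = spec_mat n (cmat Q) f"
    "resolvent S z * shifted S z = 1\<^sub>m n" "shifted S z * resolvent S z = 1\<^sub>m n"
    unfolding f_def Q(2) resolvent_spec_mat(1)[OF Q(1) z] by (auto intro: resolvent_spec_mat[OF Q(1) z])
  show "resolvent S z * shifted S z = 1\<^sub>m n" "shifted S z * resolvent S z = 1\<^sub>m n" by (rule G)+
  show "resolvent S z \<in> carrier_mat n n" "(resolvent S z)\<^sup>T = resolvent S z"
    unfolding G(1) using cQ by (auto simp: spec_mat_transpose)
  have nz: "z - of_real (l i) \<noteq> 0" for i using z by (auto simp: complex_eq_iff)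
  have Imf: "Im (f i) = - Im z * (cmod (f i))\<^sup>2" for i
    unfolding f_def by (simp add: norm_divide power_divide Im_divide cmod_power2)
  have Imzf: "Im (z * f i) \<le> 0" if "i < n" for i
  proof -
    have "Im (z * f i) = - (l i * Im z) / (cmod (z - of_real (l i)))\<^sup>2"
      unfolding f_def by (simp add: Im_divide cmod_power2 algebra_simps)
    then show ?thesis using l[OF that] z by (simp add: divide_nonpos_nonneg)
  qed
  have "cmod (f i) \<le> 1 / Im z" for i
  proof -
    have "Im z \<le> cmod (z - of_real (l i))" using abs_Im_le_cmod[of "z - of_real (l i)"] by simp
    then show ?thesis unfolding f_def using z by (simp add: norm_divide frac_le)
  qed
  then show "op_bounded n (1 / Im z) (resolvent S z)"
    unfolding G(1) using z by (intro op_bounded_spec_mat[OF Q(1)]) auto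
  show "Im (z * mtrace (resolvent S z)) \<le> 0"
    unfolding G(1) mtrace_spec_mat[OF cQ] sum_distrib_left Im_sum using Imzf by (intro sum_nonpos) auto
  have Im_mult: "Im (a * (b * of_real r)) = Im (a * b) * r" for a b r by (simp add: algebra_simps)
  assume y: "y \<in> carrier_vec n"
  note q = spec_mat_quadratic_real[OF Q(1) y, of f]
  show "Im (cvec y \<bullet> (resolvent S z *\<^sub>v cvec y)) = - Im z * (cnorm (resolvent S z *\<^sub>v cvec y))\<^sup>2"
    unfolding G(1) q Im_sum sum_distrib_left
    by (intro sum.cong refl) (simp add: Imf del: of_real_power)
  show "Im (z * (cvec y \<bullet> (resolvent S z *\<^sub>v cvec y))) \<le> 0"
    unfolding G(1) q sum_distrib_left Im_sum
  proof (intro sum_nonpos)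
    fix i assume "i \<in> {..<n}"
    have "Im (z * (f i * of_real ((\<Sum>a<n. Q $$ (a, i) * y $ a)\<^sup>2))) = Im (z * f i) * (\<Sum>a<n. Q $$ (a, i) * y $ a)\<^sup>2"
      by (rule Im_mult)
    also have "\<dots> \<le> 0" using Imzf \<open>i \<in> {..<n}\<close> by (intro mult_nonpos_nonneg) auto
    finally show "Im (z * (f i * of_real ((\<Sum>a<n. Q $$ (a, i) * y $ a)\<^sup>2))) \<le> 0" .
  qed
qed

text \<open>The link between the resolvent and the Stieltjes transform of the empirical spectral distribution.\<close>

lemma psd_spectral_distribution:
  assumes S: "S \<in> carrier_mat n n" "psd_mat S" and n: "n > 0"
  shows "\<exists>\<nu>. real_distribution \<nu> \<and> cdf \<nu> = esd S \<and> (AE t in \<nu>. 0 \<le> t) \<and>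
    (\<forall>z. Im z > 0 \<longrightarrow> stieltjes \<nu> z = mtrace (resolvent S z) / of_nat n)"
proof -
  obtain Q l where Q: "orth_mat n Q" "S = spec_mat n Q l" and l: "\<And>i. i < n \<Longrightarrow> 0 \<le> l i"
    using psd_diagonalizable[OF S] by blast
  have cQ: "orth_mat n (cmat Q)" by (rule orth_mat_cmat[OF Q(1)])
  let ?\<nu> = "point_distribution n l"
  have "stieltjes ?\<nu> z = mtrace (resolvent S z) / of_nat n" if z: "Im z > 0" for z
    unfolding Q(2) resolvent_spec_mat(1)[OF Q(1) z] mtrace_spec_mat[OF cQ] stieltjes_def
    using n by (subst point_distribution_integral) (auto simp: scaleR_conv_of_real divide_inverse)
  moreover have "AE t in ?\<nu>. 0 \<le> t"
    unfolding point_distribution_def using n l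
    by (subst AE_distr_iff) (auto simp: AE_measure_pmf_iff lessThan_empty_iff)
  ultimately show ?thesis
    using point_distribution_real esd_spec_mat[OF Q(1) n, of l] Q(2) by (intro exI[of _ ?\<nu>]) auto
qed

definition outer :: "nat \<Rightarrow> complex Matrix.vec \<Rightarrow> complex Matrix.vec \<Rightarrow> complex mat" where
  "outer n u v = Matrix.mat n n (\<lambda>(a,b). u $ a * v $ b)"

lemma outer_carrier [simp]: "outer n u v \<in> carrier_mat n n"
  by (simp add: outer_def)

lemma mult_outer:
  assumes M: "M \<in> carrier_mat n n" and u: "u \<in> carrier_vec n"
  shows "M * outer n u v = outer n (M *\<^sub>v u) v"
proof (rule eq_matI)
  fix i j assume "i < dim_row (outer n (M *\<^sub>v u) v)" "j < dim_col (outer n (M *\<^sub>v u) v)"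
  then have ij: "i < n" "j < n" by (auto simp: outer_def)
  show "(M * outer n u v) $$ (i,j) = outer n (M *\<^sub>v u) v $$ (i,j)"
    unfolding mat_entry_mult[OF M outer_carrier ij] using ij
    by (simp add: outer_def mat_vec_entry[OF M u] sum_distrib_right mult.assoc del: index_mult_mat_vec)
qed (use M in \<open>auto simp: outer_def\<close>)

lemma outer_mult:
  assumes M: "M \<in> carrier_mat n n" and v: "v \<in> carrier_vec n"
  shows "outer n u v * M = outer n u (M\<^sup>T *\<^sub>v v)"
proof (rule eq_matI)
  have MT: "M\<^sup>T \<in> carrier_mat n n" using M by simp
  fix i j assume "i < dim_row (outer n u (M\<^sup>T *\<^sub>v v))" "j < dim_col (outer n u (M\<^sup>T *\<^sub>v v))"
  then have ij: "i < n" "j < n" by (auto simp: outer_def)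
  show "(outer n u v * M) $$ (i,j) = outer n u (M\<^sup>T *\<^sub>v v) $$ (i,j)"
    unfolding mat_entry_mult[OF outer_carrier M ij] using ij M
    by (simp add: outer_def mat_vec_entry[OF MT v] sum_distrib_left mult_ac del: index_mult_mat_vec cong: sum.cong_simp)
qed (use M in \<open>auto simp: outer_def\<close>)

lemma mtrace_outer: "u \<in> carrier_vec n \<Longrightarrow> v \<in> carrier_vec n \<Longrightarrow> mtrace (outer n u v) = u \<bullet> v"
  by (simp add: mtrace_def outer_def scalar_prod_def lessThan_atLeast0)

lemma resolvent_identity:
  assumes S: "S \<in> carrier_mat n n" "psd_mat S" and S': "S' \<in> carrier_mat n n" "psd_mat S'" and z: "Im z > 0"
  shows "resolvent S' z - resolvent S z = resolvent S' z * (cmat S' - cmat S) * resolvent S z"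
proof -
  note R = resolvent_psd[OF S z] and R' = resolvent_psd[OF S' z]
  let ?G = "resolvent S z" and ?G' = "resolvent S' z"
  have K: "shifted S z \<in> carrier_mat n n" "shifted S' z \<in> carrier_mat n n" using S S' by (auto simp: shifted_def)
  have e: "cmat S' - cmat S = shifted S z - shifted S' z"
    using S S' by (intro eq_matI) (auto simp: shifted_def)
  have "?G' * (cmat S' - cmat S) * ?G = ?G' * (shifted S z * ?G) - (?G' * shifted S' z) * ?G"
    unfolding e using R(1) R'(1) K
    by (simp add: mult_minus_distrib_mat[of _ n n _ n] minus_mult_distrib_mat[of _ n n _ _ n] assoc_mult_mat[of _ n n _ n _ n] mult_carrier_mat[of _ n n _ n])
  also have "\<dots> = ?G' - ?G" unfolding R(3) R'(2) using R(1) R'(1) by simp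
  finally show ?thesis by simp
qed

text \<open>The Sherman--Morrison formula with \<open>g = G y\<close>. The imaginary part of \<open>q\<close> is
  \<open>- Im z \<cdot> c \<bar>g\<bar>\<^sup>2\<close>, so \<open>1 - q\<close> is at least as large as the numerator \<open>c \<bar>g\<bar>\<^sup>2\<close> times \<open>Im z\<close>. This is why
  the last bound does not involve the length of \<open>y\<close>.\<close>

lemma rank_one_perturbation:
  assumes S: "S \<in> carrier_mat n n" "psd_mat S" and S': "S' \<in> carrier_mat n n" "psd_mat S'"
    and y: "y \<in> carrier_vec n" and c: "0 \<le> c"
    and S'S: "cmat S' - cmat S = of_real c \<cdot>\<^sub>m outer n (cvec y) (cvec y)" and z: "Im z > 0"
  defines "G \<equiv> resolvent S z" and "G' \<equiv> resolvent S' z"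
  defines "g \<equiv> G *\<^sub>v cvec y" and "q \<equiv> of_real c * (cvec y \<bullet> (G *\<^sub>v cvec y))"
  shows "1 - q \<noteq> 0" "cmod (1 / (1 - q)) \<le> cmod z / Im z" "cmod (1 / (1 - q)) * (c * (cnorm g)\<^sup>2) \<le> 1 / Im z"
    and "G' *\<^sub>v cvec y = (1 / (1 - q)) \<cdot>\<^sub>v g"
    and "G' - G = (of_real c / (1 - q)) \<cdot>\<^sub>m outer n g g"
    and "M \<in> carrier_mat n n \<Longrightarrow> mtrace (M * G') - mtrace (M * G) = of_real c / (1 - q) * (g \<bullet> (M *\<^sub>v g))"
    and "op_bounded n a M \<Longrightarrow> cmod (mtrace (M * G') - mtrace (M * G)) \<le> a / Im z"
proof -
  note R = resolvent_psd[OF S z, folded G_def] and R' = resolvent_psd[OF S' z, folded G'_def]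
  have y': "cvec y \<in> carrier_vec n" using y by simp
  have g: "g \<in> carrier_vec n" unfolding g_def using R(1) y' by simp
  have Imq: "Im q = - Im z * (c * (cnorm g)\<^sup>2)"
    using R(6)[OF y] unfolding q_def g_def by simp
  have "Im (z * q) = c * Im (z * (cvec y \<bullet> (G *\<^sub>v cvec y)))"
    unfolding q_def by (simp add: algebra_simps)
  then have "Im (z * q) \<le> 0" using R(7)[OF y] c by (simp add: mult_nonneg_nonpos)
  then have "Im z \<le> Im (z * (1 - q))" by (simp add: algebra_simps)
  also have "\<dots> \<le> cmod z * cmod (1 - q)" using abs_Im_le_cmod[of "z * (1 - q)"] by (simp add: norm_mult)
  finally have low: "Im z \<le> cmod z * cmod (1 - q)" .
  then show nz: "1 - q \<noteq> 0" using z by auto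
  then show "cmod (1 / (1 - q)) \<le> cmod z / Im z" using low z by (simp add: norm_divide field_simps)
  have "Im z * (c * (cnorm g)\<^sup>2) \<le> cmod (1 - q)" using abs_Im_le_cmod[of "1 - q"] Imq by simp
  then show bg: "cmod (1 / (1 - q)) * (c * (cnorm g)\<^sup>2) \<le> 1 / Im z" using nz z by (simp add: norm_divide field_simps)
  have GG: "G' - G = of_real c \<cdot>\<^sub>m outer n (G' *\<^sub>v cvec y) g"
  proof -
    have "G' - G = G' * (of_real c \<cdot>\<^sub>m outer n (cvec y) (cvec y)) * G"
      using resolvent_identity[OF S S' z] unfolding S'S G_def G'_def .
    also have "\<dots> = of_real c \<cdot>\<^sub>m (G' * outer n (cvec y) (cvec y) * G)"
      using R(1) R'(1) by (simp add: mult_smult_distrib[of _ n n _ n] mult_smult_assoc_mat[of _ n n _ n] mult_carrier_mat[of _ n n _ n] del: assoc_mult_mat)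
    also have "G' * outer n (cvec y) (cvec y) * G = outer n (G' *\<^sub>v cvec y) g"
      unfolding mult_outer[OF R'(1) y'] outer_mult[OF R(1) y'] R(4) g_def ..
    finally show ?thesis .
  qed
  show G'y: "G' *\<^sub>v cvec y = (1 / (1 - q)) \<cdot>\<^sub>v g"
  proof (rule eq_vecI)
    fix i assume "i < dim_vec ((1 / (1 - q)) \<cdot>\<^sub>v g)"
    then have i: "i < n" using g by simp
    define h where "h = (G' *\<^sub>v cvec y) $ i"
    have ent: "G' $$ (i,b) = G $$ (i,b) + of_real c * (h * g $ b)" if "b < n" for b
      using arg_cong[OF GG, of "\<lambda>M. M $$ (i,b)"] R(1) R'(1) i that by (simp add: outer_def h_def algebra_simps del: index_mult_mat_vec)
    have "h = (\<Sum>b<n. G' $$ (i,b) * cvec y $ b)"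
      unfolding h_def by (rule mat_vec_entry[OF R'(1) y' i])
    also have "\<dots> = (\<Sum>b<n. (G $$ (i,b) + of_real c * (h * g $ b)) * cvec y $ b)"
      by (intro sum.cong refl) (simp add: ent)
    also have "\<dots> = g $ i + of_real c * h * (\<Sum>b<n. cvec y $ b * g $ b)"
      unfolding g_def mat_vec_entry[OF R(1) y' i] by (simp add: algebra_simps sum.distrib sum_distrib_left del: index_mult_mat_vec index_map_vec)
    also have "(\<Sum>b<n. cvec y $ b * g $ b) = cvec y \<bullet> g" using g by (simp add: scalar_prod_def lessThan_atLeast0)
    finally have "(G' *\<^sub>v cvec y) $ i * (1 - q) = g $ i"
      unfolding q_def g_def[symmetric] h_def[symmetric] by (simp add: algebra_simps del: index_mult_mat_vec)
    then show "(G' *\<^sub>v cvec y) $ i = ((1 / (1 - q)) \<cdot>\<^sub>v g) $ i"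
      using nz g i by (simp add: field_simps del: index_mult_mat_vec)
  qed (use R'(1) g in auto)
  show diff: "G' - G = (of_real c / (1 - q)) \<cdot>\<^sub>m outer n g g"
    unfolding GG G'y using g by (intro eq_matI) (auto simp: outer_def)
  show tr: "mtrace (M * G') - mtrace (M * G) = of_real c / (1 - q) * (g \<bullet> (M *\<^sub>v g))" if M: "M \<in> carrier_mat n n" for M
  proof -
    have "mtrace (M * G') - mtrace (M * G) = mtrace (M * (G' - G))"
      using M R(1) R'(1) by (simp add: mult_minus_distrib_mat[of _ n n _ n] mtrace_minus[of _ n])
    also have "\<dots> = of_real c / (1 - q) * mtrace (outer n (M *\<^sub>v g) g)"
      unfolding diff mult_smult_distrib[OF M outer_carrier] mult_outer[OF M g] by (rule mtrace_smult[of _ n]) simp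
    also have "mtrace (outer n (M *\<^sub>v g) g) = g \<bullet> (M *\<^sub>v g)"
      using M g by (simp add: mtrace_outer comm_scalar_prod[of _ n])
    finally show ?thesis .
  qed
  show "cmod (mtrace (M * G') - mtrace (M * G)) \<le> a / Im z" if M: "op_bounded n a M" for M a
  proof -
    note M' = op_boundedD[OF M]
    have "cmod (mtrace (M * G') - mtrace (M * G)) = cmod (1 / (1 - q)) * c * cmod (g \<bullet> (M *\<^sub>v g))"
      unfolding tr[OF M'(1)] using c by (simp add: norm_mult norm_divide)
    also have "\<dots> \<le> cmod (1 / (1 - q)) * c * (a * cnorm g * cnorm g)"
      using c by (intro mult_left_mono op_bounded_bilinear[OF M g g]) auto
    also have "\<dots> = a * (cmod (1 / (1 - q)) * (c * (cnorm g)\<^sup>2))" by (simp add: power2_eq_square)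
    also have "\<dots> \<le> a * (1 / Im z)" by (intro mult_left_mono bg M'(2))
    finally show ?thesis by simp
  qed
qed

section \<open>The resolvent of a sample covariance matrix\<close>

text \<open>The index set \<open>J\<close> and the normalisation \<open>c\<close> are separate parameters, so that a column can be left out
  without changing the weight of the others.\<close>

definition sample_cov :: "nat \<Rightarrow> real \<Rightarrow> nat set \<Rightarrow> (nat \<Rightarrow> real Matrix.vec) \<Rightarrow> real mat" where
  "sample_cov n c J y = Matrix.mat n n (\<lambda>(a,b). c * (\<Sum>j\<in>J. y j $ a * y j $ b))"

lemma sample_cov_carrier [simp]: "sample_cov n c J y \<in> carrier_mat n n"
  by (simp add: sample_cov_def)

lemma sample_cov_cong: "(\<And>j. j \<in> J \<Longrightarrow> y j = y' j) \<Longrightarrow> sample_cov n c J y = sample_cov n c J y'"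
  by (simp add: sample_cov_def cong: sum.cong_simp)

lemma psd_sample_cov:
  assumes c: "0 \<le> c"
  shows "psd_mat (sample_cov n c J y)"
proof -
  have "0 \<le> v \<bullet> (sample_cov n c J y *\<^sub>v v)" if v: "v \<in> carrier_vec n" for v
  proof -
    have "v \<bullet> (sample_cov n c J y *\<^sub>v v) = (\<Sum>a<n. v $ a * (sample_cov n c J y *\<^sub>v v) $ a)"
      by (simp add: sample_cov_def scalar_prod_def lessThan_atLeast0)
    also have "\<dots> = (\<Sum>a<n. v $ a * (\<Sum>b<n. c * (\<Sum>j\<in>J. y j $ a * y j $ b) * v $ b))"
      by (intro sum.cong refl) (subst mat_vec_entry[OF sample_cov_carrier v], auto simp: sample_cov_def cong: sum.cong_simp)
    also have "\<dots> = (\<Sum>a<n. \<Sum>b<n. \<Sum>j\<in>J. c * ((v $ a * y j $ a) * (v $ b * y j $ b)))"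
      by (simp add: sum_distrib_left sum_distrib_right mult_ac)
    also have "\<dots> = (\<Sum>j\<in>J. \<Sum>a<n. \<Sum>b<n. c * ((v $ a * y j $ a) * (v $ b * y j $ b)))"
      by (rule trans[OF sum.cong[OF refl sum.swap] sum.swap])
    also have "\<dots> = (\<Sum>j\<in>J. c * (\<Sum>a<n. v $ a * y j $ a)\<^sup>2)"
      unfolding power2_eq_square sum_product by (simp add: sum_distrib_left)
    finally show ?thesis using c by (simp add: sum_nonneg)
  qed
  moreover have "sym_mat (sample_cov n c J y)"
    unfolding sym_mat_def by (auto simp: sample_cov_def mult.commute intro!: eq_matI)
  ultimately show ?thesis unfolding psd_mat_def by (simp add: sample_cov_def)
qed

lemma sample_cov_remove:
  assumes "finite J" "j \<in> J" "y j \<in> carrier_vec n"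
  shows "cmat (sample_cov n c J y) - cmat (sample_cov n c (J - {j}) y) = of_real c \<cdot>\<^sub>m outer n (cvec (y j)) (cvec (y j))"
proof (rule eq_matI)
  fix a b assume "a < dim_row (of_real c \<cdot>\<^sub>m outer n (cvec (y j)) (cvec (y j)))" "b < dim_col (of_real c \<cdot>\<^sub>m outer n (cvec (y j)) (cvec (y j)))"
  then have ab: "a < n" "b < n" by (auto simp: outer_def)
  have "(\<Sum>j\<in>J. y j $ a * y j $ b) = y j $ a * y j $ b + (\<Sum>j\<in>J - {j}. y j $ a * y j $ b)"
    by (rule sum.remove[OF assms(1,2)])
  then have "sample_cov n c J y $$ (a,b) - sample_cov n c (J - {j}) y $$ (a,b) = c * (y j $ a * y j $ b)"
    using ab by (simp add: sample_cov_def algebra_simps)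
  then show "(cmat (sample_cov n c J y) - cmat (sample_cov n c (J - {j}) y)) $$ (a,b) = (of_real c \<cdot>\<^sub>m outer n (cvec (y j)) (cvec (y j))) $$ (a,b)"
    using ab assms(3) by (simp add: outer_def sample_cov_def flip: of_real_diff of_real_mult)
qed (auto simp: outer_def sample_cov_def)

lemma mtrace_mult_sample_cov:
  assumes M: "M \<in> carrier_mat n n" and y: "\<And>j. j \<in> J \<Longrightarrow> y j \<in> carrier_vec n"
  shows "mtrace (M * cmat (sample_cov n c J y)) = of_real c * (\<Sum>j\<in>J. cvec (y j) \<bullet> (M *\<^sub>v cvec (y j)))"
proof -
  have S: "cmat (sample_cov n c J y) \<in> carrier_mat n n" by simp
  have "mtrace (M * cmat (sample_cov n c J y)) = (\<Sum>a<n. \<Sum>b<n. M $$ (a,b) * of_real (c * (\<Sum>j\<in>J. y j $ b * y j $ a)))"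
  proof -
    have "dim_row (M * cmat (sample_cov n c J y)) = n" using M by simp
    then show ?thesis unfolding mtrace_def
      by (simp only:) (intro sum.cong refl, subst mat_entry_mult[OF M S], auto simp: sample_cov_def cong: sum.cong_simp)
  qed
  also have "\<dots> = (\<Sum>a<n. \<Sum>b<n. \<Sum>j\<in>J. of_real c * (of_real (y j $ a) * (M $$ (a,b) * of_real (y j $ b))))"
    by (simp add: sum_distrib_left sum_distrib_right mult_ac)
  also have "\<dots> = (\<Sum>j\<in>J. \<Sum>a<n. \<Sum>b<n. of_real c * (of_real (y j $ a) * (M $$ (a,b) * of_real (y j $ b))))"
    by (rule trans[OF sum.cong[OF refl sum.swap] sum.swap])
  also have "\<dots> = (\<Sum>j\<in>J. of_real c * (cvec (y j) \<bullet> (M *\<^sub>v cvec (y j))))"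
  proof (intro sum.cong refl)
    fix j assume "j \<in> J"
    then have yj: "y j \<in> carrier_vec n" "cvec (y j) \<in> carrier_vec n" using y by auto
    have "cvec (y j) \<bullet> (M *\<^sub>v cvec (y j)) = (\<Sum>a<n. of_real (y j $ a) * (M *\<^sub>v cvec (y j)) $ a)"
      using yj M by (simp add: scalar_prod_def lessThan_atLeast0)
    also have "\<dots> = (\<Sum>a<n. of_real (y j $ a) * (\<Sum>b<n. M $$ (a,b) * of_real (y j $ b)))"
      using yj by (intro sum.cong refl) (subst mat_vec_entry[OF M yj(2)], auto)
    finally show "(\<Sum>a<n. \<Sum>b<n. of_real c * (of_real (y j $ a) * (M $$ (a,b) * of_real (y j $ b)))) = of_real c * (cvec (y j) \<bullet> (M *\<^sub>v cvec (y j)))"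
      by (simp add: sum_distrib_left)
  qed
  finally show ?thesis by (simp add: sum_distrib_left)
qed

text \<open>Comparison of \<open>G = (z - S)\<^sup>-\<^sup>1\<close> with \<open>D = (z - b T)\<^sup>-\<^sup>1\<close>, where \<open>T\<close> has eigenvalues \<open>t\<close> and
  eigenvectors \<open>Q\<close>. By the resolvent identity \<open>tr G - tr D = tr (G (S - b T) D)\<close>. Here \<open>S\<close> is a sum
  over the columns, and for each column \<open>G y\<^sub>j = \<beta>\<^sub>j G\<^sub>j y\<^sub>j\<close>, where \<open>G\<^sub>j\<close> does not involve \<open>y\<^sub>j\<close>. The three
  terms of the bound come from replacing the quadratic form in \<open>y\<^sub>j\<close> by its expectation \<open>tr (U G\<^sub>j)\<close>, from
  replacing \<open>G\<^sub>j\<close> by \<open>G\<close> in that trace, and from the difference between \<open>b\<close> and the average of the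
  \<open>\<beta>\<^sub>j\<close>, which equals \<open>1 - \<gamma> + \<gamma> z tr G / n\<close> exactly. The parameter \<open>w\<close> stands for a nonrandom
  approximation of \<open>tr G / n\<close>.\<close>

lemma resolvent_sample_cov_estimate:
  fixes t :: "nat \<Rightarrow> real" and z w :: complex
  assumes n: "0 < n" and p: "0 < p" and z: "Im z > 0"
    and y: "\<And>j. j < p \<Longrightarrow> y j \<in> carrier_vec n"
    and Q: "orth_mat n Q" and t: "\<And>i. i < n \<Longrightarrow> 0 \<le> t i \<and> t i \<le> \<tau>" and \<tau>: "0 \<le> \<tau>"
  defines "\<gamma> \<equiv> real n / real p"
  defines "b \<equiv> 1 - of_real \<gamma> + of_real \<gamma> * z * w"
  assumes b: "Im b \<le> 0"
  defines "G \<equiv> resolvent (sample_cov n (1 / real p) {..<p} y) z"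
    and "Gj \<equiv> \<lambda>j. resolvent (sample_cov n (1 / real p) ({..<p} - {j}) y) z"
    and "D \<equiv> spec_mat n (cmat Q) (\<lambda>i. 1 / (z - b * of_real (t i)))"
    and "U \<equiv> spec_mat n (cmat Q) (\<lambda>i. of_real (t i) / (z - b * of_real (t i)))"
  shows "op_bounded n (1 / Im z) D"
    and "cmod (mtrace G / of_nat n - mtrace D / of_nat n)
      \<le> cmod z / Im z / (real n * real p) * (\<Sum>j<p. cmod (cvec (y j) \<bullet> (Gj j * D *\<^sub>v cvec (y j)) - mtrace (U * Gj j)))
        + cmod z * \<tau> / (Im z ^ 3 * real n) + \<gamma> * cmod z * \<tau> / (Im z)\<^sup>2 * cmod (mtrace G / of_nat n - w)"
proof -
  let ?\<eta> = "Im z" and ?c = "1 / real p"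
  let ?S = "sample_cov n ?c {..<p} y" and ?Sj = "\<lambda>j. sample_cov n ?c ({..<p} - {j}) y"
  let ?K = "shifted ?S z"
  have cQ: "orth_mat n (cmat Q)" by (rule orth_mat_cmat[OF Q])
  have S: "?S \<in> carrier_mat n n" "psd_mat ?S" and Sj: "?Sj j \<in> carrier_mat n n" "psd_mat (?Sj j)" for j
    by (auto intro: psd_sample_cov)
  note R = resolvent_psd[OF S z, folded G_def]
  have den: "?\<eta> \<le> cmod (z - b * of_real (t i))" if "i < n" for i
  proof -
    have "0 \<le> - Im b * t i" using b t[OF that] by (intro mult_nonneg_nonneg) auto
    then have "?\<eta> \<le> Im (z - b * of_real (t i))" by simp
    also have "\<dots> \<le> cmod (z - b * of_real (t i))" by (rule order_trans[OF abs_ge_self abs_Im_le_cmod])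
    finally show ?thesis .
  qed
  have nz: "z - b * of_real (t i) \<noteq> 0" if "i < n" for i using den[OF that] z by auto
  have fD: "cmod (1 / (z - b * of_real (t i))) \<le> 1 / ?\<eta>" if "i < n" for i
    using den[OF that] z by (simp add: norm_divide frac_le)
  then show D: "op_bounded n (1 / ?\<eta>) D" unfolding D_def using z by (intro op_bounded_spec_mat[OF Q]) auto
  have "cmod (of_real (t i) / (z - b * of_real (t i))) \<le> \<tau> / ?\<eta>" if "i < n" for i
    using den[OF that] z t[OF that] \<tau> by (simp add: norm_divide frac_le)
  then have U: "op_bounded n (\<tau> / ?\<eta>) U" unfolding U_def using z \<tau> by (intro op_bounded_spec_mat[OF Q]) auto
  note Dc = op_boundedD(1)[OF D] note Uc = op_boundedD(1)[OF U]
  define e where "e j = cvec (y j) \<bullet> (Gj j * D *\<^sub>v cvec (y j)) - mtrace (U * Gj j)" for j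
  define \<beta> where "\<beta> j = 1 / (1 - of_real ?c * (cvec (y j) \<bullet> (Gj j *\<^sub>v cvec (y j))))" for j
  have r1: "cmod (\<beta> j) \<le> cmod z / ?\<eta>" "G *\<^sub>v cvec (y j) = \<beta> j \<cdot>\<^sub>v (Gj j *\<^sub>v cvec (y j))"
    "cmod (mtrace (U * G) - mtrace (U * Gj j)) \<le> \<tau> / ?\<eta> / ?\<eta>" "1 - of_real ?c * (cvec (y j) \<bullet> (Gj j *\<^sub>v cvec (y j))) \<noteq> 0"
    if "j < p" for j
    using rank_one_perturbation(1,2,4)[OF Sj S y[OF that] _ sample_cov_remove[where y = y and n = n and J = "{..<p}" and j = j, OF _ _ y[OF that]] z]
      rank_one_perturbation(7)[OF Sj S y[OF that] _ sample_cov_remove[where y = y and n = n and J = "{..<p}" and j = j, OF _ _ y[OF that]] z U] that p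
    unfolding \<beta>_def G_def Gj_def by (simp_all add: lessThan_iff)
  have yc: "cvec (y j) \<in> carrier_vec n" if "j < p" for j using y[OF that] by simp
  have Gjc: "Gj j \<in> carrier_mat n n" "(Gj j)\<^sup>T = Gj j" for j
    using resolvent_psd(1,4)[OF Sj z] unfolding Gj_def by auto
  have gj: "Gj j *\<^sub>v cvec (y j) \<in> carrier_vec n" if "j < p" for j by (rule mult_mat_vec_carrier[OF Gjc(1) yc[OF that]])
  \<comment> \<open>the average of the \<open>\<beta> j\<close> is determined by the trace of the resolvent\<close>
  have sum\<beta>: "of_real ?c * (\<Sum>j<p. \<beta> j) = 1 - of_real \<gamma> + of_real \<gamma> * z * (mtrace G / of_nat n)"
  proof -
    have "G * ?K = z \<cdot>\<^sub>m G - G * cmat ?S"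
      unfolding shifted_def using R(1)
      by (simp add: mult_minus_distrib_mat[of _ n n _ n] mult_smult_distrib[of _ n n _ n] sample_cov_def)
    then have "mtrace (1\<^sub>m n :: complex mat) = z * mtrace G - mtrace (G * cmat ?S)"
      unfolding R(2) using R(1) by (simp add: mtrace_minus[of _ n] mtrace_smult[of _ n] mult_carrier_mat[of _ n n _ n])
    then have "of_nat n = z * mtrace G - of_real ?c * (\<Sum>j<p. cvec (y j) \<bullet> (G *\<^sub>v cvec (y j)))"
      using mtrace_mult_sample_cov[OF R(1), of "{..<p}" y ?c] y by (simp add: mtrace_one)
    also have "of_real ?c * (\<Sum>j<p. cvec (y j) \<bullet> (G *\<^sub>v cvec (y j))) = (\<Sum>j<p. \<beta> j - 1)"
      unfolding sum_distrib_left
    proof (intro sum.cong refl)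
      fix j assume "j \<in> {..<p}"
      then have j: "j < p" by simp
      have u: "cvec (y j) \<bullet> (G *\<^sub>v cvec (y j)) = \<beta> j * (cvec (y j) \<bullet> (Gj j *\<^sub>v cvec (y j)))"
        unfolding r1(2)[OF j] using yc[OF j] gj[OF j] by simp
      have alg: "c * (1 / (1 - c * s) * s) = 1 / (1 - c * s) - 1" if "1 - c * s \<noteq> 0" for c s :: complex
        using that by (simp add: field_simps)
      show "of_real ?c * (cvec (y j) \<bullet> (G *\<^sub>v cvec (y j))) = \<beta> j - 1"
        unfolding u \<beta>_def by (rule alg[OF r1(4)[OF j]])
    qed
    finally have "(\<Sum>j<p. \<beta> j) = of_nat p - of_nat n + z * mtrace G" by (simp add: sum_subtractf algebra_simps)
    then show ?thesis using n p unfolding \<gamma>_def by (simp add: field_simps)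
  qed
  \<comment> \<open>the trace of \<open>G (S - b T) D\<close>\<close>
  let ?cT = "spec_mat n (cmat Q) (\<lambda>i. of_real (t i))"
  have cT: "?cT \<in> carrier_mat n n" using cQ by simp
  have KD: "(z \<cdot>\<^sub>m 1\<^sub>m n - b \<cdot>\<^sub>m ?cT) * D = 1\<^sub>m n"
    unfolding spec_mat_affine[OF cQ] D_def spec_mat_mult[OF cQ]
    by (rule trans[OF spec_mat_cong spec_mat_one[OF cQ]]) (use nz in simp)
  have TD: "?cT * D = U" unfolding U_def D_def spec_mat_mult[OF cQ] by simp
  have "mtrace G - mtrace D = mtrace (G * cmat ?S * D) - b * mtrace (U * G)"
  proof -
    have Sc: "cmat ?S \<in> carrier_mat n n" by simp
    have zD: "z \<cdot>\<^sub>m D - b \<cdot>\<^sub>m U = 1\<^sub>m n"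
      using KD Dc cT unfolding TD[symmetric]
      by (simp add: minus_mult_distrib_mat[of _ n n _ _ n] mult_smult_assoc_mat[of _ n n _ n])
    have zG: "G * cmat ?S = z \<cdot>\<^sub>m G - 1\<^sub>m n"
    proof -
      have "G * ?K = z \<cdot>\<^sub>m G - G * cmat ?S"
        unfolding shifted_def using R(1)
        by (simp add: mult_minus_distrib_mat[of _ n n _ n] mult_smult_distrib[of _ n n _ n] sample_cov_def)
      then have "1\<^sub>m n = z \<cdot>\<^sub>m G - G * cmat ?S" unfolding R(2) .
      then have e: "(1\<^sub>m n) $$ (i,j) = (z \<cdot>\<^sub>m G - G * cmat ?S) $$ (i,j)" for i j by simp
      have GS: "G * cmat ?S \<in> carrier_mat n n" using R(1) Sc by (rule mult_carrier_mat)
      show ?thesis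
      proof (rule eq_matI)
        fix i j assume "i < dim_row (z \<cdot>\<^sub>m G - 1\<^sub>m n)" "j < dim_col (z \<cdot>\<^sub>m G - 1\<^sub>m n)"
        then have "i < n" "j < n" by auto
        then show "(G * cmat ?S) $$ (i,j) = (z \<cdot>\<^sub>m G - 1\<^sub>m n) $$ (i,j)"
          using e[of i j] R(1) GS by (simp add: algebra_simps del: index_mult_mat)
      qed (use R(1) GS in \<open>auto simp: sample_cov_def\<close>)
    qed
    have "mtrace (G * cmat ?S * D) = z * mtrace (G * D) - mtrace D"
      unfolding zG using R(1) Dc
      by (simp add: minus_mult_distrib_mat[of _ n n _ _ n] mult_smult_assoc_mat[of _ n n _ n] mtrace_minus[of _ n] mtrace_smult[of _ n] mult_carrier_mat[of _ n n _ n])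
    moreover have "mtrace G = z * mtrace (D * G) - b * mtrace (U * G)"
    proof -
      have "mtrace G = mtrace ((z \<cdot>\<^sub>m D - b \<cdot>\<^sub>m U) * G)" unfolding zD using R(1) by simp
      then show ?thesis using R(1) Dc Uc
        by (simp add: minus_mult_distrib_mat[of _ n n _ _ n] mult_smult_assoc_mat[of _ n n _ n] mtrace_minus[of _ n] mtrace_smult[of _ n] mult_carrier_mat[of _ n n _ n])
    qed
    moreover have "mtrace (G * D) = mtrace (D * G)" by (rule mtrace_mult_commute[OF R(1) Dc])
    ultimately show ?thesis by simp
  qed
  also have "mtrace (G * cmat ?S * D) = of_real ?c * (\<Sum>j<p. \<beta> j * (e j + mtrace (U * Gj j)))"
  proof -
    have DG: "D * G \<in> carrier_mat n n" using Dc R(1) by simp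
    have "mtrace (G * cmat ?S * D) = mtrace (D * G * cmat ?S)"
      using mtrace_mult_commute[of "G * cmat ?S" n n D] Dc R(1) by (simp add: assoc_mult_mat[of _ n n _ n _ n] mult_carrier_mat[of _ n n _ n])
    also have "\<dots> = of_real ?c * (\<Sum>j<p. cvec (y j) \<bullet> (D * G *\<^sub>v cvec (y j)))"
      using y by (intro mtrace_mult_sample_cov[OF DG]) auto
    also have "(\<Sum>j<p. cvec (y j) \<bullet> (D * G *\<^sub>v cvec (y j))) = (\<Sum>j<p. \<beta> j * (e j + mtrace (U * Gj j)))"
    proof (intro sum.cong refl)
      fix j assume "j \<in> {..<p}"
      then have j: "j < p" by simp
      let ?y = "cvec (y j)"
      have DT: "D\<^sup>T = D" unfolding D_def by (rule spec_mat_transpose[OF cQ])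
      have "?y \<bullet> (D * G *\<^sub>v ?y) = ?y \<bullet> (D *\<^sub>v (\<beta> j \<cdot>\<^sub>v (Gj j *\<^sub>v ?y)))"
        unfolding r1(2)[OF j, symmetric] using Dc R(1) yc[OF j] by (simp add: assoc_mult_mat_vec[of _ n n _ n])
      also have "\<dots> = \<beta> j * (?y \<bullet> (D *\<^sub>v (Gj j *\<^sub>v ?y)))"
        using Dc gj[OF j] yc[OF j] by (simp add: mult_mat_vec[of _ n n] mult_mat_vec_carrier[of _ n n])
      also have "?y \<bullet> (D *\<^sub>v (Gj j *\<^sub>v ?y)) = (D *\<^sub>v ?y) \<bullet> (Gj j *\<^sub>v ?y)"
        using transpose_vec_mult_scalar[OF Dc gj[OF j] yc[OF j]] DT by simp
      also have "\<dots> = (Gj j *\<^sub>v (D *\<^sub>v ?y)) \<bullet> ?y"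
        using transpose_vec_mult_scalar[OF Gjc(1)[of j] yc[OF j], of "D *\<^sub>v ?y"] Dc yc[OF j] Gjc(2)[of j] by (simp add: mult_mat_vec_carrier[of _ n n])
      also have "\<dots> = ?y \<bullet> (Gj j * D *\<^sub>v ?y)"
        using Dc yc[OF j] Gjc(1)[of j] by (simp add: assoc_mult_mat_vec[of _ n n _ n] comm_scalar_prod[of _ n] mult_mat_vec_carrier[of _ n n])
      finally show "?y \<bullet> (D * G *\<^sub>v ?y) = \<beta> j * (e j + mtrace (U * Gj j))" unfolding e_def by simp
    qed
    finally show ?thesis .
  qed
  finally have main: "mtrace G - mtrace D = of_real ?c * (\<Sum>j<p. \<beta> j * e j)
      + of_real ?c * (\<Sum>j<p. \<beta> j * (mtrace (U * Gj j) - mtrace (U * G)))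
      + (of_real ?c * (\<Sum>j<p. \<beta> j) - b) * mtrace (U * G)"
    by (simp add: sum.distrib sum_subtractf sum_distrib_right algebra_simps)
  have nc: "cmod (of_real ?c * s) = ?c * cmod s" for s by (simp add: norm_mult norm_divide)
  have b1: "cmod (of_real ?c * (\<Sum>j<p. \<beta> j * e j)) \<le> ?c * (\<Sum>j<p. cmod z / ?\<eta> * cmod (e j))"
    unfolding nc using r1(1) by (intro mult_left_mono sum_norm_le) (auto simp only: norm_mult lessThan_iff norm_ge_zero of_nat_0_le_iff zero_le_divide_1_iff intro!: mult_right_mono)
  have "cmod (of_real ?c * (\<Sum>j<p. \<beta> j * (mtrace (U * Gj j) - mtrace (U * G)))) \<le> ?c * (\<Sum>j<p. cmod z / ?\<eta> * (\<tau> / ?\<eta> / ?\<eta>))"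
    unfolding nc
  proof (intro mult_left_mono sum_norm_le)
    fix j assume "j \<in> {..<p}"
    then have j: "j < p" by simp
    show "cmod (\<beta> j * (mtrace (U * Gj j) - mtrace (U * G))) \<le> cmod z / ?\<eta> * (\<tau> / ?\<eta> / ?\<eta>)"
      unfolding norm_mult using r1(1,3)[OF j] z by (intro mult_mono) (auto simp: norm_minus_commute)
  qed simp
  then have b2: "cmod (of_real ?c * (\<Sum>j<p. \<beta> j * (mtrace (U * Gj j) - mtrace (U * G)))) \<le> cmod z * \<tau> / ?\<eta> ^ 3"
    using p by (simp add: power3_eq_cube)
  have "of_real ?c * (\<Sum>j<p. \<beta> j) - b = of_real \<gamma> * z * (mtrace G / of_nat n - w)"
    unfolding sum\<beta> b_def by (simp add: algebra_simps)
  then have "cmod ((of_real ?c * (\<Sum>j<p. \<beta> j) - b) * mtrace (U * G)) = \<gamma> * cmod z * cmod (mtrace G / of_nat n - w) * cmod (mtrace (U * G))"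
    by (simp add: norm_mult norm_divide \<gamma>_def)
  also have "\<dots> \<le> \<gamma> * cmod z * cmod (mtrace G / of_nat n - w) * (real n * (\<tau> / ?\<eta> * (1 / ?\<eta>)))"
    by (intro mult_left_mono op_bounded_mtrace op_bounded_mult U R(5)) (auto simp: \<gamma>_def)
  finally have b3: "cmod ((of_real ?c * (\<Sum>j<p. \<beta> j) - b) * mtrace (U * G)) \<le> real n * (\<gamma> * cmod z * \<tau> / ?\<eta>\<^sup>2 * cmod (mtrace G / of_nat n - w))"
    by (simp add: power2_eq_square mult_ac)
  have "cmod (mtrace G - mtrace D) \<le> ?c * (\<Sum>j<p. cmod z / ?\<eta> * cmod (e j)) + cmod z * \<tau> / ?\<eta> ^ 3
      + real n * (\<gamma> * cmod z * \<tau> / ?\<eta>\<^sup>2 * cmod (mtrace G / of_nat n - w))"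
    unfolding main by (intro order_trans[OF norm_triangle_ineq] add_mono b1 b2 b3)
  then have "cmod (mtrace G - mtrace D) / real n \<le> (?c * (\<Sum>j<p. cmod z / ?\<eta> * cmod (e j)) + cmod z * \<tau> / ?\<eta> ^ 3
      + real n * (\<gamma> * cmod z * \<tau> / ?\<eta>\<^sup>2 * cmod (mtrace G / of_nat n - w))) / real n"
    by (intro divide_right_mono) auto
  also have "\<dots> = cmod z / ?\<eta> / (real n * real p) * (\<Sum>j<p. cmod (e j)) + cmod z * \<tau> / (?\<eta> ^ 3 * real n)
      + \<gamma> * cmod z * \<tau> / ?\<eta>\<^sup>2 * cmod (mtrace G / of_nat n - w)"
    unfolding sum_distrib_left[symmetric] using n by (simp add: add_divide_distrib mult_ac)
  also have "cmod (mtrace G - mtrace D) / real n = cmod (mtrace G / of_nat n - mtrace D / of_nat n)"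
    by (simp add: norm_divide diff_divide_distrib[symmetric])
  finally show "cmod (mtrace G / of_nat n - mtrace D / of_nat n)
      \<le> cmod z / Im z / (real n * real p) * (\<Sum>j<p. cmod (cvec (y j) \<bullet> (Gj j * D *\<^sub>v cvec (y j)) - mtrace (U * Gj j)))
        + cmod z * \<tau> / (Im z ^ 3 * real n) + \<gamma> * cmod z * \<tau> / (Im z)\<^sup>2 * cmod (mtrace G / of_nat n - w)"
    unfolding e_def .
qed

section \<open>Overlaps of random index sets\<close>

text \<open>A uniformly random set of size \<open>d\<close> contains \<open>w\<close> given points with probability at most
  \<open>(d / n) ^ w\<close>, as if its points were drawn independently.\<close>

lemma binomial_minus_le:
  fixes n d w :: nat
  assumes "w \<le> d" "d \<le> n"
  shows "real ((n - w) choose (d - w)) \<le> real (n choose d) * (real d / real n) ^ w"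
  using assms(1)
proof (induction w)
  case 0 then show ?case by simp
next
  case (Suc w)
  define a b where "a = n - Suc w" and "b = d - Suc w"
  have ab: "n - w = Suc a" "d - w = Suc b" using Suc.prems assms(2) by (auto simp: a_def b_def)
  have "Suc b * (Suc a choose Suc b) = Suc a * (a choose b)"
    by (rule Suc_times_binomial)
  then have "real (Suc b) * real (Suc a choose Suc b) = real (Suc a) * real (a choose b)"
    by (metis of_nat_mult)
  then have "real (a choose b) = real (Suc a choose Suc b) * (real (Suc b) / real (Suc a))"
    by (simp add: field_simps)
  also have "\<dots> \<le> real (Suc a choose Suc b) * (real d / real n)"
  proof -
    have "real (d - w) * real n \<le> real d * real (n - w)"
      using Suc.prems assms(2) by (simp add: of_nat_diff algebra_simps mult_mono)
    then have "real (Suc b) / real (Suc a) \<le> real d / real n" unfolding ab(1)[symmetric] ab(2)[symmetric]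
      using Suc.prems assms(2) by (simp add: field_simps)
    then show ?thesis by (rule mult_left_mono) simp
  qed
  also have "real (Suc a choose Suc b) * (real d / real n) \<le> (real (n choose d) * (real d / real n) ^ w) * (real d / real n)"
    using Suc.IH Suc.prems unfolding ab by (intro mult_right_mono) auto
  also have "\<dots> = real (n choose d) * (real d / real n) ^ Suc w" by simp
  finally show ?case unfolding a_def b_def .
qed

lemma card_supersets_of_size:
  assumes "finite X" "W \<subseteq> X" "card W \<le> d"
  shows "card {K. K \<subseteq> X \<and> card K = d \<and> W \<subseteq> K} = (card X - card W) choose (d - card W)"
proof -
  have fW: "finite W" using assms finite_subset by blast
  have "bij_betw (\<lambda>L. L \<union> W) {L. L \<subseteq> X - W \<and> card L = d - card W} {K. K \<subseteq> X \<and> card K = d \<and> W \<subseteq> K}"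
  proof (rule bij_betw_byWitness[where f' = "\<lambda>K. K - W"])
    show "\<forall>a\<in>{L. L \<subseteq> X - W \<and> card L = d - card W}. a \<union> W - W = a" by auto
    show "\<forall>a'\<in>{K. K \<subseteq> X \<and> card K = d \<and> W \<subseteq> K}. a' - W \<union> W = a'" by auto
    show "(\<lambda>L. L \<union> W) ` {L. L \<subseteq> X - W \<and> card L = d - card W} \<subseteq> {K. K \<subseteq> X \<and> card K = d \<and> W \<subseteq> K}"
    proof clarsimp
      fix L assume L: "L \<subseteq> X - W" "card L = d - card W"
      have "finite L" using L assms finite_subset by blast
      then have "card (L \<union> W) = card L + card W" using L fW by (intro card_Un_disjoint) auto
      then show "L \<subseteq> X \<and> W \<subseteq> X \<and> card (L \<union> W) = d" using L assms by auto
    qed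
    show "(\<lambda>K. K - W) ` {K. K \<subseteq> X \<and> card K = d \<and> W \<subseteq> K} \<subseteq> {L. L \<subseteq> X - W \<and> card L = d - card W}"
      using fW by (auto simp: card_Diff_subset)
  qed
  then have "card {K. K \<subseteq> X \<and> card K = d \<and> W \<subseteq> K} = card {L. L \<subseteq> X - W \<and> card L = d - card W}"
    by (rule bij_betw_same_card[symmetric])
  also have "\<dots> = card (X - W) choose (d - card W)"
    using assms(1) by (intro n_subsets) auto
  finally show ?thesis using assms fW by (simp add: card_Diff_subset)
qed

text \<open>The generating function of the overlap of \<open>G\<close> with a uniformly random set of size \<open>d\<close>: expand
  \<open>k ^ card (G \<inter> K) = (1 + (k - 1)) ^ card (G \<inter> K)\<close> over the subsets of \<open>G \<inter> K\<close>, and count the sets \<open>K\<close>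
  that contain a given subset.\<close>

lemma sum_power_overlap_le:
  fixes k :: real
  assumes X: "finite X" "d \<le> card X" and G: "G \<subseteq> X" and k: "k \<ge> 1"
  shows "(\<Sum>K | K \<subseteq> X \<and> card K = d. k ^ card (G \<inter> K))
       \<le> real (card X choose d) * (1 + (k - 1) * (real d / real (card X))) ^ card G"
proof -
  have fG: "finite G" using X G finite_subset by blast
  have expand: "(1 + t) ^ card S = (\<Sum>W\<in>Pow S. t ^ card W)" if "finite S" for S :: "'a set" and t :: real
    using prod_add[OF that, of "\<lambda>_. t" "\<lambda>_. 1"] by (simp add: add.commute)
  let ?F = "{K. K \<subseteq> X \<and> card K = d}"
  have fF: "finite ?F" using X by simp
  have "(\<Sum>K\<in>?F. k ^ card (G \<inter> K)) = (\<Sum>K\<in>?F. \<Sum>W\<in>Pow (G \<inter> K). (k - 1) ^ card W)"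
    using expand[of _ "k - 1"] fG by (intro sum.cong) auto
  also have "\<dots> = (\<Sum>K\<in>?F. \<Sum>W\<in>Pow G. if W \<subseteq> K then (k - 1) ^ card W else 0)"
  proof (rule sum.cong[OF refl])
    fix K
    have "Pow G \<inter> {W. W \<subseteq> K} = Pow (G \<inter> K)" by auto
    then show "(\<Sum>W\<in>Pow (G \<inter> K). (k - 1) ^ card W) = (\<Sum>W\<in>Pow G. if W \<subseteq> K then (k - 1) ^ card W else 0)"
      using fG by (simp only: sum.inter_restrict[symmetric] finite_Pow_iff sum.If_cases) simp
  qed
  also have "\<dots> = (\<Sum>W\<in>Pow G. \<Sum>K\<in>?F. if W \<subseteq> K then (k - 1) ^ card W else 0)"
    by (rule sum.swap)
  also have "\<dots> = (\<Sum>W\<in>Pow G. (k - 1) ^ card W * real (card {K. K \<subseteq> X \<and> card K = d \<and> W \<subseteq> K}))"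
  proof (rule sum.cong[OF refl])
    fix W
    have "?F \<inter> {K. W \<subseteq> K} = {K. K \<subseteq> X \<and> card K = d \<and> W \<subseteq> K}" by auto
    then show "(\<Sum>K\<in>?F. if W \<subseteq> K then (k - 1) ^ card W else 0) = (k - 1) ^ card W * real (card {K. K \<subseteq> X \<and> card K = d \<and> W \<subseteq> K})"
      using fF by (simp add: sum.If_cases mult.commute)
  qed
  also have "\<dots> \<le> (\<Sum>W\<in>Pow G. (k - 1) ^ card W * (real (card X choose d) * (real d / real (card X)) ^ card W))"
  proof (intro sum_mono mult_left_mono)
    fix W assume "W \<in> Pow G"
    then have W: "W \<subseteq> X" using G by auto
    show "real (card {K. K \<subseteq> X \<and> card K = d \<and> W \<subseteq> K}) \<le> real (card X choose d) * (real d / real (card X)) ^ card W"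
    proof (cases "card W \<le> d")
      case True
      then show ?thesis unfolding card_supersets_of_size[OF X(1) W True] by (rule binomial_minus_le[OF _ X(2)])
    next
      case False
      have "card W \<le> d" if "K \<subseteq> X" "card K = d" "W \<subseteq> K" for K
        using card_mono[OF finite_subset[OF that(1) X(1)] that(3)] that(2) by simp
      with False have E: "{K. K \<subseteq> X \<and> card K = d \<and> W \<subseteq> K} = {}" by blast
      show ?thesis unfolding E by simp
    qed
  qed (use k in auto)
  also have "\<dots> = real (card X choose d) * (\<Sum>W\<in>Pow G. ((k - 1) * (real d / real (card X))) ^ card W)"
    unfolding sum_distrib_left by (rule sum.cong[OF refl]) (simp only: power_mult_distrib mult_ac)
  also have "\<dots> = real (card X choose d) * (1 + (k - 1) * (real d / real (card X))) ^ card G"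
    using expand[OF fG] by simp
  finally show ?thesis .
qed

section \<open>Mixed moments of products of independent symmetric variables\<close>

text \<open>Schur's test: \<open>2 \<bar>a s * a t\<bar> \<le> (a s)\<^sup>2 + (a t)\<^sup>2\<close> bounds the covariance matrix by its row sums.\<close>

lemma (in prob_space) schur_variance_bound:
  fixes Y :: "'s \<Rightarrow> 'a \<Rightarrow> real"
  assumes fin: "finite S"
    and int: "\<And>s t. s \<in> S \<Longrightarrow> t \<in> S \<Longrightarrow> integrable M (\<lambda>\<omega>. Y s \<omega> * Y t \<omega>)"
    and cov: "\<And>s t. s \<in> S \<Longrightarrow> t \<in> S \<Longrightarrow> \<bar>\<integral>\<omega>. Y s \<omega> * Y t \<omega> \<partial>M\<bar> \<le> c s t"
    and row: "\<And>s. s \<in> S \<Longrightarrow> (\<Sum>t\<in>S. c s t) \<le> R"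
  shows "integrable M (\<lambda>\<omega>. (\<Sum>s\<in>S. a s * Y s \<omega>)\<^sup>2)"
    and "(\<integral>\<omega>. (\<Sum>s\<in>S. a s * Y s \<omega>)\<^sup>2 \<partial>M) \<le> R * (\<Sum>s\<in>S. (a s)\<^sup>2)"
proof -
  have sq: "(\<Sum>s\<in>S. a s * Y s \<omega>)\<^sup>2 = (\<Sum>s\<in>S. \<Sum>t\<in>S. (a s * a t) * (Y s \<omega> * Y t \<omega>))" for \<omega>
    by (simp add: power2_eq_square sum_product mult_ac)
  show "integrable M (\<lambda>\<omega>. (\<Sum>s\<in>S. a s * Y s \<omega>)\<^sup>2)"
    unfolding sq using int by (intro Bochner_Integration.integrable_sum integrable_mult_right) auto
  define v where "v s t = (\<integral>\<omega>. Y s \<omega> * Y t \<omega> \<partial>M)" for s t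
  have vs: "v s t = v t s" for s t by (simp add: v_def mult.commute)
  have "(\<integral>\<omega>. (\<Sum>s\<in>S. a s * Y s \<omega>)\<^sup>2 \<partial>M) = (\<Sum>s\<in>S. \<Sum>t\<in>S. (a s * a t) * v s t)"
    unfolding sq v_def
    by (subst Bochner_Integration.integral_sum, (intro Bochner_Integration.integrable_sum integrable_mult_right int; assumption))
       (intro sum.cong refl, subst Bochner_Integration.integral_sum, (intro integrable_mult_right int; assumption), simp)
  also have "\<dots> \<le> (\<Sum>s\<in>S. \<Sum>t\<in>S. (a s)\<^sup>2 / 2 * \<bar>v s t\<bar> + (a t)\<^sup>2 / 2 * \<bar>v s t\<bar>)"
  proof (intro sum_mono)
    fix s t
    have "\<bar>a s * a t\<bar> \<le> (a s)\<^sup>2 / 2 + (a t)\<^sup>2 / 2"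
      using sum_squares_bound[of "\<bar>a s\<bar>" "\<bar>a t\<bar>"] by (simp add: abs_mult)
    then have "\<bar>a s * a t\<bar> * \<bar>v s t\<bar> \<le> ((a s)\<^sup>2 / 2 + (a t)\<^sup>2 / 2) * \<bar>v s t\<bar>"
      by (rule mult_right_mono) simp
    moreover have "(a s * a t) * v s t \<le> \<bar>a s * a t\<bar> * \<bar>v s t\<bar>"
      by (metis abs_ge_self abs_mult)
    ultimately show "(a s * a t) * v s t \<le> (a s)\<^sup>2 / 2 * \<bar>v s t\<bar> + (a t)\<^sup>2 / 2 * \<bar>v s t\<bar>"
      by (simp only: distrib_right)
  qed
  also have "\<dots> = (\<Sum>s\<in>S. (a s)\<^sup>2 * (\<Sum>t\<in>S. \<bar>v s t\<bar>))"
  proof -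
    have "(\<Sum>s\<in>S. \<Sum>t\<in>S. (a t)\<^sup>2 / 2 * \<bar>v s t\<bar>) = (\<Sum>t\<in>S. \<Sum>s\<in>S. (a t)\<^sup>2 / 2 * \<bar>v t s\<bar>)"
      by (subst sum.swap) (intro sum.cong refl, subst vs, rule refl)
    moreover have "(\<Sum>s\<in>S. \<Sum>t\<in>S. (a s)\<^sup>2 / 2 * \<bar>v s t\<bar>) = (\<Sum>s\<in>S. (a s)\<^sup>2 * (\<Sum>t\<in>S. \<bar>v s t\<bar>)) / 2"
      by (simp add: sum_distrib_left sum_divide_distrib)
    ultimately show ?thesis unfolding sum.distrib by simp
  qed
  also have "\<dots> \<le> (\<Sum>s\<in>S. (a s)\<^sup>2 * R)"
    using cov row unfolding v_def by (intro sum_mono mult_left_mono) (auto intro: order_trans[OF sum_mono])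
  finally show "(\<integral>\<omega>. (\<Sum>s\<in>S. a s * Y s \<omega>)\<^sup>2 \<partial>M) \<le> R * (\<Sum>s\<in>S. (a s)\<^sup>2)"
    by (simp add: sum_distrib_left mult.commute)
qed

text \<open>The moments up to the fourth are what enters the covariance of two products of monomials.\<close>

locale symmetric_product_variables = prob_space +
  fixes X :: "'i set" and x :: "'i \<Rightarrow> 'a \<Rightarrow> real" and \<kappa> :: real
  assumes finX: "finite X"
    and indep: "indep_vars (\<lambda>_. borel) x X"
    and mom_int: "\<And>i a. i \<in> X \<Longrightarrow> a \<le> 4 \<Longrightarrow> integrable M (\<lambda>\<omega>. x i \<omega> ^ a)"
    and mom_odd: "\<And>i a. i \<in> X \<Longrightarrow> a \<le> 4 \<Longrightarrow> odd a \<Longrightarrow> (\<integral>\<omega>. x i \<omega> ^ a \<partial>M) = 0"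
    and mom2: "\<And>i. i \<in> X \<Longrightarrow> (\<integral>\<omega>. (x i \<omega>)\<^sup>2 \<partial>M) = 1"
    and mom4: "\<And>i. i \<in> X \<Longrightarrow> (\<integral>\<omega>. x i \<omega> ^ 4 \<partial>M) = \<kappa>"
begin

definition mon :: "'i set \<Rightarrow> 'a \<Rightarrow> real" where
  "mon I \<omega> = (\<Prod>i\<in>I. x i \<omega>)"

text \<open>In the product of the four monomials each variable has an exponent between \<open>0\<close> and \<open>4\<close>. All exponents are
  even exactly if the two symmetric differences agree, and the exponent \<open>4\<close> occurs on the common intersection.\<close>

lemma mon_product_moment:
  assumes "I \<subseteq> X" "J \<subseteq> X" "K \<subseteq> X" "L \<subseteq> X"
  shows "integrable M (\<lambda>\<omega>. mon I \<omega> * mon J \<omega> * (mon K \<omega> * mon L \<omega>))"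
    and "(\<integral>\<omega>. mon I \<omega> * mon J \<omega> * (mon K \<omega> * mon L \<omega>) \<partial>M)
       = (if sym_diff I J = sym_diff K L then \<kappa> ^ card (I \<inter> J \<inter> K \<inter> L) else 0)"
proof -
  define a :: "'i \<Rightarrow> nat" where "a i = of_bool (i \<in> I) + of_bool (i \<in> J) + of_bool (i \<in> K) + of_bool (i \<in> L)" for i
  have a4: "a i \<le> 4" for i by (simp add: a_def)
  have mon: "mon U \<omega> = (\<Prod>i\<in>X. x i \<omega> ^ of_bool (i \<in> U))" if "U \<subseteq> X" for U \<omega>
  proof -
    have "(\<Prod>i\<in>U. x i \<omega>) = (\<Prod>i\<in>U. x i \<omega> ^ of_bool (i \<in> U))" by (intro prod.cong) auto
    also have "\<dots> = (\<Prod>i\<in>X. x i \<omega> ^ of_bool (i \<in> U))"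
      using that finX by (intro prod.mono_neutral_left) auto
    finally show ?thesis by (simp add: mon_def)
  qed
  have eq: "mon I \<omega> * mon J \<omega> * (mon K \<omega> * mon L \<omega>) = (\<Prod>i\<in>X. x i \<omega> ^ a i)" for \<omega>
    using assms by (simp add: mon a_def power_add prod.distrib mult_ac)
  have ind: "indep_vars (\<lambda>_. borel) (\<lambda>i \<omega>. x i \<omega> ^ a i) X"
    by (rule indep_vars_compose2[OF indep]) simp
  show "integrable M (\<lambda>\<omega>. mon I \<omega> * mon J \<omega> * (mon K \<omega> * mon L \<omega>))"
    unfolding eq by (rule indep_vars_integrable[OF finX ind]) (use a4 mom_int in auto)
  have "(\<integral>\<omega>. mon I \<omega> * mon J \<omega> * (mon K \<omega> * mon L \<omega>) \<partial>M) = (\<Prod>i\<in>X. \<integral>\<omega>. x i \<omega> ^ a i \<partial>M)"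
    unfolding eq by (rule indep_vars_lebesgue_integral[OF finX ind]) (use a4 mom_int in auto)
  also have "\<dots> = (if sym_diff I J = sym_diff K L then \<kappa> ^ card (I \<inter> J \<inter> K \<inter> L) else 0)"
  proof (cases "sym_diff I J = sym_diff K L")
    case True
    have "(\<integral>\<omega>. x i \<omega> ^ a i \<partial>M) = (if i \<in> I \<inter> J \<inter> K \<inter> L then \<kappa> else 1)" if i: "i \<in> X" for i
    proof -
      have "a i = 0 \<and> i \<notin> I \<inter> J \<inter> K \<inter> L \<or> a i = 2 \<and> i \<notin> I \<inter> J \<inter> K \<inter> L \<or> a i = 4 \<and> i \<in> I \<inter> J \<inter> K \<inter> L"
        using True by (cases "i \<in> I"; cases "i \<in> J"; cases "i \<in> K"; cases "i \<in> L") (auto simp: a_def)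
      then show ?thesis using mom2[OF i] mom4[OF i] prob_space by auto
    qed
    then have "(\<Prod>i\<in>X. \<integral>\<omega>. x i \<omega> ^ a i \<partial>M) = (\<Prod>i\<in>X. if i \<in> I \<inter> J \<inter> K \<inter> L then \<kappa> else 1)"
      by (rule prod.cong[OF refl])
    also have "\<dots> = (\<Prod>i\<in>X \<inter> (I \<inter> J \<inter> K \<inter> L). \<kappa>)"
      using prod.inter_restrict[OF finX, of "\<lambda>_. \<kappa>" "I \<inter> J \<inter> K \<inter> L"] by simp
    also have "X \<inter> (I \<inter> J \<inter> K \<inter> L) = I \<inter> J \<inter> K \<inter> L" using assms by auto
    finally show ?thesis using True by simp
  next
    case False
    then obtain i where i: "i \<in> sym_diff I J \<longleftrightarrow> i \<notin> sym_diff K L" by blast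
    then have "odd (a i)" "i \<in> X"
      using assms by (cases "i \<in> I"; cases "i \<in> J"; cases "i \<in> K"; cases "i \<in> L"; auto simp: a_def)+
    then have "\<exists>i\<in>X. (\<integral>\<omega>. x i \<omega> ^ a i \<partial>M) = 0"
      by (intro bexI[of _ i] mom_odd a4)
    then have "(\<Prod>i\<in>X. \<integral>\<omega>. x i \<omega> ^ a i \<partial>M) = 0"
      by (rule prod_zero[OF finX])
    then show ?thesis using False by simp
  qed
  finally show "(\<integral>\<omega>. mon I \<omega> * mon J \<omega> * (mon K \<omega> * mon L \<omega>) \<partial>M)
       = (if sym_diff I J = sym_diff K L then \<kappa> ^ card (I \<inter> J \<inter> K \<inter> L) else 0)" .
qed

lemma mon_pair_moment:
  assumes "I \<subseteq> X" "J \<subseteq> X"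
  shows "integrable M (\<lambda>\<omega>. mon I \<omega> * mon J \<omega>)"
    and "(\<integral>\<omega>. mon I \<omega> * mon J \<omega> \<partial>M) = of_bool (I = J)"
proof -
  have e: "mon {} = (\<lambda>_. 1)" by (simp add: mon_def fun_eq_iff)
  show "integrable M (\<lambda>\<omega>. mon I \<omega> * mon J \<omega>)"
    using mon_product_moment(1)[OF assms, of "{}" "{}"] by (simp add: e)
  have "sym_diff I J = {} \<longleftrightarrow> I = J" by auto
  then show "(\<integral>\<omega>. mon I \<omega> * mon J \<omega> \<partial>M) = of_bool (I = J)"
    using mon_product_moment(2)[OF assms, of "{}" "{}"] by (simp add: e)
qed

text \<open>The bound is shaped so that it can be summed over \<open>K\<close> by the generating function of the overlap with
  \<open>I \<union> J\<close>. It has to vanish when this overlap is empty: then the condition on the symmetric differences and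
  the equality of the sizes force \<open>K = L\<close> and \<open>I = J\<close>, and the two factors are uncorrelated. Otherwise the
  exponent is positive, and \<open>k \<ge> 2\<close> allows the moment \<open>k ^ r\<close> to be replaced by \<open>2 (k ^ r - 1)\<close>.\<close>

lemma mon_covariance:
  assumes sub: "I \<subseteq> X" "J \<subseteq> X" "K \<subseteq> X" "L \<subseteq> X" and cKL: "card K = card L"
    and k: "k \<ge> 2" "0 \<le> \<kappa>" "\<kappa> \<le> k"
  defines "Y \<equiv> \<lambda>I J \<omega>. mon I \<omega> * mon J \<omega> - of_bool (I = J)"
  shows "integrable M (\<lambda>\<omega>. Y I J \<omega> * Y K L \<omega>)"
    and "\<bar>\<integral>\<omega>. Y I J \<omega> * Y K L \<omega> \<partial>M\<bar>
      \<le> (if sym_diff I J = sym_diff K L then 2 * (k ^ card ((I \<union> J) \<inter> K) - 1) else 0)"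
proof -
  have fin: "finite I" "finite J" "finite K" "finite L" using sub by (auto intro: finite_subset[OF _ finX])
  let ?f = "\<lambda>\<omega>. mon I \<omega> * mon J \<omega> * (mon K \<omega> * mon L \<omega>)"
  have Yeq: "Y I J \<omega> * Y K L \<omega> = ?f \<omega> - of_bool (K = L) * (mon I \<omega> * mon J \<omega>)
      - of_bool (I = J) * (mon K \<omega> * mon L \<omega>) + of_bool (I = J) * of_bool (K = L)" for \<omega>
    by (simp add: Y_def algebra_simps)
  note int = mon_product_moment(1)[OF sub] mon_pair_moment(1)[OF sub(1,2)] mon_pair_moment(1)[OF sub(3,4)]
  show "integrable M (\<lambda>\<omega>. Y I J \<omega> * Y K L \<omega>)"
    unfolding Yeq using int by simp
  have E: "(\<integral>\<omega>. Y I J \<omega> * Y K L \<omega> \<partial>M)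
      = (if sym_diff I J = sym_diff K L then \<kappa> ^ card (I \<inter> J \<inter> K \<inter> L) else 0) - of_bool (I = J) * of_bool (K = L)"
    unfolding Yeq using int mon_product_moment(2)[OF sub] mon_pair_moment(2)[OF sub(1,2)] mon_pair_moment(2)[OF sub(3,4)]
    by (simp add: prob_space)
  show "\<bar>\<integral>\<omega>. Y I J \<omega> * Y K L \<omega> \<partial>M\<bar>
      \<le> (if sym_diff I J = sym_diff K L then 2 * (k ^ card ((I \<union> J) \<inter> K) - 1) else 0)"
  proof (cases "sym_diff I J = sym_diff K L")
    case False
    then have "\<not> (I = J \<and> K = L)" by auto
    then show ?thesis unfolding E using False by auto
  next
    case True
    let ?m = "card (I \<inter> J \<inter> K \<inter> L)" and ?r = "card ((I \<union> J) \<inter> K)"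
    show ?thesis
    proof (cases "(I \<union> J) \<inter> K = {}")
      case disj: True
      then have "K \<subseteq> L" using True by blast
      then have "K = L" using cKL fin by (simp add: card_subset_eq)
      then have IJ: "I = J" using True by auto
      have "I \<inter> J \<inter> K \<inter> L = {}" using disj by auto
      then show ?thesis unfolding E using True disj \<open>K = L\<close> IJ by simp
    next
      case False
      then have r: "?r \<ge> 1" using fin by (simp add: Suc_leI card_gt_0_iff)
      have "\<kappa> ^ ?m \<le> k ^ ?m" using k by (intro power_mono) auto
      also have "\<dots> \<le> k ^ ?r" using k fin by (intro power_increasing card_mono) auto
      finally have 1: "\<kappa> ^ ?m \<le> k ^ ?r" .
      have 2: "2 \<le> k ^ ?r" using power_increasing[OF r, of k] k by simp
      have 3: "0 \<le> \<kappa> ^ ?m" using k by simp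
      have "\<bar>\<kappa> ^ ?m - of_bool (I = J) * of_bool (K = L)\<bar> \<le> k ^ ?r"
        using 1 2 3 by (auto simp: of_bool_def)
      also have "\<dots> \<le> 2 * (k ^ ?r - 1)" using 2 by simp
      finally show ?thesis unfolding E using True by simp
    qed
  qed
qed

text \<open>Given \<open>I\<close>, \<open>J\<close> and \<open>K\<close>, the set \<open>L\<close> is determined by the equality of the symmetric differences. A row
  sum of the covariance matrix is therefore a sum over \<open>K\<close> alone, and \<open>I \<union> J\<close> has at most \<open>2 d\<close> points.\<close>

theorem quadratic_form_variance:
  fixes A :: "'i set \<Rightarrow> 'i set \<Rightarrow> real" and d :: nat
  assumes d: "d \<le> card X" and k: "k \<ge> 2" "0 \<le> \<kappa>" "\<kappa> \<le> k"
  defines "F \<equiv> {K. K \<subseteq> X \<and> card K = d}"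
  shows "integrable M (\<lambda>\<omega>. ((\<Sum>I\<in>F. \<Sum>J\<in>F. A I J * (mon I \<omega> * mon J \<omega>)) - (\<Sum>I\<in>F. A I I))\<^sup>2)" (is "integrable M ?q")
    and "(\<integral>\<omega>. ((\<Sum>I\<in>F. \<Sum>J\<in>F. A I J * (mon I \<omega> * mon J \<omega>)) - (\<Sum>I\<in>F. A I I))\<^sup>2 \<partial>M)
      \<le> 2 * real (card X choose d) * ((1 + (k - 1) * (real d / real (card X))) ^ (2 * d) - 1) * (\<Sum>I\<in>F. \<Sum>J\<in>F. (A I J)\<^sup>2)"
proof -
  let ?t = "1 + (k - 1) * (real d / real (card X))"
  let ?N = "real (card X choose d)"
  have finF: "finite F" using finX by (simp add: F_def)
  have cF: "card F = card X choose d" unfolding F_def using finX by (rule n_subsets)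
  define Y where "Y s \<omega> = mon (fst s) \<omega> * mon (snd s) \<omega> - of_bool (fst s = snd s)" for s :: "'i set \<times> 'i set" and \<omega>
  define c where "c s t = (if sym_diff (fst s) (snd s) = sym_diff (fst t) (snd t) then 2 * (k ^ card ((fst s \<union> snd s) \<inter> fst t) - 1) else 0)"
    for s t :: "'i set \<times> 'i set"
  have q: "(\<Sum>I\<in>F. \<Sum>J\<in>F. A I J * (mon I \<omega> * mon J \<omega>)) - (\<Sum>I\<in>F. A I I) = (\<Sum>s\<in>F \<times> F. A (fst s) (snd s) * Y s \<omega>)" for \<omega>
  proof -
    have "(\<Sum>I\<in>F. A I I) = (\<Sum>I\<in>F. \<Sum>J\<in>F. A I J * of_bool (I = J))"
      using finF by (simp add: of_bool_def if_distrib[of "\<lambda>u. _ * u"] cong: if_cong)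
    then show ?thesis
      unfolding Y_def sum.cartesian_product'
      by (simp add: sum_subtractf right_diff_distrib)
  qed
  have cov: "integrable M (\<lambda>\<omega>. Y s \<omega> * Y t \<omega>)" "\<bar>\<integral>\<omega>. Y s \<omega> * Y t \<omega> \<partial>M\<bar> \<le> c s t" if "s \<in> F \<times> F" "t \<in> F \<times> F" for s t
  proof -
    obtain I J K L where st: "s = (I,J)" "t = (K,L)" by (metis surj_pair)
    have s: "s = (I,J)" "I \<subseteq> X" "J \<subseteq> X" and t: "t = (K,L)" "K \<subseteq> X" "L \<subseteq> X" "card K = card L"
      using that unfolding st by (auto simp: F_def)
    note c = mon_covariance[OF s(2,3) t(2,3,4) k]
    show "integrable M (\<lambda>\<omega>. Y s \<omega> * Y t \<omega>)" unfolding Y_def s(1) t(1) fst_conv snd_conv by (rule c(1))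
    show "\<bar>\<integral>\<omega>. Y s \<omega> * Y t \<omega> \<partial>M\<bar> \<le> c s t" unfolding Y_def c_def s(1) t(1) fst_conv snd_conv by (rule c(2))
  qed
  have row: "(\<Sum>t\<in>F \<times> F. c s t) \<le> 2 * ?N * (?t ^ (2 * d) - 1)" if "s \<in> F \<times> F" for s
  proof -
    obtain I J where sIJ: "s = (I,J)" by (metis surj_pair)
    then have s: "s = (I,J)" "I \<subseteq> X" "J \<subseteq> X" "card I = d" "card J = d"
      using \<open>s \<in> F \<times> F\<close> by (auto simp: F_def)
    have cG: "card (I \<union> J) \<le> 2 * d" using card_Un_le[of I J] s by simp
    have "(\<Sum>t\<in>F \<times> F. c s t) = (\<Sum>K\<in>F. \<Sum>L\<in>F. if sym_diff I J = sym_diff K L then 2 * (k ^ card ((I \<union> J) \<inter> K) - 1) else 0)"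
      unfolding sum.cartesian_product' c_def s(1) fst_conv snd_conv ..
    also have "\<dots> \<le> (\<Sum>K\<in>F. 2 * (k ^ card ((I \<union> J) \<inter> K) - 1))"
    proof (rule sum_mono)
      fix K
      have nn: "0 \<le> 2 * (k ^ card ((I \<union> J) \<inter> K) - 1)" using k one_le_power[of k] by simp
      have "sym_diff I J = sym_diff K L \<longleftrightarrow> L = sym_diff K (sym_diff I J)" for L by blast
      then have "(\<Sum>L\<in>F. if sym_diff I J = sym_diff K L then 2 * (k ^ card ((I \<union> J) \<inter> K) - 1) else 0)
          = (\<Sum>L\<in>F. if L = sym_diff K (sym_diff I J) then 2 * (k ^ card ((I \<union> J) \<inter> K) - 1) else 0)"
        by simp
      also have "\<dots> \<le> 2 * (k ^ card ((I \<union> J) \<inter> K) - 1)"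
        using finF nn by simp
      finally show "(\<Sum>L\<in>F. if sym_diff I J = sym_diff K L then 2 * (k ^ card ((I \<union> J) \<inter> K) - 1) else 0)
        \<le> 2 * (k ^ card ((I \<union> J) \<inter> K) - 1)" .
    qed
    also have "\<dots> = 2 * ((\<Sum>K\<in>F. k ^ card ((I \<union> J) \<inter> K)) - ?N)"
      by (simp add: sum_distrib_left[symmetric] sum_subtractf cF)
    also have "(\<Sum>K\<in>F. k ^ card ((I \<union> J) \<inter> K)) \<le> ?N * ?t ^ card (I \<union> J)"
      unfolding F_def by (rule sum_power_overlap_le[OF finX d]) (use s k in auto)
    also have "?N * ?t ^ card (I \<union> J) \<le> ?N * ?t ^ (2 * d)"
      using k cG by (intro mult_left_mono power_increasing) auto
    finally show ?thesis by (simp add: algebra_simps)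
  qed
  have fS: "finite (F \<times> F)" using finF by simp
  show "integrable M ?q" unfolding q by (rule schur_variance_bound(1)[OF fS cov row])
  have "(\<integral>\<omega>. ?q \<omega> \<partial>M) \<le> 2 * ?N * (?t ^ (2 * d) - 1) * (\<Sum>s\<in>F \<times> F. (A (fst s) (snd s))\<^sup>2)"
    unfolding q by (rule schur_variance_bound(2)[OF fS cov row])
  then show "(\<integral>\<omega>. ?q \<omega> \<partial>M) \<le> 2 * ?N * (?t ^ (2 * d) - 1) * (\<Sum>I\<in>F. \<Sum>J\<in>F. (A I J)\<^sup>2)"
    unfolding sum.cartesian_product' by simp
qed

end

section \<open>Concentration of functions of independent variables with bounded differences\<close>

text \<open>Induction on the coordinates. After integrating out all but one coordinate, the mean \<open>g\<close> still changes by at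
  most \<open>c\<close>, so it lies in an interval of length \<open>2 c\<close>, and Hoeffding's lemma contributes the factor
  \<open>exp (l\<^sup>2 c\<^sup>2 / 2)\<close>.\<close>

lemma bounded_differences_mgf:
  fixes F :: "('i \<Rightarrow> 'a) \<Rightarrow> real" and \<nu> :: "'a measure"
  assumes \<nu>: "prob_space \<nu>" and fin: "finite I" and l: "l > 0"
    and F: "F \<in> borel_measurable (PiM I (\<lambda>_. \<nu>))"
    and bdd: "\<And>x. x \<in> space (PiM I (\<lambda>_. \<nu>)) \<Longrightarrow> \<bar>F x\<bar> \<le> B"
    and diff: "\<And>x i a. x \<in> space (PiM I (\<lambda>_. \<nu>)) \<Longrightarrow> i \<in> I \<Longrightarrow> a \<in> space \<nu> \<Longrightarrow> \<bar>F x - F (x(i := a))\<bar> \<le> c"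
  shows "(\<integral>\<^sup>+x. ennreal (exp (l * (F x - (\<integral>x. F x \<partial>PiM I (\<lambda>_. \<nu>))))) \<partial>PiM I (\<lambda>_. \<nu>)) \<le> ennreal (exp (l\<^sup>2 * c\<^sup>2 * card I / 2))"
  using fin F bdd diff
proof (induction I arbitrary: F rule: finite_induct)
  case empty
  interpret nu: prob_space \<nu> by fact
  interpret P: product_prob_space "\<lambda>_::'i. \<nu>" ..
  define u where "u = F (\<lambda>_. undefined)"
  have const: "F x = u" if "x \<in> space (PiM {} (\<lambda>_::'i. \<nu>))" for x
    using that by (simp add: u_def space_PiM)
  interpret E: prob_space "PiM {} (\<lambda>_::'i. \<nu>)" by (rule prob_space_PiM) (rule \<nu>)
  have "(\<integral>x. F x \<partial>PiM {} (\<lambda>_::'i. \<nu>)) = (\<integral>x. u \<partial>PiM {} (\<lambda>_::'i. \<nu>))"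
    by (rule Bochner_Integration.integral_cong[OF refl const])
  also have "\<dots> = u" by (simp only: lebesgue_integral_const E.prob_space) simp
  finally have "(\<integral>x. F x \<partial>PiM {} (\<lambda>_::'i. \<nu>)) = u" .
  then have "(\<integral>\<^sup>+x. ennreal (exp (l * (F x - (\<integral>x. F x \<partial>PiM {} (\<lambda>_. \<nu>))))) \<partial>PiM {} (\<lambda>_::'i. \<nu>))
      = (\<integral>\<^sup>+x. 1 \<partial>PiM {} (\<lambda>_::'i. \<nu>))"
    by (intro nn_integral_cong) (simp add: const)
  then show ?case by (simp add: E.emeasure_space_1)
next
  case (insert i I)
  interpret nu: prob_space \<nu> by fact
  interpret P: product_prob_space "\<lambda>_::'i. \<nu>" ..
  interpret PI: prob_space "PiM I (\<lambda>_::'i. \<nu>)" by (rule prob_space_PiM) (rule \<nu>)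
  interpret PJ: prob_space "PiM (insert i I) (\<lambda>_::'i. \<nu>)" by (rule prob_space_PiM) (rule \<nu>)
  interpret pair: pair_prob_space \<nu> "PiM I (\<lambda>_::'i. \<nu>)" ..
  let ?PI = "PiM I (\<lambda>_::'i. \<nu>)" and ?PJ = "PiM (insert i I) (\<lambda>_::'i. \<nu>)"
  have upd: "x(i := a) \<in> space ?PJ" if "x \<in> space ?PI" "a \<in> space \<nu>" for x a
    using that by (auto simp: space_PiM PiE_iff extensional_def)
  have mupd [measurable]: "(\<lambda>(a,x). x(i := a)) \<in> measurable (\<nu> \<Otimes>\<^sub>M ?PI) ?PJ"
    unfolding case_prod_beta by (rule measurable_fun_upd[where J = I]) (auto intro: measurable_fst measurable_snd)
  note F [measurable] = insert.prems(1)
  have mF2: "(\<lambda>(a,x). F (x(i := a))) \<in> borel_measurable (\<nu> \<Otimes>\<^sub>M ?PI)"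
    using measurable_compose[OF mupd F] by (simp add: case_prod_beta)
  have mFa: "(\<lambda>x. F (x(i := a))) \<in> borel_measurable ?PI" if "a \<in> space \<nu>" for a
    using measurable_compose[OF measurable_Pair1'[OF that] mF2] by simp
  define g where "g a = (\<integral>x. F (x(i := a)) \<partial>?PI)" for a
  have mg [measurable]: "g \<in> borel_measurable \<nu>"
    unfolding g_def using mF2 by (intro PI.borel_measurable_lebesgue_integral) (simp add: case_prod_beta)
  have iFa: "integrable ?PI (\<lambda>x. F (x(i := a)))" if "a \<in> space \<nu>" for a
    by (rule PI.integrable_const_bound[where B = B, OF AE_I2 mFa[OF that]])
      (unfold real_norm_def, rule insert.prems(2)[OF upd[OF _ that]])
  have Eg: "(\<integral>x. F x \<partial>?PJ) = (\<integral>a. g a \<partial>\<nu>)"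
  proof -
    have "distr (\<nu> \<Otimes>\<^sub>M ?PI) ?PJ (\<lambda>(a,x). x(i := a)) = ?PJ"
      by (rule distr_pair_PiM_eq_PiM) (rule \<nu>)+
    then have "(\<integral>x. F x \<partial>?PJ) = (\<integral>u. F ((\<lambda>(a,x). x(i := a)) u) \<partial>(\<nu> \<Otimes>\<^sub>M ?PI))"
      using integral_distr[OF mupd F] by simp
    also have "\<dots> = (\<integral>a. g a \<partial>\<nu>)"
    proof -
      have "integrable (\<nu> \<Otimes>\<^sub>M ?PI) (\<lambda>(a,x). F (x(i := a)))"
        using mF2 insert.prems(2) upd
        by (intro pair.integrable_const_bound[where B = B]) (auto simp: space_pair_measure intro!: AE_I2)
      from pair.integral_fst'[OF this] show ?thesis unfolding g_def split_def by simp
    qed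
    finally show ?thesis .
  qed
  have gdiff: "\<bar>g a - g a'\<bar> \<le> c" if a: "a \<in> space \<nu>" "a' \<in> space \<nu>" for a a'
  proof -
    have "g a - g a' = (\<integral>x. F (x(i := a)) - F (x(i := a')) \<partial>?PI)"
      unfolding g_def using iFa a by simp
    also have "\<bar>\<dots>\<bar> \<le> (\<integral>x. \<bar>F (x(i := a)) - F (x(i := a'))\<bar> \<partial>?PI)" by (rule integral_abs_bound)
    also have "\<dots> \<le> (\<integral>x. c \<partial>?PI)"
    proof (rule integral_mono)
      fix x assume x: "x \<in> space ?PI"
      show "\<bar>F (x(i := a)) - F (x(i := a'))\<bar> \<le> c"
        using insert.prems(3)[OF upd[OF x a(1)] insertI1 a(2)] unfolding fun_upd_upd .
    qed (use iFa a in auto)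
    finally show ?thesis by (simp add: PI.prob_space)
  qed
  obtain a0 where a0: "a0 \<in> space \<nu>" using nu.not_empty by auto
  interpret H: interval_bounded_random_variable \<nu> g "g a0 - c" "g a0 + c"
    by unfold_locales (use gdiff[OF _ a0] in \<open>auto simp: abs_le_iff algebra_simps intro!: AE_I2\<close>)
  let ?E = "\<integral>x. F x \<partial>?PJ"
  let ?K = "exp (l\<^sup>2 * c\<^sup>2 * card I / 2)"
  have "(\<integral>\<^sup>+x. ennreal (exp (l * (F x - ?E))) \<partial>?PJ) = (\<integral>\<^sup>+a. (\<integral>\<^sup>+x. ennreal (exp (l * (F (x(i := a)) - ?E))) \<partial>?PI) \<partial>\<nu>)"
    by (rule P.product_nn_integral_insert_rev[OF insert.hyps(1,2)]) measurable
  also have "\<dots> \<le> (\<integral>\<^sup>+a. ennreal (exp (l * (g a - ?E))) * ennreal ?K \<partial>\<nu>)"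
  proof (rule nn_integral_mono)
    fix a assume a: "a \<in> space \<nu>"
    have "(\<integral>\<^sup>+x. ennreal (exp (l * (F (x(i := a)) - ?E))) \<partial>?PI)
        = (\<integral>\<^sup>+x. ennreal (exp (l * (g a - ?E))) * ennreal (exp (l * (F (x(i := a)) - g a))) \<partial>?PI)"
      by (intro nn_integral_cong) (simp add: ennreal_mult[symmetric] exp_add[symmetric] algebra_simps)
    also have "\<dots> = ennreal (exp (l * (g a - ?E))) * (\<integral>\<^sup>+x. ennreal (exp (l * (F (x(i := a)) - g a))) \<partial>?PI)"
      by (rule nn_integral_cmult, rule measurable_compose[OF mFa[OF a], of "\<lambda>u. ennreal (exp (l * (u - g a)))" borel]) simp
    also have "(\<integral>\<^sup>+x. ennreal (exp (l * (F (x(i := a)) - g a))) \<partial>?PI) \<le> ennreal ?K"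
      unfolding g_def
    proof (rule insert.IH[OF mFa[OF a]])
      fix x assume x: "x \<in> space ?PI"
      show "\<bar>F (x(i := a))\<bar> \<le> B" by (rule insert.prems(2)[OF upd[OF x a]])
      fix j b assume j: "j \<in> I" "b \<in> space \<nu>"
      then have "j \<noteq> i" using insert.hyps by auto
      then have e: "x(j := b, i := a) = x(i := a, j := b)" by (rule fun_upd_twist)
      show "\<bar>F (x(i := a)) - F (x(j := b, i := a))\<bar> \<le> c"
        unfolding e by (rule insert.prems(3)[OF upd[OF x a]]) (use j in auto)
    qed
    finally show "(\<integral>\<^sup>+x. ennreal (exp (l * (F (x(i := a)) - ?E))) \<partial>?PI) \<le> ennreal (exp (l * (g a - ?E))) * ennreal ?K"
      by (simp add: mult_left_mono)
  qed
  also have "\<dots> = (\<integral>\<^sup>+a. ennreal (exp (l * (g a - ?E))) \<partial>\<nu>) * ennreal ?K"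
    by (intro nn_integral_multc) measurable
  also have "(\<integral>\<^sup>+a. ennreal (exp (l * (g a - ?E))) \<partial>\<nu>) \<le> ennreal (exp (l\<^sup>2 * ((g a0 + c) - (g a0 - c))\<^sup>2 / 8))"
    unfolding Eg by (rule H.Hoeffdings_lemma_nn_integral[OF l])
  also have "ennreal (exp (l\<^sup>2 * ((g a0 + c) - (g a0 - c))\<^sup>2 / 8)) * ennreal ?K = ennreal (exp (l\<^sup>2 * c\<^sup>2 * card (insert i I) / 2))"
    using insert.hyps by (simp add: ennreal_mult[symmetric] exp_add[symmetric] power2_eq_square algebra_simps add_divide_distrib)
  finally show ?case by (simp add: mult_right_mono)
qed

text \<open>The Chernoff bound for \<open>F\<close> and \<open>- F\<close>, with the exponent \<open>l\<close> that optimises it.\<close>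

theorem bounded_differences_inequality:
  fixes F :: "('i \<Rightarrow> 'a) \<Rightarrow> real" and \<nu> :: "'a measure"
  assumes \<nu>: "prob_space \<nu>" and fin: "finite I" "I \<noteq> {}" and c: "c > 0" and \<delta>: "\<delta> > 0"
    and F: "F \<in> borel_measurable (PiM I (\<lambda>_. \<nu>))"
    and bdd: "\<And>x. x \<in> space (PiM I (\<lambda>_. \<nu>)) \<Longrightarrow> \<bar>F x\<bar> \<le> B"
    and diff: "\<And>x i a. x \<in> space (PiM I (\<lambda>_. \<nu>)) \<Longrightarrow> i \<in> I \<Longrightarrow> a \<in> space \<nu> \<Longrightarrow> \<bar>F x - F (x(i := a))\<bar> \<le> c"
  defines "P \<equiv> PiM I (\<lambda>_. \<nu>)"
  shows "measure P {x \<in> space P. \<delta> \<le> \<bar>F x - (\<integral>x. F x \<partial>P)\<bar>} \<le> 2 * exp (- (\<delta>\<^sup>2 / (2 * c\<^sup>2 * card I)))"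
proof -
  interpret nu: prob_space \<nu> by fact
  interpret PP: product_prob_space "\<lambda>_::'i. \<nu>" ..
  interpret P: prob_space P unfolding P_def by (rule prob_space_PiM) (rule \<nu>)
  have m: "card I > 0" using fin by (simp add: card_gt_0_iff)
  define l where "l = \<delta> / (c\<^sup>2 * card I)"
  have l: "l > 0" using \<delta> c m by (simp add: l_def)
  let ?b = "exp (- (\<delta>\<^sup>2 / (2 * c\<^sup>2 * card I)))"
  have one: "measure P {x \<in> space P. \<delta> \<le> f x - (\<integral>x. f x \<partial>P)} \<le> ?b"
    if f: "f \<in> borel_measurable P" and fb: "\<And>x. x \<in> space P \<Longrightarrow> \<bar>f x\<bar> \<le> B"
      and fd: "\<And>x i a. x \<in> space P \<Longrightarrow> i \<in> I \<Longrightarrow> a \<in> space \<nu> \<Longrightarrow> \<bar>f x - f (x(i := a))\<bar> \<le> c" for f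
  proof -
    note [measurable] = f
    let ?E = "\<integral>x. f x \<partial>P"
    have "emeasure P {x \<in> space P. \<delta> \<le> f x - ?E} \<le> (\<integral>\<^sup>+x. ennreal (exp (- l * \<delta>)) * ennreal (exp (l * (f x - ?E))) \<partial>P)"
    proof -
      have "emeasure P {x \<in> space P. \<delta> \<le> f x - ?E} = (\<integral>\<^sup>+x. indicator {x \<in> space P. \<delta> \<le> f x - ?E} x \<partial>P)"
        by (intro nn_integral_indicator[symmetric]) measurable
      also have "\<dots> \<le> (\<integral>\<^sup>+x. ennreal (exp (- l * \<delta>)) * ennreal (exp (l * (f x - ?E))) \<partial>P)"
        using l by (intro nn_integral_mono) (auto simp: indicator_def ennreal_mult[symmetric] exp_add[symmetric] intro!: mult_left_mono)
      finally show ?thesis .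
    qed
    also have "\<dots> = ennreal (exp (- l * \<delta>)) * (\<integral>\<^sup>+x. ennreal (exp (l * (f x - ?E))) \<partial>P)"
      by (intro nn_integral_cmult) measurable
    also have "\<dots> \<le> ennreal (exp (- l * \<delta>)) * ennreal (exp (l\<^sup>2 * c\<^sup>2 * card I / 2))"
      using bounded_differences_mgf[OF \<nu> fin(1) l f[unfolded P_def] fb[unfolded P_def] fd[unfolded P_def]]
      by (intro mult_left_mono) (auto simp: P_def)
    also have "\<dots> = ennreal (exp (- l * \<delta> + l\<^sup>2 * c\<^sup>2 * card I / 2))"
      by (simp add: ennreal_mult[symmetric] exp_add[symmetric])
    also have "- l * \<delta> + l\<^sup>2 * c\<^sup>2 * card I / 2 = - (\<delta>\<^sup>2 / (2 * c\<^sup>2 * card I))"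
      using c m by (simp add: l_def power2_eq_square divide_simps)
    finally show ?thesis by (simp add: P.emeasure_eq_measure)
  qed
  have sub: "{x \<in> space P. \<delta> \<le> \<bar>F x - (\<integral>x. F x \<partial>P)\<bar>}
      \<subseteq> {x \<in> space P. \<delta> \<le> F x - (\<integral>x. F x \<partial>P)} \<union> {x \<in> space P. \<delta> \<le> - F x - (\<integral>x. - F x \<partial>P)}"
    by auto
  note [measurable] = F[folded P_def]
  have "measure P {x \<in> space P. \<delta> \<le> \<bar>F x - (\<integral>x. F x \<partial>P)\<bar>}
      \<le> measure P ({x \<in> space P. \<delta> \<le> F x - (\<integral>x. F x \<partial>P)} \<union> {x \<in> space P. \<delta> \<le> - F x - (\<integral>x. - F x \<partial>P)})"
    by (intro P.finite_measure_mono sub) measurable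
  also have "\<dots> \<le> measure P {x \<in> space P. \<delta> \<le> F x - (\<integral>x. F x \<partial>P)} + measure P {x \<in> space P. \<delta> \<le> - F x - (\<integral>x. - F x \<partial>P)}"
    by (intro measure_Un_le) measurable
  also have "\<dots> \<le> ?b + ?b"
    using bdd diff by (intro add_mono one borel_measurable_uminus F[folded P_def]) (auto simp: P_def abs_minus_commute)
  finally show ?thesis by simp
qed

section \<open>Stieltjes transforms\<close>

lemma upper_half_plane_minus_real:
  assumes "Im z > 0"
  shows "z - complex_of_real t \<noteq> 0" "cmod (1 / (z - complex_of_real t)) \<le> 1 / Im z"
proof -
  have "Im z \<le> cmod (z - complex_of_real t)" using abs_Im_le_cmod[of "z - of_real t"] by simp
  then show "z - complex_of_real t \<noteq> 0" "cmod (1 / (z - complex_of_real t)) \<le> 1 / Im z"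
    using assms by (auto simp: norm_divide frac_le)
qed

lemma stieltjes_power_integrable:
  assumes "real_distribution \<mu>" and z: "Im z > 0"
  shows "integrable \<mu> (\<lambda>t. 1 / (z - complex_of_real t) ^ k)"
proof -
  interpret real_distribution \<mu> by fact
  have "cmod (1 / (z - complex_of_real t) ^ k) \<le> (1 / Im z) ^ k" for t
    using power_mono[OF upper_half_plane_minus_real(2)[OF z, of t], of k] by (simp add: norm_divide norm_power power_divide)
  then show ?thesis by (intro integrable_const_bound[where B = "(1 / Im z) ^ k"]) auto
qed

text \<open>Differentiation under the integral sign: the difference quotients are finite geometric-type sums, bounded
  uniformly in \<open>t\<close> on a half-plane around \<open>z\<close>.\<close>

lemma stieltjes_power_deriv:
  assumes \<mu>: "real_distribution \<mu>" and z: "Im z > 0"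
  shows "((\<lambda>z. \<integral>t. 1 / (z - complex_of_real t) ^ k \<partial>\<mu>) has_field_derivative
           - of_nat k * (\<integral>t. 1 / (z - complex_of_real t) ^ Suc k \<partial>\<mu>)) (at z)"
proof -
  interpret real_distribution \<mu> by fact
  let ?F = "\<lambda>z. \<integral>t. 1 / (z - complex_of_real t) ^ k \<partial>\<mu>"
  let ?B = "real k * (2 / Im z) ^ Suc k"
  have "(\<lambda>n. (?F (X n) - ?F z) / (X n - z)) \<longlonglongrightarrow> - of_nat k * (\<integral>t. 1 / (z - complex_of_real t) ^ Suc k \<partial>\<mu>)"
    if X: "\<And>n. X n \<noteq> z" "X \<longlonglongrightarrow> z" "\<And>n. Im (X n) > Im z / 2" for X
  proof -
    have Xp: "Im (X n) > 0" for n using X(3)[of n] z by linarith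
    define q where "q n t = - (\<Sum>i<k. (1 / (X n - complex_of_real t)) ^ Suc i * (1 / (z - of_real t)) ^ (k - i))" for n t
    have quot: "(1 / (X n - complex_of_real t) ^ k - 1 / (z - of_real t) ^ k) / (X n - z) = q n t" for n t
    proof -
      let ?a = "1 / (X n - complex_of_real t)" and ?b = "1 / (z - complex_of_real t)"
      have ab: "?a - ?b = - (X n - z) * (?a * ?b)"
        using upper_half_plane_minus_real(1)[OF Xp[of n], of t] upper_half_plane_minus_real(1)[OF z, of t] by (simp add: field_simps)
      have "?a ^ k - ?b ^ k = (?a - ?b) * (\<Sum>i<k. ?b ^ (k - Suc i) * ?a ^ i)" by (rule power_diff_sumr2)
      also have "\<dots> = (X n - z) * (- (\<Sum>i<k. ?a * ?b * (?b ^ (k - Suc i) * ?a ^ i)))"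
        unfolding ab sum_distrib_left[symmetric] by (simp only: mult_minus_left mult_minus_right mult.assoc)
      also have "(\<Sum>i<k. ?a * ?b * (?b ^ (k - Suc i) * ?a ^ i)) = (\<Sum>i<k. ?a ^ Suc i * ?b ^ (k - i))"
      proof (intro sum.cong refl)
        fix i assume "i \<in> {..<k}"
        then have "k - i = Suc (k - Suc i)" by auto
        then show "?a * ?b * (?b ^ (k - Suc i) * ?a ^ i) = ?a ^ Suc i * ?b ^ (k - i)" by (simp only: power_Suc mult_ac)
      qed
      finally have "?a ^ k - ?b ^ k = (X n - z) * q n t" unfolding q_def .
      then show ?thesis using X(1)[of n] by (simp add: power_one_over)
    qed
    have qb: "cmod (q n t) \<le> ?B" for n t
    proof -
      have a: "cmod (1 / (X n - complex_of_real t)) \<le> 2 / Im z"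
      proof -
        have "1 / Im (X n) \<le> 2 / Im z" using X(3)[of n] z by (simp add: field_simps)
        then show ?thesis using upper_half_plane_minus_real(2)[OF Xp[of n], of t] by linarith
      qed
      have b: "cmod (1 / (z - complex_of_real t)) \<le> 2 / Im z"
      proof -
        have "1 / Im z \<le> 2 / Im z" using z by (simp add: field_simps)
        then show ?thesis using upper_half_plane_minus_real(2)[OF z, of t] by linarith
      qed
      have "cmod (q n t) \<le> (\<Sum>i<k. (2 / Im z) ^ Suc i * (2 / Im z) ^ (k - i))"
        unfolding q_def norm_minus_cancel
      proof (rule sum_norm_le)
        fix i assume "i \<in> {..<k}"
        show "norm ((1 / (X n - complex_of_real t)) ^ Suc i * (1 / (z - complex_of_real t)) ^ (k - i)) \<le> (2 / Im z) ^ Suc i * (2 / Im z) ^ (k - i)"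
          unfolding norm_mult norm_power using z by (intro mult_mono power_mono a b) auto
      qed
      also have "\<dots> = (\<Sum>i<k. (2 / Im z) ^ Suc k)"
        by (intro sum.cong refl) (subst power_add[symmetric], auto)
      finally show ?thesis by simp
    qed
    have lim: "(\<lambda>n. q n t) \<longlonglongrightarrow> - of_nat k * (1 / (z - complex_of_real t) ^ Suc k)" for t
    proof -
      have "(\<lambda>n. q n t) \<longlonglongrightarrow> - (\<Sum>i<k. (1 / (z - complex_of_real t)) ^ Suc i * (1 / (z - of_real t)) ^ (k - i))"
        unfolding q_def using upper_half_plane_minus_real(1)[OF z, of t] by (intro tendsto_intros X(2)) auto
      also have "(\<Sum>i<k. (1 / (z - complex_of_real t)) ^ Suc i * (1 / (z - of_real t)) ^ (k - i)) = (\<Sum>i<k. (1 / (z - complex_of_real t)) ^ Suc k)"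
        by (intro sum.cong refl) (subst power_add[symmetric], auto)
      finally show ?thesis by (simp add: power_one_over)
    qed
    have "(\<lambda>n. \<integral>t. q n t \<partial>\<mu>) \<longlonglongrightarrow> (\<integral>t. - of_nat k * (1 / (z - complex_of_real t) ^ Suc k) \<partial>\<mu>)"
      by (rule integral_dominated_convergence[where w = "\<lambda>_. ?B"]) (use qb lim in \<open>auto simp: q_def\<close>)
    also have "(\<lambda>n. \<integral>t. q n t \<partial>\<mu>) = (\<lambda>n. (?F (X n) - ?F z) / (X n - z))"
      unfolding quot[symmetric]
      using stieltjes_power_integrable[OF \<mu> Xp] stieltjes_power_integrable[OF \<mu> z] by simp
    finally show ?thesis unfolding integral_mult_right_zero .
  qed
  moreover define S where "S = {w. Im w > Im z / 2}"
  moreover have "open S" unfolding S_def by (rule open_halfspace_Im_gt)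
  moreover have "z \<in> S" using z by (simp add: S_def)
  ultimately have "((\<lambda>w. (?F w - ?F z) / (w - z)) \<longlongrightarrow> - of_nat k * (\<integral>t. 1 / (z - complex_of_real t) ^ Suc k \<partial>\<mu>)) (at z within S)"
    unfolding tendsto_at_iff_sequentially comp_def by auto
  then show ?thesis
    unfolding has_field_derivative_iff at_within_open[OF \<open>z \<in> S\<close> \<open>open S\<close>] .
qed

lemma stieltjes_holomorphic:
  assumes "real_distribution \<mu>"
  shows "stieltjes \<mu> holomorphic_on {z. Im z > 0}"
  unfolding holomorphic_on_def field_differentiable_def
  using stieltjes_power_deriv[OF assms, of _ 1] unfolding stieltjes_def
  by (auto intro: has_field_derivative_at_within)

lemma complex_exp_limit:
  fixes w :: complex
  shows "(\<lambda>n. (1 + w / of_nat n) ^ n) \<longlonglongrightarrow> exp w"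
proof (cases "w = 0")
  case False
  have "((\<lambda>h. (Ln (1 + h) - Ln 1) / h) \<longlongrightarrow> 1) (at 0)"
    using has_field_derivative_Ln[of 1] unfolding DERIV_def by simp
  moreover have "filterlim (\<lambda>n. w / of_nat n) (at 0) sequentially"
    using False by (auto simp: filterlim_at eventually_sequentially intro!: exI[of _ 1] lim_1_over_n tendsto_divide_0 tendsto_of_nat)
  ultimately have "(\<lambda>n. Ln (1 + w / of_nat n) / (w / of_nat n)) \<longlonglongrightarrow> 1"
    using filterlim_compose by fastforce
  from tendsto_exp[OF tendsto_mult[OF this tendsto_const[of w]]]
  have *: "(\<lambda>n. exp (Ln (1 + w / of_nat n) / (w / of_nat n) * w)) \<longlonglongrightarrow> exp w" by simp
  have "(\<lambda>n. 1 + w / of_nat n) \<longlonglongrightarrow> 1 + 0"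
    by (intro tendsto_add tendsto_const tendsto_divide_0[OF tendsto_const]) (rule tendsto_of_nat)
  then have "eventually (\<lambda>n. 1 + w / of_nat n \<noteq> 0) sequentially"
    by (rule tendsto_imp_eventually_ne) simp
  then have "eventually (\<lambda>n. exp (Ln (1 + w / of_nat n) / (w / of_nat n) * w) = (1 + w / of_nat n) ^ n) sequentially"
    using eventually_gt_at_top[of 0]
  proof eventually_elim
    case (elim n)
    then have "exp (Ln (1 + w / of_nat n) / (w / of_nat n) * w) = exp (of_nat n * Ln (1 + w / of_nat n))"
      using False by (simp add: field_simps)
    also have "\<dots> = (1 + w / of_nat n) ^ n" using elim by (simp add: exp_of_nat_mult)
    finally show ?case .
  qed
  with * show ?thesis by (rule Lim_transform_eventually)
qed simp

text \<open>Differentiating repeatedly, the Stieltjes transform determines the integrals of \<open>(z - t) ^ - k\<close>. At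
  \<open>z = - \<i> k / u\<close> and after multiplication with \<open>z ^ k\<close>, the integrand becomes \<open>(1 - \<i> u t / k) ^ - k\<close>, which
  tends to \<open>exp (\<i> u t)\<close>. So the characteristic function is determined, at first for \<open>u < 0\<close>, where
  \<open>z\<close> is in the upper half-plane.\<close>

theorem stieltjes_unique:
  assumes \<mu>: "real_distribution \<mu>" and \<nu>: "real_distribution \<nu>"
    and eq: "\<And>z. Im z > 0 \<Longrightarrow> stieltjes \<mu> z = stieltjes \<nu> z"
  shows "\<mu> = \<nu>"
proof -
  let ?F = "\<lambda>M k z. \<integral>t. 1 / (z - complex_of_real t) ^ k \<partial>M"
  have pow: "?F \<mu> (Suc k) z = ?F \<nu> (Suc k) z" if "Im z > 0" for k z
    using that
  proof (induction k arbitrary: z)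
    case 0 then show ?case using eq by (simp add: stieltjes_def)
  next
    case (Suc k)
    have "(?F \<mu> (Suc k) has_field_derivative - of_nat (Suc k) * ?F \<mu> (Suc (Suc k)) z) (at z)"
      by (rule stieltjes_power_deriv[OF \<mu> Suc.prems])
    moreover have "(?F \<nu> (Suc k) has_field_derivative - of_nat (Suc k) * ?F \<nu> (Suc (Suc k)) z) (at z)"
      by (rule stieltjes_power_deriv[OF \<nu> Suc.prems])
    then have "(?F \<mu> (Suc k) has_field_derivative - of_nat (Suc k) * ?F \<nu> (Suc (Suc k)) z) (at z)"
      by (rule has_field_derivative_transform_within_open[where S = "{z. Im z > 0}"])
        (use Suc in \<open>auto simp: open_halfspace_Im_gt\<close>)
    ultimately have "- of_nat (Suc k) * ?F \<mu> (Suc (Suc k)) z = - of_nat (Suc k) * ?F \<nu> (Suc (Suc k)) z"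
      by (rule DERIV_unique)
    then show ?case by (simp del: of_nat_Suc)
  qed
  \<comment> \<open>the factor \<open>z ^ Suc k\<close> normalises the integrand to \<open>(1 - \<i> u t / Suc k) ^ - Suc k\<close>\<close>
  have chlim: "(\<lambda>k. ?F M (Suc k) (- \<i> * of_nat (Suc k) / of_real u) * (- \<i> * of_nat (Suc k) / of_real u) ^ Suc k) \<longlonglongrightarrow> char M u"
    if M: "real_distribution M" and u: "u < 0" for M u
  proof -
    interpret real_distribution M by fact
    let ?z = "\<lambda>k. - \<i> * of_nat (Suc k) / complex_of_real u"
    have z: "Im (?z k) > 0" for k using u by (simp add: Im_divide_of_real divide_pos_neg)
    define f where "f k t = 1 / (?z k - complex_of_real t) ^ Suc k * ?z k ^ Suc k" for k t
    have f: "f k t = 1 / (1 + (- \<i> * of_real (u * t)) / of_nat (Suc k)) ^ Suc k" for k t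
    proof -
      have e: "1 + (- \<i> * of_real (u * t)) / of_nat (Suc k) = (?z k - of_real t) / ?z k"
        using u by (simp add: field_simps del: of_nat_Suc)
      have "1 / a * b = 1 / (a / b)" for a b :: complex by simp
      then show ?thesis unfolding f_def e power_divide[of "?z k - of_real t" "?z k"] .
    qed
    have "(\<lambda>k. f k t) \<longlonglongrightarrow> 1 / exp (- \<i> * of_real (u * t))" for t
      unfolding f using LIMSEQ_Suc[OF complex_exp_limit[of "- \<i> * of_real (u * t)"]]
      by (intro tendsto_divide tendsto_const) auto
    then have lim: "(\<lambda>k. f k t) \<longlonglongrightarrow> iexp (u * t)" for t by (simp add: exp_minus inverse_eq_divide)
    have bd: "cmod (f k t) \<le> 1" for k t
    proof -
      have "1 \<le> cmod (1 + (- \<i> * of_real (u * t)) / of_nat (Suc k))"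
        using complex_Re_le_cmod[of "1 + (- \<i> * of_real (u * t)) / of_nat (Suc k)"] by (simp add: Re_divide del: of_nat_Suc)
      from power_mono[OF this, of "Suc k"] show ?thesis
        unfolding f norm_divide norm_power by (simp add: divide_le_eq_1 del: power_Suc of_nat_Suc)
    qed
    have "(\<lambda>k. \<integral>t. f k t \<partial>M) \<longlonglongrightarrow> (\<integral>t. iexp (u * t) \<partial>M)"
      by (rule integral_dominated_convergence[where w = "\<lambda>_. 1"]) (use bd lim in \<open>auto simp: f_def\<close>)
    moreover have "(\<integral>t. f k t \<partial>M) = ?F M (Suc k) (?z k) * ?z k ^ Suc k" for k
      unfolding f_def by (rule integral_mult_left_zero)
    ultimately show ?thesis by (simp add: char_def)
  qed
  have neg: "char \<mu> u = char \<nu> u" if u: "u < 0" for u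
  proof -
    have "?F \<mu> (Suc k) (- \<i> * of_nat (Suc k) / of_real u) = ?F \<nu> (Suc k) (- \<i> * of_nat (Suc k) / of_real u)" for k
      by (rule pow) (use u in \<open>simp add: Im_divide_of_real divide_pos_neg\<close>)
    then show ?thesis using chlim[OF \<mu> u] chlim[OF \<nu> u] LIMSEQ_unique by simp
  qed
  have "char \<mu> u = char \<nu> u" for u
  proof -
    have cn: "char M (- v) = cnj (char M v)" for M v
    proof -
      have "cnj (char M v) = (\<integral>x. cnj (iexp (v * x)) \<partial>M)" unfolding char_def by (rule Bochner_Integration.integral_cnj[symmetric])
      also have "\<dots> = char M (- v)" unfolding char_def by (simp add: exp_cnj)
      finally show ?thesis by simp
    qed
    consider "u < 0" | "u = 0" | "u > 0" by linarith
    then show ?thesis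
    proof cases
      case 3 then show ?thesis using neg[of "- u"] cn[of \<mu> u] cn[of \<nu> u] by simp
    qed (use neg real_distribution.char_zero[OF \<mu>] real_distribution.char_zero[OF \<nu>] in auto)
  qed
  then show ?thesis by (intro Levy_uniqueness[OF \<mu> \<nu>]) auto
qed

section \<open>The Marchenko--Pastur equation\<close>

text \<open>The Marchenko--Pastur equation is \<open>m = mp_rhs H z (mp_factor \<gamma> z m)\<close>. The factor is separated from the
  integral because all estimates are made for factors in the closed lower half-plane.\<close>

definition mp_factor :: "real \<Rightarrow> complex \<Rightarrow> complex \<Rightarrow> complex" where
  "mp_factor \<gamma> z m = 1 - of_real \<gamma> + of_real \<gamma> * z * m"

definition mp_rhs :: "real measure \<Rightarrow> complex \<Rightarrow> complex \<Rightarrow> complex" where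
  "mp_rhs H z b = (\<integral>t. 1 / (z - of_real t * b) \<partial>H)"

lemma (in prob_space) norm_integral_le:
  fixes f :: "'a \<Rightarrow> 'b::{banach, second_countable_topology}"
  assumes "AE x in M. norm (f x) \<le> B" and "0 \<le> B"
  shows "norm (\<integral>x. f x \<partial>M) \<le> B"
proof (cases "integrable M f")
  case True
  have "norm (\<integral>x. f x \<partial>M) \<le> (\<integral>x. norm (f x) \<partial>M)" by simp
  also have "\<dots> \<le> (\<integral>x. B \<partial>M)" using True assms(1) by (intro integral_mono_AE) auto
  finally show ?thesis by (simp add: prob_space)
qed (use assms in \<open>simp add: not_integrable_integral_eq\<close>)

lemma mp_denominator:
  assumes z: "Im z > 0" and b: "Im b \<le> 0" and t: "0 \<le> t"
  shows "Im z \<le> cmod (z - complex_of_real t * b)" "z - complex_of_real t * b \<noteq> 0" "cmod (1 / (z - complex_of_real t * b)) \<le> 1 / Im z"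
proof -
  have "t * Im b \<le> 0" using b t by (simp add: mult_nonneg_nonpos)
  then have "Im z \<le> Im (z - complex_of_real t * b)" by simp
  also have "\<dots> \<le> cmod (z - complex_of_real t * b)" by (rule order_trans[OF abs_ge_self abs_Im_le_cmod])
  finally show "Im z \<le> cmod (z - complex_of_real t * b)" .
  then show "z - complex_of_real t * b \<noteq> 0" "cmod (1 / (z - complex_of_real t * b)) \<le> 1 / Im z"
    using z by (auto simp: norm_divide frac_le)
qed

lemma stieltjes_bounds:
  assumes \<mu>: "real_distribution \<mu>" and pos: "AE t in \<mu>. 0 \<le> t" and z: "Im z > 0"
  shows "Im (z * stieltjes \<mu> z) \<le> 0" "cmod (stieltjes \<mu> z) \<le> 1 / Im z"
    "0 \<le> \<gamma> \<Longrightarrow> Im (mp_factor \<gamma> z (stieltjes \<mu> z)) \<le> 0"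
proof -
  interpret real_distribution \<mu> by fact
  have int: "integrable \<mu> (\<lambda>t. 1 / (z - complex_of_real t))" using stieltjes_power_integrable[OF \<mu> z, of 1] by simp
  have "Im (z * (1 / (z - complex_of_real t))) \<le> 0" if "0 \<le> t" for t
  proof -
    have "Im (z * (1 / (z - complex_of_real t))) = - (t * Im z) / (cmod (z - of_real t))\<^sup>2"
      by (simp add: Im_divide cmod_power2 algebra_simps)
    then show ?thesis using that z by (simp add: divide_nonpos_nonneg)
  qed
  then have "0 \<le> (\<integral>t. - Im (z * (1 / (z - complex_of_real t))) \<partial>\<mu>)"
    using pos by (intro integral_nonneg_AE) auto
  also have "\<dots> = - Im (z * stieltjes \<mu> z)"
    unfolding stieltjes_def using int by (simp only: integral_mult_right_zero[symmetric] integral_minus integral_Im integrable_mult_right)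
  finally show 1: "Im (z * stieltjes \<mu> z) \<le> 0" by simp
  show "cmod (stieltjes \<mu> z) \<le> 1 / Im z"
    unfolding stieltjes_def using upper_half_plane_minus_real(2)[OF z] z by (intro norm_integral_le) auto
  show "Im (mp_factor \<gamma> z (stieltjes \<mu> z)) \<le> 0" if "0 \<le> \<gamma>"
  proof -
    have "Im (mp_factor \<gamma> z (stieltjes \<mu> z)) = \<gamma> * Im (z * stieltjes \<mu> z)"
      by (simp add: mp_factor_def algebra_simps)
    then show ?thesis using 1 that by (simp add: mult_nonneg_nonpos)
  qed
qed

lemma mp_rhs_lipschitz:
  assumes H: "real_distribution H" and supp: "AE t in H. 0 \<le> t \<and> t \<le> \<tau>" and \<tau>: "0 \<le> \<tau>"
    and z: "Im z > 0" and b: "Im b \<le> 0" and b': "Im b' \<le> 0"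
  shows "cmod (mp_rhs H z b - mp_rhs H z b') \<le> \<tau> * cmod (b - b') / (Im z)\<^sup>2"
proof -
  interpret real_distribution H by fact
  have int: "integrable H (\<lambda>t. 1 / (z - complex_of_real t * c))" if "Im c \<le> 0" for c
    using supp mp_denominator(3)[OF z that] by (intro integrable_const_bound[where B = "1 / Im z"]) auto
  have "mp_rhs H z b - mp_rhs H z b' = (\<integral>t. 1 / (z - of_real t * b) - 1 / (z - of_real t * b') \<partial>H)"
    unfolding mp_rhs_def using int b b' by simp
  also have "cmod \<dots> \<le> \<tau> * cmod (b - b') / (Im z)\<^sup>2"
  proof (rule norm_integral_le)
    show "AE t in H. cmod (1 / (z - of_real t * b) - 1 / (z - of_real t * b')) \<le> \<tau> * cmod (b - b') / (Im z)\<^sup>2"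
      using supp
    proof eventually_elim
      case (elim t)
      note d = mp_denominator[OF z b, of t] mp_denominator[OF z b', of t]
      have "1 / (z - of_real t * b) - 1 / (z - of_real t * b') = of_real t * (b - b') * (1 / (z - of_real t * b) * (1 / (z - of_real t * b')))"
        using d(2,5) elim by (simp add: field_simps)
      then have "cmod (1 / (z - of_real t * b) - 1 / (z - of_real t * b'))
          = t * cmod (b - b') * (cmod (1 / (z - of_real t * b)) * cmod (1 / (z - of_real t * b')))"
        using elim by (simp only: norm_mult norm_of_real abs_of_nonneg)
      also have "\<dots> \<le> \<tau> * cmod (b - b') * (1 / Im z * (1 / Im z))"
        using d(3,6) elim z \<tau> by (intro mult_mono) auto
      finally show ?case by (simp add: power2_eq_square)
    qed
  qed (use \<tau> in auto)
  finally show ?thesis .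
qed

text \<open>Where \<open>Im z\<close> is large and \<open>\<bar>z\<bar> < 2 Im z\<close>, the right-hand side of the equation is a contraction in
  \<open>m\<close>, so the two transforms agree on an open set, and hence everywhere by analytic continuation.\<close>

theorem mp_unique:
  assumes \<mu>: "real_distribution \<mu>" "AE t in \<mu>. 0 \<le> t" and \<nu>: "real_distribution \<nu>" "AE t in \<nu>. 0 \<le> t"
    and H: "real_distribution H" "AE t in H. 0 \<le> t \<and> t \<le> \<tau>" and \<tau>: "0 \<le> \<tau>" and \<gamma>: "0 \<le> \<gamma>"
    and eq\<mu>: "\<And>z. Im z > 0 \<Longrightarrow> stieltjes \<mu> z = mp_rhs H z (mp_factor \<gamma> z (stieltjes \<mu> z))"
    and eq\<nu>: "\<And>z. Im z > 0 \<Longrightarrow> stieltjes \<nu> z = mp_rhs H z (mp_factor \<gamma> z (stieltjes \<nu> z))"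
  shows "\<mu> = \<nu>"
proof (rule stieltjes_unique[OF \<mu>(1) \<nu>(1)])
  define S where "S = {z. Im z > 2 * \<tau> * \<gamma> + 1 \<and> cmod z < 2 * Im z}"
  have contr: "stieltjes \<mu> z = stieltjes \<nu> z" if "z \<in> S" for z
  proof (rule ccontr)
    assume ne: "stieltjes \<mu> z \<noteq> stieltjes \<nu> z"
    let ?m = "stieltjes \<mu> z" and ?m' = "stieltjes \<nu> z"
    have y: "2 * \<tau> * \<gamma> < Im z" "cmod z < 2 * Im z" using that by (auto simp: S_def)
    have z: "Im z > 0" using y(1) \<tau> \<gamma> mult_nonneg_nonneg[OF \<tau> \<gamma>] by linarith
    have "cmod (?m - ?m') \<le> \<tau> * cmod (mp_factor \<gamma> z ?m - mp_factor \<gamma> z ?m') / (Im z)\<^sup>2"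
      by (subst eq\<mu>[OF z], subst eq\<nu>[OF z], rule mp_rhs_lipschitz[OF H \<tau> z])
        (use stieltjes_bounds(3)[OF \<mu> z \<gamma>] stieltjes_bounds(3)[OF \<nu> z \<gamma>] in auto)
    also have "mp_factor \<gamma> z ?m - mp_factor \<gamma> z ?m' = of_real \<gamma> * z * (?m - ?m')"
      by (simp add: mp_factor_def algebra_simps)
    also have "\<tau> * cmod (of_real \<gamma> * z * (?m - ?m')) / (Im z)\<^sup>2 = \<tau> * \<gamma> * cmod z / (Im z)\<^sup>2 * cmod (?m - ?m')"
      using \<gamma> by (simp add: norm_mult)
    finally have "1 * cmod (?m - ?m') \<le> \<tau> * \<gamma> * cmod z / (Im z)\<^sup>2 * cmod (?m - ?m')" by simp
    then have "1 \<le> \<tau> * \<gamma> * cmod z / (Im z)\<^sup>2" by (rule mult_right_le_imp_le) (use ne in simp)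
    also have "\<dots> \<le> \<tau> * \<gamma> * (2 * Im z) / (Im z)\<^sup>2"
      using y \<tau> \<gamma> by (intro divide_right_mono mult_left_mono) auto
    also have "\<dots> = 2 * \<tau> * \<gamma> / Im z" using z by (simp add: power2_eq_square)
    also have "\<dots> < 1" using y z by simp
    finally show False by simp
  qed
  fix z :: complex assume z: "Im z > 0"
  show "stieltjes \<mu> z = stieltjes \<nu> z"
  proof (rule analytic_continuation_open[of S "{z. Im z > 0}" "stieltjes \<mu>" "stieltjes \<nu>"])
    have "S = {z. Im z > 2 * \<tau> * \<gamma> + 1} \<inter> {z. cmod z < 2 * Im z}" by (auto simp: S_def)
    moreover have "open {z. cmod z < 2 * Im z}" by (intro open_Collect_less continuous_intros)
    ultimately show "open S" by (simp add: open_Int open_halfspace_Im_gt)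
    have "Complex 0 (2 * \<tau> * \<gamma> + 2) \<in> S"
      using mult_nonneg_nonneg[OF \<tau> \<gamma>] by (simp add: S_def cmod_def mult.commute[of \<gamma>])
    then show "S \<noteq> {}" by auto
    show "S \<subseteq> {z. Im z > 0}" using mult_nonneg_nonneg[OF \<tau> \<gamma>] by (auto simp: S_def)
    show "connected {z. Im z > 0}" by (simp add: convex_connected convex_halfspace_Im_gt)
  qed (use contr stieltjes_holomorphic \<mu> \<nu> z in \<open>auto simp: open_halfspace_Im_gt\<close>)
qed

text \<open>Closed constraints on the support survive weak limits; \<open>g\<close> measures the violation of the constraint.\<close>

lemma weak_limit_concentrated:
  fixes g :: "real \<Rightarrow> real"
  assumes \<mu>: "\<And>n. real_distribution (\<mu> n)" and \<nu>: "real_distribution \<nu>" and conv: "weak_conv_m \<mu> \<nu>"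
    and g: "\<And>t. isCont g t" "\<And>t. 0 \<le> g t" "\<And>t. g t \<le> B"
    and z: "\<And>n. AE t in \<mu> n. g t = 0"
  shows "AE t in \<nu>. g t = 0"
proof -
  interpret \<nu>: real_distribution \<nu> by fact
  have gm [measurable]: "g \<in> borel_measurable borel"
    using g(1) by (intro borel_measurable_continuous_onI continuous_at_imp_continuous_on) auto
  have "(\<lambda>n. \<integral>t. g t \<partial>\<mu> n) \<longlonglongrightarrow> (\<integral>t. g t \<partial>\<nu>)"
    by (rule weak_conv_imp_integral_bdd_continuous_conv[OF \<mu> \<nu> conv, where B = B]) (use g in auto)
  moreover have "(\<integral>t. g t \<partial>\<mu> n) = 0" for n using z by (rule integral_eq_zero_AE)
  ultimately have "(\<integral>t. g t \<partial>\<nu>) = 0" by (simp add: LIMSEQ_const_iff)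
  moreover have "integrable \<nu> g" using g by (intro \<nu>.integrable_const_bound[where B = B]) auto
  ultimately show ?thesis using integral_nonneg_eq_0_iff_AE[of \<nu> g] g(2) by simp
qed

lemma weak_limit_nonneg:
  assumes \<mu>: "\<And>n. real_distribution (\<mu> n)" and \<nu>: "real_distribution \<nu>" and conv: "weak_conv_m \<mu> \<nu>"
    and z: "\<And>n. AE t in \<mu> n. 0 \<le> t"
  shows "AE t in \<nu>. 0 \<le> t"
proof -
  have z': "AE t in \<mu> n. min 1 (max 0 (- t)) = 0" for n using z[of n] by eventually_elim (simp add: max_def)
  have "AE t in \<nu>. min 1 (max 0 (- t)) = 0"
    by (rule weak_limit_concentrated[OF \<mu> \<nu> conv _ _ _ z', where B = 1]) (auto intro!: continuous_intros)
  then show ?thesis by eventually_elim (auto simp: min_def max_def split: if_splits)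
qed

lemma weak_limit_bounded:
  assumes \<mu>: "\<And>n. real_distribution (\<mu> n)" and \<nu>: "real_distribution \<nu>" and conv: "weak_conv_m \<mu> \<nu>"
    and z: "\<And>n. AE t in \<mu> n. 0 \<le> t \<and> t \<le> \<tau>"
  shows "AE t in \<nu>. 0 \<le> t \<and> t \<le> \<tau>"
proof -
  have z': "AE t in \<mu> n. 0 \<le> t" for n using z[of n] by eventually_elim auto
  have z'': "AE t in \<mu> n. min 1 (max 0 (t - \<tau>)) = 0" for n using z[of n] by eventually_elim (simp add: max_def)
  have "AE t in \<nu>. min 1 (max 0 (t - \<tau>)) = 0"
    by (rule weak_limit_concentrated[OF \<mu> \<nu> conv _ _ _ z'', where B = 1]) (auto intro!: continuous_intros)
  then show ?thesis using weak_limit_nonneg[OF \<mu> \<nu> conv z'] by eventually_elim (auto simp: min_def max_def split: if_splits)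
qed

lemma stieltjes_weak_limit:
  assumes \<mu>: "\<And>n. real_distribution (\<mu> n)" and \<nu>: "real_distribution \<nu>" and conv: "weak_conv_m \<mu> \<nu>" and z: "Im z > 0"
  shows "(\<lambda>n. stieltjes (\<mu> n) z) \<longlonglongrightarrow> stieltjes \<nu> z"
  unfolding stieltjes_def
  by (rule weak_conv_imp_integral_bdd_continuous_conv[OF \<mu> \<nu> conv, where B = "1 / Im z"])
    (use upper_half_plane_minus_real[OF z] in \<open>auto intro!: continuous_intros\<close>)

text \<open>The integrand is bounded only for \<open>t \<ge> 0\<close>. With \<open>max 0 t\<close> in place of \<open>t\<close> it becomes bounded and
  continuous on the whole line, and the integrals do not change.\<close>

lemma mp_rhs_weak_limit:
  assumes h: "\<And>n. real_distribution (h n)" "\<And>n. AE t in h n. 0 \<le> t \<and> t \<le> \<tau>" and \<tau>: "0 \<le> \<tau>"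
    and H: "real_distribution H" and conv: "weak_conv_m h H"
    and z: "Im z > 0" and b: "\<And>n. Im (b n) \<le> 0" "b \<longlonglongrightarrow> b'"
  shows "(\<lambda>n. mp_rhs (h n) z (b n)) \<longlonglongrightarrow> mp_rhs H z b'"
proof -
  have b': "Im b' \<le> 0" using tendsto_Im[OF b(2)] b(1) by (intro LIMSEQ_le_const2) auto
  have supp: "AE t in H. 0 \<le> t \<and> t \<le> \<tau>" by (rule weak_limit_bounded[OF h(1) H conv h(2)])
  have "(\<lambda>n. \<integral>t. 1 / (z - of_real (max 0 t) * b') \<partial>h n) \<longlonglongrightarrow> (\<integral>t. 1 / (z - of_real (max 0 t) * b') \<partial>H)"
    by (rule weak_conv_imp_integral_bdd_continuous_conv[OF h(1) H conv, where B = "1 / Im z"])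
      (use mp_denominator[OF z b'] in \<open>auto intro!: continuous_intros\<close>)
  moreover have "(\<integral>t. 1 / (z - of_real (max 0 t) * b') \<partial>K) = mp_rhs K z b'" if "AE t in K. 0 \<le> t \<and> t \<le> \<tau>" "real_distribution K" for K
  proof -
    interpret K: real_distribution K by fact
    show ?thesis unfolding mp_rhs_def
      by (rule integral_cong_AE) (use that(1) in \<open>auto simp: max_def elim!: eventually_mono\<close>)
  qed
  ultimately have 1: "(\<lambda>n. mp_rhs (h n) z b') \<longlonglongrightarrow> mp_rhs H z b'" using h supp H by simp
  have "(\<lambda>n. \<tau> * cmod (b n - b') / (Im z)\<^sup>2) \<longlonglongrightarrow> \<tau> * cmod (b' - b') / (Im z)\<^sup>2"
    using z by (intro tendsto_intros b(2)) auto
  then have g0: "(\<lambda>n. \<tau> * cmod (b n - b') / (Im z)\<^sup>2) \<longlonglongrightarrow> 0" by simp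
  have "(\<lambda>n. mp_rhs (h n) z (b n) - mp_rhs (h n) z b') \<longlonglongrightarrow> 0"
    by (rule Lim_null_comparison[OF always_eventually g0]) (rule allI, rule mp_rhs_lipschitz[OF h(1,2) \<tau> z b(1) b'])
  from tendsto_add[OF this 1] show ?thesis by simp
qed

text \<open>The real part of \<open>1 - z / (z - t)\<close> at \<open>z = \<i> y\<close> is \<open>t\<^sup>2 / (t\<^sup>2 + y\<^sup>2)\<close>, which is at least
  \<open>1 / 2\<close> outside the interval.\<close>

lemma stieltjes_tail:
  assumes \<mu>: "real_distribution \<mu>" and y: "y > 0"
  shows "1 - measure \<mu> {- y<..y} \<le> 2 * cmod (\<i> * of_real y * stieltjes \<mu> (\<i> * of_real y) - 1)"
proof -
  interpret real_distribution \<mu> by fact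
  let ?z = "\<i> * complex_of_real y"
  have z: "Im ?z > 0" using y by simp
  have int: "integrable \<mu> (\<lambda>t. 1 / (?z - complex_of_real t))" using stieltjes_power_integrable[OF \<mu> z, of 1] by simp
  have re: "Re (1 - ?z * (1 / (?z - of_real t))) = t\<^sup>2 / (t\<^sup>2 + y\<^sup>2)" for t
  proof -
    have "t * t + y * y \<noteq> 0" using y by (simp add: add_nonneg_eq_0_iff)
    then show ?thesis by (simp add: Re_divide power2_eq_square) (simp add: field_simps)
  qed
  have "1 - measure \<mu> {- y<..y} = measure \<mu> (- {- y<..y})"
    using prob_compl[of "{- y<..y}"] by (simp add: Compl_eq_Diff_UNIV)
  also have "\<dots> = (\<integral>t. indicator (- {- y<..y}) t \<partial>\<mu>)" by simp
  also have "\<dots> \<le> (\<integral>t. 2 * Re (1 - ?z * (1 / (?z - of_real t))) \<partial>\<mu>)"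
  proof (rule integral_mono)
    show "integrable \<mu> (\<lambda>t. 2 * Re (1 - ?z * (1 / (?z - of_real t))))"
      using int by (intro integrable_mult_right integrable_Re Bochner_Integration.integrable_diff) auto
    fix t
    have "1 \<le> 2 * (t\<^sup>2 / (t\<^sup>2 + y\<^sup>2))" if "y \<le> \<bar>t\<bar>"
    proof -
      have "y\<^sup>2 \<le> t\<^sup>2" using that y by (metis abs_of_pos power2_le_iff_abs_le power2_abs abs_ge_zero less_imp_le)
      moreover have "t\<^sup>2 + y\<^sup>2 > 0" using y by (simp add: add_nonneg_pos)
      ultimately show ?thesis by (simp add: field_simps)
    qed
    then show "indicator (- {- y<..y}) t \<le> 2 * Re (1 - ?z * (1 / (?z - of_real t)))"
      unfolding re by (auto simp: indicator_def)
    show "integrable \<mu> (indicator (- {- y<..y}) :: real \<Rightarrow> real)"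
      by (intro integrable_const_bound[where B = 1]) auto
  qed
  also have "\<dots> = 2 * Re (1 - ?z * stieltjes \<mu> ?z)"
    unfolding stieltjes_def using int by (simp only: integral_mult_right_zero integral_Re Bochner_Integration.integrable_diff integrable_mult_right integrable_const Bochner_Integration.integral_diff) (use prob_space in simp)
  also have "\<dots> \<le> 2 * cmod (1 - ?z * stieltjes \<mu> ?z)" by (intro mult_left_mono complex_Re_le_cmod) simp
  finally show ?thesis by (simp add: norm_minus_commute)
qed

text \<open>If the Stieltjes transforms are asymptotically equal to approximate solutions \<open>w n\<close> of the equation, then the
  measures converge to the solution of the limiting equation. Convergence is only required on a dense set, which
  may be countable; it contains points arbitrarily high on the imaginary axis, where tightness is read off.\<close>

theorem mp_limit:
  assumes \<mu>: "\<And>n. real_distribution (\<mu> n)" "\<And>n. AE t in \<mu> n. 0 \<le> t"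
    and h: "\<And>n. real_distribution (h n)" "\<And>n. AE t in h n. 0 \<le> t \<and> t \<le> \<tau>" and \<tau>: "0 \<le> \<tau>"
    and H: "real_distribution H" and conv: "weak_conv_m h H"
    and g: "\<And>n. 0 \<le> g n" "g \<longlonglongrightarrow> \<gamma>"
    and A: "\<And>z. z \<in> A \<Longrightarrow> Im z > 0" "\<And>k::nat. k > 0 \<Longrightarrow> \<i> * of_nat k \<in> A"
    and dense: "\<And>z \<epsilon>. Im z > 0 \<Longrightarrow> \<epsilon> > 0 \<Longrightarrow> \<exists>a\<in>A. cmod (a - z) < \<epsilon>"
    and w: "\<And>n z. z \<in> A \<Longrightarrow> Im (z * w n z) \<le> 0" "\<And>n z. z \<in> A \<Longrightarrow> cmod (w n z) \<le> 1 / Im z"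
    and mw: "\<And>z. z \<in> A \<Longrightarrow> (\<lambda>n. stieltjes (\<mu> n) z - w n z) \<longlonglongrightarrow> 0"
    and wr: "\<And>z. z \<in> A \<Longrightarrow> (\<lambda>n. w n z - mp_rhs (h n) z (mp_factor (g n) z (w n z))) \<longlonglongrightarrow> 0"
  shows "\<exists>\<nu>. real_distribution \<nu> \<and> weak_conv_m \<mu> \<nu> \<and> (AE t in \<nu>. 0 \<le> t) \<and>
    (\<forall>z. Im z > 0 \<longrightarrow> stieltjes \<nu> z = mp_rhs H z (mp_factor \<gamma> z (stieltjes \<nu> z)))"
proof -
  have \<gamma>: "0 \<le> \<gamma>" using g by (intro LIMSEQ_le_const) auto
  have supp: "AE t in H. 0 \<le> t \<and> t \<le> \<tau>" by (rule weak_limit_bounded[OF h(1) H conv h(2)])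
  have Imb: "Im (mp_factor (g n) z (w n z)) \<le> 0" if "z \<in> A" for n z
  proof -
    have "Im (mp_factor (g n) z (w n z)) = g n * Im (z * w n z)" by (simp add: mp_factor_def algebra_simps)
    then show ?thesis using w(1)[OF that, of n] g(1)[of n] by (simp add: mult_nonneg_nonpos)
  qed
  obtain \<Gamma> where \<Gamma>: "\<And>n. g n \<le> \<Gamma>"
    using convergent_imp_Bseq[OF convergentI[OF g(2)]] by (auto simp: Bseq_def abs_le_iff)
  \<comment> \<open>far up the imaginary axis the equation forces \<open>z m(z)\<close> close to \<open>1\<close>, hence the tails are small\<close>
  define K where "K = \<tau> * (1 + 2 * \<Gamma>)"
  have \<Gamma>0: "0 \<le> \<Gamma>" using g(1)[of 0] \<Gamma>[of 0] by linarith
  have K: "0 \<le> K" unfolding K_def using \<tau> \<Gamma>0 by simp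
  have rhs1: "cmod (z * mp_rhs (h n) z (mp_factor (g n) z (w n z)) - 1) \<le> K / real k"
    if k: "k > 0" and zk: "z = \<i> * of_nat k" for n k z
  proof -
    interpret hn: real_distribution "h n" by (rule h)
    have zA: "z \<in> A" and z: "Im z > 0" "cmod z = real k" "Im z = real k" using A(2)[OF k] k by (auto simp: zk norm_mult)
    let ?b = "mp_factor (g n) z (w n z)"
    have "cmod ?b \<le> cmod (1 - of_real (g n) :: complex) + cmod (of_real (g n) * z * w n z)"
      unfolding mp_factor_def by (rule norm_triangle_ineq)
    also have "cmod (1 - of_real (g n) :: complex) \<le> 1 + g n"
      using norm_triangle_ineq4[of "1::complex" "of_real (g n)"] g(1)[of n] by simp
    also have "cmod (of_real (g n) * z * w n z) \<le> g n * 1"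
    proof -
      have "real k * cmod (w n z) \<le> real k * (1 / real k)" using w(2)[OF zA, of n] z k by (intro mult_left_mono) auto
      then have "real k * cmod (w n z) \<le> 1" using k by simp
      from mult_left_mono[OF this g(1)[of n]] show ?thesis using g(1)[of n] by (simp add: norm_mult z mult.assoc)
    qed
    finally have b: "cmod ?b \<le> 1 + 2 * \<Gamma>" using \<Gamma>[of n] by simp
    have int: "integrable (h n) (\<lambda>t. 1 / (z - complex_of_real t * ?b))"
      using h(2)[of n] mp_denominator(3)[OF z(1) Imb[OF zA]] by (intro hn.integrable_const_bound[where B = "1 / Im z"]) auto
    have "z * mp_rhs (h n) z ?b - 1 = (\<integral>t. z * (1 / (z - of_real t * ?b)) - 1 \<partial>h n)"
      unfolding mp_rhs_def using int by (subst Bochner_Integration.integral_diff) (use hn.prob_space in \<open>auto simp del: mult_1_right times_divide_eq_right\<close>)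
    also have "cmod \<dots> \<le> K / real k"
    proof (rule hn.norm_integral_le)
      show "AE t in h n. cmod (z * (1 / (z - of_real t * ?b)) - 1) \<le> K / real k"
        using h(2)[of n]
      proof eventually_elim
        case (elim t)
        note d = mp_denominator[OF z(1) Imb[OF zA], of t n]
        have "z * (1 / (z - of_real t * ?b)) - 1 = of_real t * ?b * (1 / (z - of_real t * ?b))"
          using d(2) elim by (simp add: field_simps)
        then have "cmod (z * (1 / (z - of_real t * ?b)) - 1) = t * cmod ?b * cmod (1 / (z - of_real t * ?b))"
          using elim by (simp only: norm_mult norm_of_real abs_of_nonneg)
        also have "\<dots> \<le> \<tau> * (1 + 2 * \<Gamma>) * (1 / real k)"
          using d(3) elim b \<tau> \<Gamma>0 z(3) by (intro mult_mono) auto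
        finally show ?case by (simp add: K_def)
      qed
    qed (use K in auto)
    finally show ?thesis .
  qed
  have tail: "eventually (\<lambda>n. 1 - measure (\<mu> n) {- real k<..real k} \<le> 2 * (K + 1) / real k) sequentially" if k: "k > 0" for k
  proof -
    let ?z = "\<i> * of_nat k"
    have zA: "?z \<in> A" by (rule A(2)[OF k])
    let ?R = "\<lambda>n. mp_rhs (h n) ?z (mp_factor (g n) ?z (w n ?z))"
    have "(\<lambda>n. (stieltjes (\<mu> n) ?z - w n ?z) + (w n ?z - ?R n)) \<longlonglongrightarrow> 0 + 0"
      by (intro tendsto_add mw wr zA)
    then have "(\<lambda>n. ?z * (stieltjes (\<mu> n) ?z - ?R n)) \<longlonglongrightarrow> 0" using tendsto_mult_right_zero by force
    then have "eventually (\<lambda>n. cmod (?z * (stieltjes (\<mu> n) ?z - ?R n)) < 1 / real k) sequentially"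
      using k by (auto simp: tendsto_iff dist_norm)
    then show ?thesis
    proof eventually_elim
      case (elim n)
      have "cmod (?z * stieltjes (\<mu> n) ?z - 1) \<le> cmod (?z * (stieltjes (\<mu> n) ?z - ?R n)) + cmod (?z * ?R n - 1)"
        using norm_triangle_ineq[of "?z * (stieltjes (\<mu> n) ?z - ?R n)" "?z * ?R n - 1"] by (simp add: algebra_simps)
      also have "\<dots> \<le> 1 / real k + K / real k" using elim rhs1[OF k refl, of n] by linarith
      finally show ?case using stieltjes_tail[OF \<mu>(1), of "real k" n] k by (simp add: add_divide_distrib)
    qed
  qed
  have tight: "tight \<mu>"
    unfolding tight_def
  proof (intro conjI allI impI \<mu>(1))
    fix \<epsilon> :: real assume \<epsilon>: "\<epsilon> > 0"
    obtain k :: nat where k: "2 * (K + 1) / \<epsilon> < real k" using reals_Archimedean2 by blast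
    have "0 < 2 * (K + 1) / \<epsilon>" using K \<epsilon> by simp
    then have k0: "k > 0" using k by (cases k) auto
    have "2 * (K + 1) / real k < \<epsilon>" using k k0 \<epsilon> by (simp add: field_simps)
    then obtain n0 where n0: "\<And>n. n \<ge> n0 \<Longrightarrow> 1 - measure (\<mu> n) {- real k<..real k} < \<epsilon>"
      using tail[OF k0] unfolding eventually_sequentially by force
    \<comment> \<open>the tail estimate holds for large \<open>n\<close>; each of the remaining measures is tight by itself\<close>
    have "\<exists>j. 1 - \<epsilon> < measure (\<mu> n) {- real j<..real j}" for n
    proof -
      interpret real_distribution "\<mu> n" by (rule \<mu>)
      have "(\<lambda>j. measure (\<mu> n) {- real j<..real j}) \<longlonglongrightarrow> measure (\<mu> n) (\<Union>j. {- real j<..real j})"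
        by (rule finite_Lim_measure_incseq) (auto simp: incseq_def)
      moreover have "x \<in> (\<Union>j. {- real j<..real j})" for x :: real
      proof -
        obtain j :: nat where "\<bar>x\<bar> < real j" using reals_Archimedean2 by blast
        then show ?thesis by (intro UN_I[of j]) auto
      qed
      then have "(\<Union>j. {- real j<..real j}) = UNIV" by blast
      ultimately have "(\<lambda>j. measure (\<mu> n) {- real j<..real j}) \<longlonglongrightarrow> 1" using prob_space by simp
      then have "eventually (\<lambda>j. 1 - \<epsilon> < measure (\<mu> n) {- real j<..real j}) sequentially"
        using \<epsilon> by (intro order_tendstoD(1)) auto
      then show ?thesis unfolding eventually_sequentially by auto
    qed
    then obtain J where J: "\<And>n. 1 - \<epsilon> < measure (\<mu> n) {- real (J n)<..real (J n)}" by metis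
    define m where "m = Max (insert k (J ` {..<n0}))"
    have km: "k \<le> m" and Jm: "n < n0 \<Longrightarrow> J n \<le> m" for n unfolding m_def by (auto intro!: Max_ge)
    have "1 - \<epsilon> < measure (\<mu> n) {- real m<..real m}" for n
    proof -
      interpret real_distribution "\<mu> n" by (rule \<mu>)
      have le: "measure (\<mu> n) {- real j<..real j} \<le> measure (\<mu> n) {- real m<..real m}" if "j \<le> m" for j
        using that by (intro finite_measure_mono) auto
      show ?thesis
        using J[of n] n0[of n] le[OF km] le[OF Jm, of n] by (cases "n < n0") auto
    qed
    then show "\<exists>a b. a < b \<and> (\<forall>n. 1 - \<epsilon> < measure (\<mu> n) {a<..b})"
      using k0 km by (intro exI[of _ "- real m"] exI[of _ "real m"]) auto
  qed
  have eqn: "(AE t in \<nu>. 0 \<le> t) \<and> (\<forall>z. Im z > 0 \<longrightarrow> stieltjes \<nu> z = mp_rhs H z (mp_factor \<gamma> z (stieltjes \<nu> z)))"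
    if s: "strict_mono s" and \<nu>: "real_distribution \<nu>" and c: "weak_conv_m (\<mu> \<circ> s) \<nu>" for s \<nu>
  proof -
    have \<mu>s: "real_distribution ((\<mu> \<circ> s) n)" "AE t in (\<mu> \<circ> s) n. 0 \<le> t" for n unfolding comp_def by (rule \<mu>)+
    have pos: "AE t in \<nu>. 0 \<le> t" by (rule weak_limit_nonneg[OF \<mu>s(1) \<nu> c \<mu>s(2)])
    have onA: "stieltjes \<nu> z = mp_rhs H z (mp_factor \<gamma> z (stieltjes \<nu> z))" if zA: "z \<in> A" for z
    proof -
      have z: "Im z > 0" by (rule A(1)[OF zA])
      have ml: "(\<lambda>n. stieltjes (\<mu> (s n)) z) \<longlonglongrightarrow> stieltjes \<nu> z"
        using stieltjes_weak_limit[OF \<mu>s(1) \<nu> c z] by simp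
      have "(\<lambda>n. stieltjes (\<mu> (s n)) z - (stieltjes (\<mu> (s n)) z - w (s n) z)) \<longlonglongrightarrow> stieltjes \<nu> z - 0"
        using LIMSEQ_subseq_LIMSEQ[OF mw[OF zA] s] by (intro tendsto_diff ml) (simp add: comp_def)
      then have wl: "(\<lambda>n. w (s n) z) \<longlonglongrightarrow> stieltjes \<nu> z" by simp
      have gl: "(\<lambda>n. g (s n)) \<longlonglongrightarrow> \<gamma>" using LIMSEQ_subseq_LIMSEQ[OF g(2) s] by (simp add: comp_def)
      have bl: "(\<lambda>n. mp_factor (g (s n)) z (w (s n) z)) \<longlonglongrightarrow> mp_factor \<gamma> z (stieltjes \<nu> z)"
        unfolding mp_factor_def by (intro tendsto_intros gl wl)
      have cH: "weak_conv_m (\<lambda>n. h (s n)) H"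
        unfolding weak_conv_m_def weak_conv_def
      proof (intro allI impI)
        fix x assume "isCont (cdf H) x"
        then have "(\<lambda>n. cdf (h n) x) \<longlonglongrightarrow> cdf H x" using conv by (simp add: weak_conv_m_def weak_conv_def)
        from LIMSEQ_subseq_LIMSEQ[OF this s] show "(\<lambda>n. cdf (h (s n)) x) \<longlonglongrightarrow> cdf H x" by (simp add: comp_def)
      qed
      have "(\<lambda>n. mp_rhs (h (s n)) z (mp_factor (g (s n)) z (w (s n) z))) \<longlonglongrightarrow> mp_rhs H z (mp_factor \<gamma> z (stieltjes \<nu> z))"
        by (rule mp_rhs_weak_limit[OF h \<tau> H cH z Imb[OF zA] bl])
      moreover have "(\<lambda>n. w (s n) z - (w (s n) z - mp_rhs (h (s n)) z (mp_factor (g (s n)) z (w (s n) z)))) \<longlonglongrightarrow> stieltjes \<nu> z - 0"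
        using LIMSEQ_subseq_LIMSEQ[OF wr[OF zA] s] by (intro tendsto_diff wl) (simp add: comp_def)
      ultimately show ?thesis using LIMSEQ_unique by simp
    qed
    have "stieltjes \<nu> z = mp_rhs H z (mp_factor \<gamma> z (stieltjes \<nu> z))" if z: "Im z > 0" for z
    proof -
      \<comment> \<open>both sides of the equation are continuous in \<open>z\<close>, so it extends from the dense set\<close>
      have "\<exists>a\<in>A. cmod (a - z) < min (Im z / 2) (1 / real (Suc k))" for k by (rule dense[OF z]) (use z in simp)
      then obtain a where a: "\<And>k. a k \<in> A" "\<And>k. cmod (a k - z) < min (Im z / 2) (1 / real (Suc k))" by metis
      have "(\<lambda>k. a k - z) \<longlonglongrightarrow> 0"
        by (rule Lim_null_comparison[OF _ LIMSEQ_Suc[OF lim_1_over_n]]) (use a(2) in \<open>auto simp: less_imp_le\<close>)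
      then have az: "a \<longlonglongrightarrow> z" by (simp add: LIM_zero_iff)
      have Ima: "Im z / 2 < Im (a k)" for k
        using abs_Im_le_cmod[of "a k - z"] a(2)[of k] by (auto simp: min_less_iff_conj)
      have "isCont (stieltjes \<nu>) z"
        using stieltjes_holomorphic[OF \<nu>] z by (auto intro!: continuous_on_interior[of "{z. Im z > 0}"] holomorphic_on_imp_continuous_on simp: interior_open open_halfspace_Im_gt)
      then have ma: "(\<lambda>k. stieltjes \<nu> (a k)) \<longlonglongrightarrow> stieltjes \<nu> z" using az by (rule isCont_tendsto_compose)
      define b where "b k = mp_factor \<gamma> (a k) (stieltjes \<nu> (a k))" for k
      have bz: "b \<longlonglongrightarrow> mp_factor \<gamma> z (stieltjes \<nu> z)" unfolding b_def mp_factor_def by (intro tendsto_intros az ma)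
      have Ia: "Im (a k) > 0" for k using A(1) a(1) by blast
      have b0: "Im (b k) \<le> 0" for k unfolding b_def by (rule stieltjes_bounds(3)[OF \<nu> pos Ia \<gamma>])
      have bz0: "Im (mp_factor \<gamma> z (stieltjes \<nu> z)) \<le> 0" by (rule stieltjes_bounds(3)[OF \<nu> pos z \<gamma>])
      interpret H: real_distribution H by (rule H)
      have "(\<lambda>k. mp_rhs H (a k) (b k)) \<longlonglongrightarrow> mp_rhs H z (mp_factor \<gamma> z (stieltjes \<nu> z))"
        unfolding mp_rhs_def
      proof (rule integral_dominated_convergence[where w = "\<lambda>_. 2 / Im z"])
        show "AE t in H. (\<lambda>k. 1 / (a k - complex_of_real t * b k)) \<longlonglongrightarrow> 1 / (z - complex_of_real t * mp_factor \<gamma> z (stieltjes \<nu> z))"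
          using supp by eventually_elim (intro tendsto_intros az bz mp_denominator(2)[OF z bz0], simp)
        show "AE t in H. cmod (1 / (a k - complex_of_real t * b k)) \<le> 2 / Im z" for k
          using supp
        proof eventually_elim
          case (elim t)
          have "cmod (1 / (a k - complex_of_real t * b k)) \<le> 1 / Im (a k)" using mp_denominator(3)[OF Ia b0] elim by blast
          also have "\<dots> \<le> 2 / Im z" using Ima[of k] z Ia[of k] by (simp add: field_simps)
          finally show ?case .
        qed
      qed auto
      moreover have "mp_rhs H (a k) (b k) = stieltjes \<nu> (a k)" for k using onA[OF a(1)] unfolding b_def by simp
      ultimately show ?thesis using ma LIMSEQ_unique by simp
    qed
    then show ?thesis using pos by blast
  qed
  obtain r \<nu> where r: "strict_mono r" "real_distribution \<nu>" "weak_conv_m (\<mu> \<circ> id \<circ> r) \<nu>"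
    using tight_imp_convergent_subsubsequence[OF tight strict_mono_id] by blast
  have \<nu>: "(AE t in \<nu>. 0 \<le> t) \<and> (\<forall>z. Im z > 0 \<longrightarrow> stieltjes \<nu> z = mp_rhs H z (mp_factor \<gamma> z (stieltjes \<nu> z)))"
    using eqn[OF r(1,2)] r(3) by simp
  have "weak_conv_m \<mu> \<nu>"
  proof (rule tight_subseq_weak_converge[OF \<mu>(1) r(2) tight])
    fix s \<nu>' assume s: "strict_mono s" "real_distribution \<nu>'" "weak_conv_m (\<mu> \<circ> s) \<nu>'"
    have "\<nu>' = \<nu>" using eqn[OF s] \<nu> by (intro mp_unique[OF s(2) _ r(2) _ H supp \<tau> \<gamma>]) auto
    then show "weak_conv_m (\<mu> \<circ> s) \<nu>" using s(3) by simp
  qed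
  then show ?thesis using r(2) \<nu> by blast
qed

section \<open>Quadratic forms in the columns\<close>

text \<open>Increasing tuples and sets of indices correspond to each other by sorting.\<close>

lemma bij_betw_index_sets:
  assumes e: "bij_betw e {..<N} (index_tuples n d)"
  shows "bij_betw (\<lambda>k. set (e k)) {..<N} {K. K \<subseteq> {1..n} \<and> card K = d}"
    and "k < N \<Longrightarrow> distinct (e k)"
proof -
  have "bij_betw set (index_tuples n d) {K. K \<subseteq> {1..n} \<and> card K = d}"
  proof (rule bij_betw_byWitness[where f' = sorted_list_of_set])
    show "\<forall>a\<in>index_tuples n d. sorted_list_of_set (set a) = a"
      by (auto simp: index_tuples_def strict_sorted_iff sorted_list_of_set.idem_if_sorted_distinct)
    show "\<forall>a'\<in>{K. K \<subseteq> {1..n} \<and> card K = d}. set (sorted_list_of_set a') = a'"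
      by (auto simp: finite_subset)
    show "set ` index_tuples n d \<subseteq> {K. K \<subseteq> {1..n} \<and> card K = d}"
      by (auto simp: index_tuples_def strict_sorted_iff distinct_card)
    show "sorted_list_of_set ` {K. K \<subseteq> {1..n} \<and> card K = d} \<subseteq> index_tuples n d"
    proof (clarify)
      fix K assume K: "K \<subseteq> {1..n}"
      then have "finite K" by (rule finite_subset) simp
      then show "sorted_list_of_set K \<in> index_tuples n (card K)" using K by (simp add: index_tuples_def)
    qed
  qed
  then show "bij_betw (\<lambda>k. set (e k)) {..<N} {K. K \<subseteq> {1..n} \<and> card K = d}"
    using bij_betw_trans[OF e] by (simp add: comp_def)
  show "distinct (e k)" if "k < N"
    using bij_betwE[OF e] that by (auto simp: index_tuples_def strict_sorted_iff)
qed

text \<open>The variance bound applies to the real and the imaginary part of the matrix separately; the first moment follows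
  from the second because \<open>\<bar>q\<bar> \<le> s / 2 + q\<^sup>2 / (2 s)\<close>.\<close>

lemma tensor_quadratic_form_L1:
  fixes x :: "nat \<Rightarrow> 'b \<Rightarrow> real"
  assumes sp: "symmetric_product_variables P {1..n} x \<kappa>" and e: "bij_betw e {..<N} (index_tuples n d)"
    and N: "N = n choose d" and d: "1 \<le> d" "d \<le> n" and k: "2 \<le> k" "0 \<le> \<kappa>" "\<kappa> \<le> k"
    and A: "A \<in> carrier_mat N N" and a: "0 < a" and frob: "(\<Sum>i<N. \<Sum>j<N. (cmod (A $$ (i,j)))\<^sup>2) \<le> real N * a\<^sup>2"
  defines "r \<equiv> (1 + (k - 1) * (real d / real n)) ^ (2 * d) - 1"
    and "Z \<equiv> \<lambda>\<omega>. tensor_vec N e (\<lambda>i. x i \<omega>)"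
  shows "(\<integral>\<^sup>+\<omega>. ennreal (cmod (cvec (Z \<omega>) \<bullet> (A *\<^sub>v cvec (Z \<omega>)) - mtrace A)) \<partial>P) \<le> ennreal (real N * a * sqrt (2 * r))"
proof -
  interpret sp: symmetric_product_variables P "{1..n}" x \<kappa> by fact
  let ?F = "{K. K \<subseteq> {1..n} \<and> card K = d}"
  let ?s = "\<lambda>k. set (e k)"
  have bij: "bij_betw ?s {..<N} ?F" by (rule bij_betw_index_sets(1)[OF e])
  have N0: "N > 0" using N d by simp
  have r0: "0 < r"
  proof -
    have "1 < 1 + (k - 1) * (real d / real n)" using k d by simp
    then have "1 < (1 + (k - 1) * (real d / real n)) ^ (2 * d)" using d by (intro one_less_power) auto
    then show ?thesis unfolding r_def by simp
  qed
  have Zk: "Z \<omega> $ i = sp.mon (?s i) \<omega>" if "i < N" for i \<omega>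
    using that bij_betw_index_sets(2)[OF e that] unfolding Z_def tensor_vec_def sp.mon_def
    by (simp add: prod.distinct_set_conv_list)
  define pos where "pos = the_inv_into {..<N} ?s"
  have pos: "pos (?s i) = i" if "i < N" for i
    unfolding pos_def using that bij the_inv_into_f_f[of ?s "{..<N}" i] by (simp add: bij_betw_def)
  define q where "q \<alpha> \<omega> = (\<Sum>i<N. \<Sum>j<N. \<alpha> i j * (Z \<omega> $ i * Z \<omega> $ j)) - (\<Sum>i<N. \<alpha> i i)" for \<alpha> :: "nat \<Rightarrow> nat \<Rightarrow> real" and \<omega>
  have real: "integrable P (\<lambda>\<omega>. (q \<alpha> \<omega>)\<^sup>2)" "(\<integral>\<omega>. (q \<alpha> \<omega>)\<^sup>2 \<partial>P) \<le> 2 * real N * r * (\<Sum>i<N. \<Sum>j<N. (\<alpha> i j)\<^sup>2)" for \<alpha>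
  proof -
    let ?A = "\<lambda>I J. \<alpha> (pos I) (pos J)"
    have re: "(\<Sum>I\<in>?F. f I) = (\<Sum>i<N. f (?s i))" for f :: "nat set \<Rightarrow> real"
      by (rule sum.reindex_bij_betw[OF bij, symmetric])
    have q: "q \<alpha> \<omega> = (\<Sum>I\<in>?F. \<Sum>J\<in>?F. ?A I J * (sp.mon I \<omega> * sp.mon J \<omega>)) - (\<Sum>I\<in>?F. ?A I I)" for \<omega>
      unfolding re q_def by (simp add: pos Zk cong: sum.cong_simp)
    have s: "(\<Sum>i<N. \<Sum>j<N. (\<alpha> i j)\<^sup>2) = (\<Sum>I\<in>?F. \<Sum>J\<in>?F. (?A I J)\<^sup>2)"
      unfolding re by (simp add: pos cong: sum.cong_simp)
    have dX: "d \<le> card {1..n}" using d by simp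
    show "integrable P (\<lambda>\<omega>. (q \<alpha> \<omega>)\<^sup>2)"
      unfolding q by (rule sp.quadratic_form_variance(1)[OF dX k])
    show "(\<integral>\<omega>. (q \<alpha> \<omega>)\<^sup>2 \<partial>P) \<le> 2 * real N * r * (\<Sum>i<N. \<Sum>j<N. (\<alpha> i j)\<^sup>2)"
      using sp.quadratic_form_variance(2)[OF dX k, of ?A] unfolding q s r_def by (simp add: N)
  qed
  define Q where "Q \<omega> = cvec (Z \<omega>) \<bullet> (A *\<^sub>v cvec (Z \<omega>)) - mtrace A" for \<omega>
  have Zc: "cvec (Z \<omega>) \<in> carrier_vec N" for \<omega> by (simp add: Z_def tensor_vec_def)
  have Qe: "Q \<omega> = (\<Sum>i<N. \<Sum>j<N. A $$ (i,j) * of_real (Z \<omega> $ i * Z \<omega> $ j)) - (\<Sum>i<N. A $$ (i,i))" for \<omega>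
  proof -
    have "cvec (Z \<omega>) \<bullet> (A *\<^sub>v cvec (Z \<omega>)) = (\<Sum>i<N. of_real (Z \<omega> $ i) * (A *\<^sub>v cvec (Z \<omega>)) $ i)"
      using A Zc[of \<omega>] by (simp add: scalar_prod_def lessThan_atLeast0)
    also have "\<dots> = (\<Sum>i<N. of_real (Z \<omega> $ i) * (\<Sum>j<N. A $$ (i,j) * of_real (Z \<omega> $ j)))"
      using Zc[of \<omega>] by (intro sum.cong refl) (subst mat_vec_entry[OF A Zc], auto)
    finally show ?thesis unfolding Q_def mtrace_def using A by (simp add: sum_distrib_left mult_ac)
  qed
  have RQ: "Re (Q \<omega>) = q (\<lambda>i j. Re (A $$ (i,j))) \<omega>" "Im (Q \<omega>) = q (\<lambda>i j. Im (A $$ (i,j))) \<omega>" for \<omega>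
    unfolding Qe q_def by simp_all
  have Q2: "(cmod (Q \<omega>))\<^sup>2 = (q (\<lambda>i j. Re (A $$ (i,j))) \<omega>)\<^sup>2 + (q (\<lambda>i j. Im (A $$ (i,j))) \<omega>)\<^sup>2" for \<omega>
    unfolding cmod_power2 RQ ..
  have int: "integrable P (\<lambda>\<omega>. (cmod (Q \<omega>))\<^sup>2)" unfolding Q2 using real(1) by simp
  define s where "s = real N * a * sqrt (2 * r)"
  have s: "0 < s" using N0 a r0 by (simp add: s_def)
  have "(\<integral>\<omega>. (cmod (Q \<omega>))\<^sup>2 \<partial>P) = (\<integral>\<omega>. (q (\<lambda>i j. Re (A $$ (i,j))) \<omega>)\<^sup>2 \<partial>P) + (\<integral>\<omega>. (q (\<lambda>i j. Im (A $$ (i,j))) \<omega>)\<^sup>2 \<partial>P)"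
    unfolding Q2 by (rule Bochner_Integration.integral_add[OF real(1) real(1)])
  also have "\<dots> \<le> 2 * real N * r * (\<Sum>i<N. \<Sum>j<N. (Re (A $$ (i,j)))\<^sup>2) + 2 * real N * r * (\<Sum>i<N. \<Sum>j<N. (Im (A $$ (i,j)))\<^sup>2)"
    by (intro add_mono real(2))
  also have "\<dots> = 2 * real N * r * (\<Sum>i<N. \<Sum>j<N. (cmod (A $$ (i,j)))\<^sup>2)"
    by (simp add: cmod_power2 sum.distrib distrib_left)
  also have "\<dots> \<le> 2 * real N * r * (real N * a\<^sup>2)" using r0 by (intro mult_left_mono frob) auto
  also have "\<dots> = s\<^sup>2" using r0 by (simp add: s_def power_mult_distrib power2_eq_square)
  finally have E2: "(\<integral>\<omega>. (cmod (Q \<omega>))\<^sup>2 \<partial>P) \<le> s\<^sup>2" .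
  have "(\<integral>\<^sup>+\<omega>. ennreal (cmod (Q \<omega>)) \<partial>P) \<le> (\<integral>\<^sup>+\<omega>. ennreal (s / 2 + (cmod (Q \<omega>))\<^sup>2 / (2 * s)) \<partial>P)"
  proof (intro nn_integral_mono ennreal_leI)
    fix \<omega>
    have "0 \<le> (cmod (Q \<omega>) - s)\<^sup>2 / (2 * s)" using s by simp
    then show "cmod (Q \<omega>) \<le> s / 2 + (cmod (Q \<omega>))\<^sup>2 / (2 * s)"
      using s by (simp add: power2_eq_square field_simps)
  qed
  also have "\<dots> = ennreal (\<integral>\<omega>. s / 2 + (cmod (Q \<omega>))\<^sup>2 / (2 * s) \<partial>P)"
    using s int by (intro nn_integral_eq_integral) auto
  also have "(\<integral>\<omega>. s / 2 + (cmod (Q \<omega>))\<^sup>2 / (2 * s) \<partial>P) = s / 2 + (\<integral>\<omega>. (cmod (Q \<omega>))\<^sup>2 \<partial>P) / (2 * s)"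
    using int by (simp add: sp.prob_space)
  also have "ennreal \<dots> \<le> ennreal (s / 2 + s\<^sup>2 / (2 * s))"
    using E2 s by (intro ennreal_leI add_mono divide_right_mono) auto
  also have "s / 2 + s\<^sup>2 / (2 * s) = s" using s by (simp add: power2_eq_square)
  finally show ?thesis unfolding Q_def s_def .
qed

lemma space_borel_vec [simp]: "space (borel_vec N) = carrier_vec N"
  by (simp add: borel_vec_def)

lemma borel_vec_coordinate [measurable]: "i < N \<Longrightarrow> (\<lambda>v. v $ i) \<in> borel_measurable (borel_vec N)"
proof -
  assume i: "i < N"
  have "(\<lambda>v. \<lambda>i\<in>{..<N}. vec_index v i) \<in> measurable (borel_vec N) (\<Pi>\<^sub>M i\<in>{..<N}. borel)"
    unfolding borel_vec_def by (rule measurable_vimage_algebra1) (auto simp: space_PiM)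
  from measurable_compose[OF this measurable_component_singleton[of i]] show ?thesis using i by simp
qed

lemma measurable_into_borel_vec:
  assumes "\<And>\<omega>. \<omega> \<in> space M \<Longrightarrow> f \<omega> \<in> carrier_vec N" and "\<And>i. i < N \<Longrightarrow> (\<lambda>\<omega>. f \<omega> $ i) \<in> borel_measurable M"
  shows "f \<in> measurable M (borel_vec N)"
  unfolding borel_vec_def
proof (rule measurable_vimage_algebra2)
  show "f \<in> space M \<rightarrow> carrier_vec N" using assms(1) by auto
  show "(\<lambda>\<omega>. \<lambda>i\<in>{..<N}. vec_index (f \<omega>) i) \<in> measurable M (\<Pi>\<^sub>M i\<in>{..<N}. borel)"
    using assms(2) by (intro measurable_restrict) auto
qed

lemma bilinear_form_measurable:
  assumes M: "\<And>\<omega>. \<omega> \<in> space S \<Longrightarrow> M \<omega> \<in> carrier_mat N N" "\<And>i j. i < N \<Longrightarrow> j < N \<Longrightarrow> (\<lambda>\<omega>. M \<omega> $$ (i,j)) \<in> borel_measurable S"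
    and v: "\<And>\<omega>. \<omega> \<in> space S \<Longrightarrow> v \<omega> \<in> carrier_vec N" "\<And>i. i < N \<Longrightarrow> (\<lambda>\<omega>. v \<omega> $ i) \<in> borel_measurable S"
  shows "(\<lambda>\<omega>. cvec (v \<omega>) \<bullet> (M \<omega> *\<^sub>v cvec (v \<omega>))) \<in> borel_measurable S"
proof -
  have eq: "cvec (v \<omega>) \<bullet> (M \<omega> *\<^sub>v cvec (v \<omega>)) = (\<Sum>i<N. \<Sum>j<N. of_real (v \<omega> $ i) * (M \<omega> $$ (i,j) * of_real (v \<omega> $ j)))"
    if \<omega>: "\<omega> \<in> space S" for \<omega>
  proof -
    have "cvec (v \<omega>) \<bullet> (M \<omega> *\<^sub>v cvec (v \<omega>)) = (\<Sum>i<N. of_real (v \<omega> $ i) * (M \<omega> *\<^sub>v cvec (v \<omega>)) $ i)"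
      using M(1)[OF \<omega>] v(1)[OF \<omega>] by (simp add: scalar_prod_def lessThan_atLeast0)
    also have "\<dots> = (\<Sum>i<N. of_real (v \<omega> $ i) * (\<Sum>j<N. M \<omega> $$ (i,j) * of_real (v \<omega> $ j)))"
      using v(1)[OF \<omega>] by (intro sum.cong refl) (subst mat_vec_entry[OF M(1)[OF \<omega>], of "cvec (v \<omega>)"], auto)
    finally show ?thesis by (simp add: sum_distrib_left)
  qed
  have "(\<lambda>\<omega>. \<Sum>i<N. \<Sum>j<N. complex_of_real (v \<omega> $ i) * (M \<omega> $$ (i,j) * of_real (v \<omega> $ j))) \<in> borel_measurable S"
    using M(2) v(2) by (intro borel_measurable_sum borel_measurable_times measurable_compose[OF _ borel_measurable_of_real]) auto
  then show ?thesis using eq by (subst measurable_cong) auto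
qed

lemma quadratic_form_measurable:
  assumes M: "M \<in> carrier_mat N N"
  shows "(\<lambda>v. cvec v \<bullet> (M *\<^sub>v cvec v)) \<in> borel_measurable (borel_vec N)"
  by (rule bilinear_form_measurable) (use M in auto)

text \<open>With \<open>B\<close> the square root of \<open>T\<close>, a quadratic form with matrix \<open>M\<close> in \<open>B Z\<close> is a quadratic form with
  matrix \<open>B M B\<close> in \<open>Z\<close>, and \<open>tr (B M B) = tr (T M)\<close>.\<close>

lemma column_quadratic_form_L1:
  fixes x :: "nat \<Rightarrow> 'b \<Rightarrow> real"
  assumes sp: "symmetric_product_variables P {1..n} x \<kappa>" and e: "bij_betw e {..<N} (index_tuples n d)"
    and N: "N = n choose d" and d: "1 \<le> d" "d \<le> n" and k: "2 \<le> k" "0 \<le> \<kappa>" "\<kappa> \<le> k"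
    and Q: "orth_mat N Q" and t: "\<And>i. i < N \<Longrightarrow> 0 \<le> t i \<and> t i \<le> \<tau>" and \<tau>: "0 < \<tau>"
    and M: "op_bounded N m M" and m: "0 < m"
  defines "r \<equiv> (1 + (k - 1) * (real d / real n)) ^ (2 * d) - 1"
    and "\<nu> \<equiv> distr P (borel_vec N) (\<lambda>\<omega>. psd_sqrt (spec_mat N Q t) *\<^sub>v tensor_vec N e (\<lambda>i. x i \<omega>))"
  shows "prob_space \<nu>"
    and "(\<integral>\<^sup>+y. ennreal (cmod (cvec y \<bullet> (M *\<^sub>v cvec y) - mtrace (cmat (spec_mat N Q t) * M))) \<partial>\<nu>)
      \<le> ennreal (real N * (\<tau> * m) * sqrt (2 * r))"
proof -
  interpret sp: symmetric_product_variables P "{1..n}" x \<kappa> by fact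
  let ?B = "spec_mat N Q (\<lambda>i. sqrt (t i))"
  let ?Z = "\<lambda>\<omega>. tensor_vec N e (\<lambda>i. x i \<omega>)"
  note M' = op_boundedD[OF M]
  have B: "psd_sqrt (spec_mat N Q t) = ?B" using t by (intro psd_sqrt_spec_mat[OF Q]) auto
  have Bc: "?B \<in> carrier_mat N N" using Q by simp
  have cQ: "orth_mat N (cmat Q)" by (rule orth_mat_cmat[OF Q])
  have cB: "cmat ?B = spec_mat N (cmat Q) (\<lambda>i. of_real (sqrt (t i)))" by (rule cmat_spec_mat[OF Q])
  have cBc: "cmat ?B \<in> carrier_mat N N" using Bc by simp
  have Zc: "?Z \<omega> \<in> carrier_vec N" for \<omega> by (simp add: tensor_vec_def)
  have Zm: "(\<lambda>\<omega>. ?Z \<omega> $ i) \<in> borel_measurable P" if "i < N" for i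
  proof -
    have "set (e i) \<subseteq> {1..n}" using bij_betwE[OF e] that by (auto simp: index_tuples_def)
    moreover have "x j \<in> borel_measurable P" if "j \<in> {1..n}" for j
      using sp.indep that by (auto simp: sp.indep_vars_def)
    then have "set js \<subseteq> {1..n} \<Longrightarrow> (\<lambda>\<omega>. \<Prod>i\<leftarrow>js. x i \<omega>) \<in> borel_measurable P" for js
      by (induction js) auto
    ultimately have "(\<lambda>\<omega>. \<Prod>i\<leftarrow>e i. x i \<omega>) \<in> borel_measurable P" by blast
    then show ?thesis using that by (simp add: tensor_vec_def)
  qed
  have Ym: "(\<lambda>\<omega>. psd_sqrt (spec_mat N Q t) *\<^sub>v ?Z \<omega>) \<in> measurable P (borel_vec N)"
    unfolding B
  proof (rule measurable_into_borel_vec)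
    show "?B *\<^sub>v ?Z \<omega> \<in> carrier_vec N" for \<omega> by (rule mult_mat_vec_carrier[OF Bc Zc])
    show "(\<lambda>\<omega>. (?B *\<^sub>v ?Z \<omega>) $ i) \<in> borel_measurable P" if "i < N" for i
      unfolding mat_vec_entry[OF Bc Zc that] using Zm by (intro borel_measurable_sum borel_measurable_times) auto
  qed
  show "prob_space \<nu>" unfolding \<nu>_def by (rule sp.prob_space_distr[OF Ym])
  define A where "A = cmat ?B * (M * cmat ?B)"
  have Bb: "op_bounded N (sqrt \<tau>) (cmat ?B)"
    unfolding cB using t \<tau> by (intro op_bounded_spec_mat[OF Q]) auto
  have Ab: "op_bounded N (\<tau> * m) A"
    using op_bounded_mult[OF Bb op_bounded_mult[OF M Bb]] \<tau> unfolding A_def by (simp add: mult_ac)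
  have Ac: "A \<in> carrier_mat N N" by (rule op_boundedD[OF Ab])
  have "mtrace A = mtrace ((M * cmat ?B) * cmat ?B)"
    unfolding A_def using cBc M' by (intro mtrace_mult_commute[of _ N N]) (auto simp: mult_carrier_mat[of _ N N _ N])
  also have "(M * cmat ?B) * cmat ?B = M * (cmat ?B * cmat ?B)" by (rule assoc_mult_mat[OF M'(1) cBc cBc])
  also have "cmat ?B * cmat ?B = cmat (spec_mat N Q t)"
    unfolding cB cmat_spec_mat[OF Q] spec_mat_mult[OF cQ]
    by (rule spec_mat_cong) (use t in \<open>simp flip: of_real_mult\<close>)
  also have "mtrace (M * cmat (spec_mat N Q t)) = mtrace (cmat (spec_mat N Q t) * M)"
    using Q M' by (intro mtrace_mult_commute[of _ N N]) auto
  finally have trA: "mtrace A = mtrace (cmat (spec_mat N Q t) * M)" .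
  have quad: "cvec (?B *\<^sub>v ?Z \<omega>) \<bullet> (M *\<^sub>v cvec (?B *\<^sub>v ?Z \<omega>)) = cvec (?Z \<omega>) \<bullet> (A *\<^sub>v cvec (?Z \<omega>))" for \<omega>
  proof -
    let ?z = "cvec (?Z \<omega>)"
    have zc: "?z \<in> carrier_vec N" using Zc by simp
    have y: "cvec (?B *\<^sub>v ?Z \<omega>) = cmat ?B *\<^sub>v ?z" by (rule of_real_hom.mult_mat_vec_hom[OF Bc Zc])
    have Bz: "cmat ?B *\<^sub>v ?z \<in> carrier_vec N" by (rule mult_mat_vec_carrier[OF cBc zc])
    have MBz: "M *\<^sub>v (cmat ?B *\<^sub>v ?z) \<in> carrier_vec N" by (rule mult_mat_vec_carrier[OF M'(1) Bz])
    have BT: "(cmat ?B)\<^sup>T = cmat ?B" unfolding cB by (rule spec_mat_transpose[OF cQ])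
    have "(cmat ?B *\<^sub>v ?z) \<bullet> (M *\<^sub>v (cmat ?B *\<^sub>v ?z)) = ?z \<bullet> (cmat ?B *\<^sub>v (M *\<^sub>v (cmat ?B *\<^sub>v ?z)))"
      using transpose_vec_mult_scalar[OF cBc MBz zc] unfolding BT by simp
    also have "cmat ?B *\<^sub>v (M *\<^sub>v (cmat ?B *\<^sub>v ?z)) = A *\<^sub>v ?z"
      unfolding A_def using assoc_mult_mat_vec[OF cBc mult_carrier_mat[OF M'(1) cBc] zc] assoc_mult_mat_vec[OF M'(1) cBc zc] by simp
    finally show ?thesis unfolding y .
  qed
  have "(\<integral>\<^sup>+y. ennreal (cmod (cvec y \<bullet> (M *\<^sub>v cvec y) - mtrace (cmat (spec_mat N Q t) * M))) \<partial>\<nu>)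
      = (\<integral>\<^sup>+\<omega>. ennreal (cmod (cvec (?Z \<omega>) \<bullet> (A *\<^sub>v cvec (?Z \<omega>)) - mtrace A)) \<partial>P)"
    unfolding \<nu>_def using quadratic_form_measurable[OF M'(1)] Ym
    by (subst nn_integral_distr) (auto simp: B quad trA intro!: measurable_compose[OF _ measurable_ennreal] borel_measurable_norm borel_measurable_diff)
  also have "\<dots> \<le> ennreal (real N * (\<tau> * m) * sqrt (2 * r))"
    unfolding r_def by (rule tensor_quadratic_form_L1[OF sp e N d k Ac _ op_bounded_frobenius[OF Ab]]) (use \<tau> m in simp)
  finally show "(\<integral>\<^sup>+y. ennreal (cmod (cvec y \<bullet> (M *\<^sub>v cvec y) - mtrace (cmat (spec_mat N Q t) * M))) \<partial>\<nu>)
      \<le> ennreal (real N * (\<tau> * m) * sqrt (2 * r))" .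
qed

section \<open>The expected resolvent\<close>

lemma det_measurable:
  fixes A :: "'w \<Rightarrow> complex mat"
  assumes A: "\<And>\<omega>. \<omega> \<in> space S \<Longrightarrow> A \<omega> \<in> carrier_mat n n"
    and m: "\<And>i j. i < n \<Longrightarrow> j < n \<Longrightarrow> (\<lambda>\<omega>. A \<omega> $$ (i,j)) \<in> borel_measurable S"
  shows "(\<lambda>\<omega>. Determinant.det (A \<omega>)) \<in> borel_measurable S"
proof -
  have g: "(\<lambda>\<omega>. \<Sum>p | p permutes {0..<n}. signof p * (\<Prod>i = 0..<n. A \<omega> $$ (i, p i))) \<in> borel_measurable S"
  proof (intro borel_measurable_sum borel_measurable_times borel_measurable_const borel_measurable_prod m)
    fix p i assume p: "p \<in> {p. p permutes {0..<n}}" and i: "i \<in> {0..<n}"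
    show "i < n" using i by simp
    show "p i < n" using permutes_in_image[of p "{0..<n}" i] p i by simp
  qed
  show ?thesis by (rule iffD2[OF measurable_cong[OF det_def'[OF A]] g])
qed

lemma resolvent_entry_measurable:
  fixes A :: "'w \<Rightarrow> real mat"
  assumes A: "\<And>\<omega>. \<omega> \<in> space S \<Longrightarrow> A \<omega> \<in> carrier_mat n n"
    and m: "\<And>i j. i < n \<Longrightarrow> j < n \<Longrightarrow> (\<lambda>\<omega>. A \<omega> $$ (i,j)) \<in> borel_measurable S"
    and ij: "i < n" "j < n"
  shows "(\<lambda>\<omega>. resolvent (A \<omega>) z $$ (i,j)) \<in> borel_measurable S"
proof -
  let ?K = "\<lambda>\<omega>. shifted (A \<omega>) z"
  have K: "?K \<omega> \<in> carrier_mat n n" if "\<omega> \<in> space S" for \<omega> using A[OF that] by (auto simp: shifted_def)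
  have Km: "(\<lambda>\<omega>. ?K \<omega> $$ (i,j)) \<in> borel_measurable S" if "i < n" "j < n" for i j
  proof -
    have g: "(\<lambda>\<omega>. z * of_bool (i = j) - complex_of_real (A \<omega> $$ (i,j))) \<in> borel_measurable S"
      using m[OF that] by (intro borel_measurable_diff borel_measurable_const measurable_compose[OF _ borel_measurable_of_real]) auto
    have eq: "?K \<omega> $$ (i,j) = z * of_bool (i = j) - complex_of_real (A \<omega> $$ (i,j))" if "\<omega> \<in> space S" for \<omega>
      using A[OF that] \<open>i < n\<close> \<open>j < n\<close> by (auto simp: shifted_def)
    show ?thesis by (rule iffD2[OF measurable_cong[OF eq] g])
  qed
  have del: "(\<lambda>\<omega>. Determinant.det (mat_delete (?K \<omega>) j i)) \<in> borel_measurable S"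
  proof (rule det_measurable[where n = "n - 1"])
    show "mat_delete (?K \<omega>) j i \<in> carrier_mat (n - 1) (n - 1)" if "\<omega> \<in> space S" for \<omega>
      using K[OF that] by (rule mat_delete_carrier)
    fix a b assume ab: "a < n - 1" "b < n - 1"
    define a' b' where "a' = (if a < j then a else Suc a)" and "b' = (if b < i then b else Suc b)"
    have eq: "mat_delete (?K \<omega>) j i $$ (a,b) = ?K \<omega> $$ (a',b')" if "\<omega> \<in> space S" for \<omega>
      using K[OF that] ab by (simp add: mat_delete_def a'_def b'_def)
    have ab': "a' < n" "b' < n" using ab by (auto simp: a'_def b'_def)
    show "(\<lambda>\<omega>. mat_delete (?K \<omega>) j i $$ (a,b)) \<in> borel_measurable S"
      by (rule iffD2[OF measurable_cong[OF eq] Km[OF ab']])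
  qed
  have eq: "resolvent (A \<omega>) z $$ (i,j) = 1 / Determinant.det (?K \<omega>) * ((-1) ^ (j + i) * Determinant.det (mat_delete (?K \<omega>) j i))"
    if "\<omega> \<in> space S" for \<omega>
    using K[OF that] ij unfolding resolvent_def adj_mat_def cofactor_def by simp
  have g: "(\<lambda>\<omega>. 1 / Determinant.det (?K \<omega>) * ((-1) ^ (j + i) * Determinant.det (mat_delete (?K \<omega>) j i))) \<in> borel_measurable S"
    by (intro borel_measurable_times borel_measurable_divide borel_measurable_const del det_measurable[OF K Km])
  show ?thesis by (rule iffD2[OF measurable_cong[OF eq] g])
qed

text \<open>The law \<open>\<nu>\<close> of a column enters the limit through one property: its quadratic forms are close to their
  traces against \<open>T\<close>, with relative error \<open>\<rho>\<close>, uniformly over matrices of bounded operator norm.\<close>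

locale column_model = prob_space \<nu> for \<nu> :: "real Matrix.vec measure" +
  fixes N p :: nat and Q :: "real mat" and t :: "nat \<Rightarrow> real" and \<tau> \<rho> :: real and z :: complex
  assumes sets_\<nu> [measurable_cong]: "sets \<nu> = sets (borel_vec N)"
    and N: "0 < N" and p: "0 < p"
    and Q: "orth_mat N Q" and t: "\<And>i. i < N \<Longrightarrow> 0 \<le> t i \<and> t i \<le> \<tau>" and \<tau>: "0 < \<tau>"
    and z: "Im z > 0" and \<rho>: "0 \<le> \<rho>"
    and column_form: "\<And>M m. op_bounded N m M \<Longrightarrow> 0 < m \<Longrightarrow>
      (\<integral>\<^sup>+y. ennreal (cmod (cvec y \<bullet> (M *\<^sub>v cvec y) - mtrace (cmat (spec_mat N Q t) * M))) \<partial>\<nu>) \<le> ennreal (real N * (\<tau> * m) * \<rho>)"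
begin

abbreviation columns :: "(nat \<Rightarrow> real Matrix.vec) measure" where
  "columns \<equiv> PiM {..<p} (\<lambda>_. \<nu>)"

definition normalized_trace :: "(nat \<Rightarrow> real Matrix.vec) \<Rightarrow> complex" where
  "normalized_trace y = mtrace (resolvent (sample_cov N (1 / real p) {..<p} y) z) / of_nat N"

definition mean_trace :: complex where
  "mean_trace = (\<integral>y. normalized_trace y \<partial>columns)"

lemma space_\<nu>: "space \<nu> = carrier_vec N"
  using sets_eq_imp_space_eq[OF sets_\<nu>] by simp

lemma prob_space_columns: "prob_space (PiM I (\<lambda>_. \<nu>))"
  by (rule prob_space_PiM) (rule prob_space_axioms)

lemma space_columns: "y \<in> space (PiM I (\<lambda>_. \<nu>)) \<Longrightarrow> j \<in> I \<Longrightarrow> y j \<in> carrier_vec N"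
  by (auto simp: space_PiM space_\<nu>)

lemma column_entry_measurable: "j \<in> I \<Longrightarrow> a < N \<Longrightarrow> (\<lambda>y. y j $ a) \<in> borel_measurable (PiM I (\<lambda>_. \<nu>))"
proof -
  assume "j \<in> I" "a < N"
  then have "(\<lambda>y. y j) \<in> measurable (PiM I (\<lambda>_. \<nu>)) \<nu>" "(\<lambda>v. v $ a) \<in> borel_measurable \<nu>"
    unfolding measurable_cong_sets[OF sets_\<nu> refl] by (auto intro: measurable_component_singleton borel_vec_coordinate)
  then show ?thesis by (rule measurable_compose)
qed

lemma sample_cov_resolvent_measurable:
  assumes "J \<subseteq> I" "i < N" "j < N"
  shows "(\<lambda>y. resolvent (sample_cov N (1 / real p) J y) z $$ (i,j)) \<in> borel_measurable (PiM I (\<lambda>_. \<nu>))"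
proof (rule resolvent_entry_measurable[where n = N])
  fix a b assume ab: "a < N" "b < N"
  have "(\<lambda>y. 1 / real p * (\<Sum>j\<in>J. y j $ a * y j $ b)) \<in> borel_measurable (PiM I (\<lambda>_. \<nu>))"
    by (intro borel_measurable_times borel_measurable_const borel_measurable_sum column_entry_measurable ab) (use assms(1) in auto)
  then show "(\<lambda>y. sample_cov N (1 / real p) J y $$ (a,b)) \<in> borel_measurable (PiM I (\<lambda>_. \<nu>))"
    using ab by (simp add: sample_cov_def)
qed (rule sample_cov_carrier assms(2,3))+

lemma resolvent_sample_cov:
  "sample_cov N (1 / real p) J y \<in> carrier_mat N N" "psd_mat (sample_cov N (1 / real p) J y)"
  by (auto intro: psd_sample_cov)

lemma normalized_trace_measurable [measurable]: "normalized_trace \<in> borel_measurable columns"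
proof -
  have "dim_row (resolvent (sample_cov N (1 / real p) {..<p} y) z) = N" for y
    using resolvent_psd(1)[OF resolvent_sample_cov z] by (rule carrier_matD(1))
  then have eq: "mtrace (resolvent (sample_cov N (1 / real p) {..<p} y) z) = (\<Sum>i<N. resolvent (sample_cov N (1 / real p) {..<p} y) z $$ (i,i))" for y
    by (simp only: mtrace_def)
  have "(\<lambda>y. \<Sum>i<N. resolvent (sample_cov N (1 / real p) {..<p} y) z $$ (i,i)) \<in> borel_measurable columns"
    by (rule borel_measurable_sum, rule sample_cov_resolvent_measurable) auto
  then show ?thesis
    unfolding normalized_trace_def eq by (rule borel_measurable_divide) (rule borel_measurable_const)
qed

lemma normalized_trace_bounds:
  "cmod (normalized_trace y) \<le> 1 / Im z" "Im (z * normalized_trace y) \<le> 0"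
proof -
  note R = resolvent_psd[OF resolvent_sample_cov[of "{..<p}" y] z]
  show "cmod (normalized_trace y) \<le> 1 / Im z"
    using op_bounded_mtrace[OF R(5)] N unfolding normalized_trace_def by (simp add: norm_divide divide_le_eq mult.commute)
  have "Im (z * normalized_trace y) = Im (z * mtrace (resolvent (sample_cov N (1 / real p) {..<p} y) z)) / real N"
    unfolding normalized_trace_def times_divide_eq_right by (simp add: Im_divide_of_nat)
  then show "Im (z * normalized_trace y) \<le> 0" using R(8) by (simp add: divide_nonpos_nonneg)
qed

lemma normalized_trace_integrable: "integrable columns normalized_trace"
proof -
  interpret C: prob_space columns by (rule prob_space_columns)
  show ?thesis by (rule C.integrable_const_bound[where B = "1 / Im z"]) (auto simp: normalized_trace_bounds)
qed

lemma mean_trace_bounds: "cmod mean_trace \<le> 1 / Im z" "Im (z * mean_trace) \<le> 0"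
proof -
  interpret C: prob_space columns by (rule prob_space_columns)
  show "cmod mean_trace \<le> 1 / Im z"
    unfolding mean_trace_def using z by (intro C.norm_integral_le) (auto simp: normalized_trace_bounds)
  have "0 \<le> (\<integral>y. - Im (z * normalized_trace y) \<partial>columns)"
    by (intro integral_nonneg_AE AE_I2) (use normalized_trace_bounds(2) in \<open>simp only: neg_0_le_iff_le\<close>)
  also have "\<dots> = - Im (z * mean_trace)"
    unfolding mean_trace_def using normalized_trace_integrable
    by (simp only: integral_mult_right_zero[symmetric] integral_minus integral_Im integrable_mult_right)
  finally show "Im (z * mean_trace) \<le> 0" by simp
qed

text \<open>Both matrices are rank-one perturbations of the one in which the column \<open>j\<close> is left out.\<close>

lemma normalized_trace_difference:
  assumes y: "y \<in> space columns" and j: "j < p" and a: "a \<in> carrier_vec N"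
  shows "cmod (normalized_trace y - normalized_trace (y(j := a))) \<le> 2 / (Im z * real N)"
proof -
  let ?c = "1 / real p"
  let ?tr = "\<lambda>J y. mtrace (resolvent (sample_cov N ?c J y) z)"
  have one: "op_bounded N 1 (1\<^sub>m N)" by (auto simp: op_bounded_def)
  have step: "cmod (?tr {..<p} v - ?tr ({..<p} - {j}) v) \<le> 1 / Im z" if v: "v j \<in> carrier_vec N" for v
  proof -
    have rc: "resolvent (sample_cov N ?c J v) z \<in> carrier_mat N N" for J by (rule resolvent_psd(1)[OF resolvent_sample_cov z])
    have "cmod (mtrace (1\<^sub>m N * resolvent (sample_cov N ?c {..<p} v) z) - mtrace (1\<^sub>m N * resolvent (sample_cov N ?c ({..<p} - {j}) v) z)) \<le> 1 / Im z"
      by (rule rank_one_perturbation(7)[OF resolvent_sample_cov resolvent_sample_cov v _ sample_cov_remove[where y = v and J = "{..<p}"] z one])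
        (use j v in auto)
    then show ?thesis unfolding left_mult_one_mat[OF rc] .
  qed
  have same: "?tr ({..<p} - {j}) (y(j := a)) = ?tr ({..<p} - {j}) y"
    by (subst sample_cov_cong[of _ _ y]) auto
  have "cmod (?tr {..<p} y - ?tr {..<p} (y(j := a))) \<le> 1 / Im z + 1 / Im z"
    using norm_triangle_ineq4[of "?tr {..<p} y - ?tr ({..<p} - {j}) y" "?tr {..<p} (y(j := a)) - ?tr ({..<p} - {j}) (y(j := a))"]
      step[of y] step[of "y(j := a)"] space_columns[OF y, of j] j a unfolding same by simp
  then have "cmod (?tr {..<p} y - ?tr {..<p} (y(j := a))) / real N \<le> (2 / Im z) / real N"
    by (intro divide_right_mono) auto
  then show ?thesis
    unfolding normalized_trace_def by (simp add: norm_divide diff_divide_distrib[symmetric])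
qed

text \<open>The bounded difference inequality for the real and the imaginary part, each with half of \<open>\<delta>\<close>.\<close>

lemma normalized_trace_concentration:
  assumes \<delta>: "\<delta> > 0"
  shows "measure columns {y \<in> space columns. \<delta> \<le> cmod (normalized_trace y - mean_trace)}
    \<le> 4 * exp (- (\<delta>\<^sup>2 * (Im z)\<^sup>2 * (real N)\<^sup>2 / (32 * real p)))"
proof -
  interpret C: prob_space columns by (rule prob_space_columns)
  let ?b = "exp (- (\<delta>\<^sup>2 * (Im z)\<^sup>2 * (real N)\<^sup>2 / (32 * real p)))"
  let ?c = "2 / (Im z * real N)"
  have c: "?c > 0" using z N by simp
  have I: "finite {..<p}" "{..<p} \<noteq> {}" using p by (auto simp: lessThan_empty_iff)
  have e: "(\<delta> / 2)\<^sup>2 / (2 * ?c\<^sup>2 * card {..<p}) = \<delta>\<^sup>2 * (Im z)\<^sup>2 * (real N)\<^sup>2 / (32 * real p)"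
    using z N p by (simp add: power_divide power_mult_distrib field_simps)
  have part: "measure columns {y \<in> space columns. \<delta> / 2 \<le> \<bar>f (normalized_trace y) - f mean_trace\<bar>} \<le> 2 * ?b"
    if f: "f = Re \<or> f = Im" for f
  proof -
    have fm: "(\<lambda>y. f (normalized_trace y)) \<in> borel_measurable columns"
      using f by (auto intro: measurable_compose[OF normalized_trace_measurable])
    have fb: "\<bar>f w\<bar> \<le> cmod w" for w using f abs_Re_le_cmod abs_Im_le_cmod by auto
    have fd: "f u - f v = f (u - v)" for u v using f by auto
    have fi: "(\<integral>y. f (normalized_trace y) \<partial>columns) = f mean_trace"
      using f normalized_trace_integrable unfolding mean_trace_def by auto
    have "measure columns {y \<in> space columns. \<delta> / 2 \<le> \<bar>f (normalized_trace y) - (\<integral>y. f (normalized_trace y) \<partial>columns)\<bar>}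
        \<le> 2 * exp (- ((\<delta> / 2)\<^sup>2 / (2 * ?c\<^sup>2 * card {..<p})))"
    proof (rule bounded_differences_inequality[OF prob_space_axioms I c _ fm, where B = "1 / Im z"])
      show "\<delta> / 2 > 0" using \<delta> by simp
      show "\<bar>f (normalized_trace y)\<bar> \<le> 1 / Im z" for y using order_trans[OF fb normalized_trace_bounds(1)] .
      show "\<bar>f (normalized_trace y) - f (normalized_trace (y(i := a)))\<bar> \<le> ?c"
        if "y \<in> space columns" "i \<in> {..<p}" "a \<in> space \<nu>" for y i a
        unfolding fd using order_trans[OF fb normalized_trace_difference] that by (simp add: space_\<nu>)
    qed
    then show ?thesis unfolding e fi .
  qed
  have m: "{y \<in> space columns. \<delta> / 2 \<le> \<bar>f (normalized_trace y) - f mean_trace\<bar>} \<in> sets columns" if "f = Re \<or> f = Im" for f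
    using that by auto
  have "{y \<in> space columns. \<delta> \<le> cmod (normalized_trace y - mean_trace)}
      \<subseteq> {y \<in> space columns. \<delta> / 2 \<le> \<bar>Re (normalized_trace y) - Re mean_trace\<bar>} \<union> {y \<in> space columns. \<delta> / 2 \<le> \<bar>Im (normalized_trace y) - Im mean_trace\<bar>}"
  proof -
    have "cmod w \<le> \<bar>Re w\<bar> + \<bar>Im w\<bar>" for w by (rule cmod_le)
    then have "\<delta> / 2 \<le> \<bar>Re w\<bar> \<or> \<delta> / 2 \<le> \<bar>Im w\<bar>" if "\<delta> \<le> cmod w" for w
      using that by (metis add_strict_mono field_sum_of_halves not_le order_less_le_trans)
    then show ?thesis by fastforce
  qed
  then have "measure columns {y \<in> space columns. \<delta> \<le> cmod (normalized_trace y - mean_trace)}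
      \<le> measure columns ({y \<in> space columns. \<delta> / 2 \<le> \<bar>Re (normalized_trace y) - Re mean_trace\<bar>} \<union> {y \<in> space columns. \<delta> / 2 \<le> \<bar>Im (normalized_trace y) - Im mean_trace\<bar>})"
    by (rule C.finite_measure_mono) (intro sets.Un m disjI1[OF refl] disjI2[OF refl])
  also have "\<dots> \<le> 2 * ?b + 2 * ?b"
    by (intro order_trans[OF measure_Un_le] add_mono part m disjI1[OF refl] disjI2[OF refl])
  finally show ?thesis by simp
qed

lemma expected_deviation:
  assumes \<delta>: "\<delta> > 0"
  shows "(\<integral>y. cmod (normalized_trace y - mean_trace) \<partial>columns)
    \<le> \<delta> + 8 / Im z * exp (- (\<delta>\<^sup>2 * (Im z)\<^sup>2 * (real N)\<^sup>2 / (32 * real p)))"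
proof -
  interpret C: prob_space columns by (rule prob_space_columns)
  let ?S = "{y \<in> space columns. \<delta> \<le> cmod (normalized_trace y - mean_trace)}"
  have S: "?S \<in> sets columns" by measurable
  have b: "cmod (normalized_trace y - mean_trace) \<le> 2 / Im z" for y
    using norm_triangle_ineq4[of "normalized_trace y" mean_trace] normalized_trace_bounds(1)[of y] mean_trace_bounds(1) by simp
  have "(\<integral>y. cmod (normalized_trace y - mean_trace) \<partial>columns) \<le> (\<integral>y. \<delta> + 2 / Im z * indicator ?S y \<partial>columns)"
  proof (rule integral_mono)
    show "integrable columns (\<lambda>y. cmod (normalized_trace y - mean_trace))" using normalized_trace_integrable by auto
    show "integrable columns (\<lambda>y. \<delta> + 2 / Im z * indicator ?S y)" using S by (auto simp: C.emeasure_eq_measure)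
    show "cmod (normalized_trace y - mean_trace) \<le> \<delta> + 2 / Im z * indicator ?S y" if "y \<in> space columns" for y
      using b[of y] \<delta> that by (auto simp: indicator_def)
  qed
  also have "\<dots> = \<delta> + 2 / Im z * measure columns ?S" using S by (simp add: C.prob_space C.emeasure_eq_measure)
  also have "\<dots> \<le> \<delta> + 2 / Im z * (4 * exp (- (\<delta>\<^sup>2 * (Im z)\<^sup>2 * (real N)\<^sup>2 / (32 * real p))))"
    using z by (intro add_left_mono mult_left_mono normalized_trace_concentration \<delta>) auto
  finally show ?thesis by simp
qed

text \<open>The comparison of resolvents is integrated, with the expectation itself as the nonrandom approximation. In the
  error term of column \<open>j\<close> the integral over \<open>y\<^sub>j\<close> is taken first: the leave-one-out resolvent is then a
  fixed matrix of bounded operator norm.\<close>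

theorem mean_trace_equation:
  assumes \<delta>: "\<delta> > 0"
  defines "\<gamma> \<equiv> real N / real p"
  shows "cmod (mean_trace - mp_rhs (point_distribution N t) z (mp_factor \<gamma> z mean_trace))
    \<le> cmod z * \<tau> / Im z ^ 3 * \<rho> + cmod z * \<tau> / (Im z ^ 3 * real N)
      + \<gamma> * cmod z * \<tau> / (Im z)\<^sup>2 * (\<delta> + 8 / Im z * exp (- (\<delta>\<^sup>2 * (Im z)\<^sup>2 * (real N)\<^sup>2 / (32 * real p))))"
proof -
  interpret C: prob_space columns by (rule prob_space_columns)
  interpret PP: product_prob_space "\<lambda>_::nat. \<nu>" ..
  let ?\<eta> = "Im z" and ?c = "1 / real p" and ?w = mean_trace
  let ?b = "mp_factor \<gamma> z ?w"
  have b: "Im ?b \<le> 0"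
  proof -
    have eq: "Im ?b = \<gamma> * Im (z * ?w)" by (simp add: mp_factor_def algebra_simps)
    show ?thesis unfolding eq by (rule mult_nonneg_nonpos[OF _ mean_trace_bounds(2)]) (simp add: \<gamma>_def)
  qed
  have cQ: "orth_mat N (cmat Q)" by (rule orth_mat_cmat[OF Q])
  define D where "D = spec_mat N (cmat Q) (\<lambda>i. 1 / (z - ?b * of_real (t i)))"
  define U where "U = spec_mat N (cmat Q) (\<lambda>i. of_real (t i) / (z - ?b * of_real (t i)))"
  define Gj where "Gj j y = resolvent (sample_cov N ?c ({..<p} - {j}) y) z" for j y
  define e where "e j y = cvec (y j) \<bullet> (Gj j y * D *\<^sub>v cvec (y j)) - mtrace (U * Gj j y)" for j and y :: "nat \<Rightarrow> real Matrix.vec"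
  obtain y0 where y0: "y0 \<in> space columns" using C.not_empty by blast
  have estimate: "cmod (normalized_trace y - mtrace D / of_nat N)
      \<le> cmod z / ?\<eta> / (real N * real p) * (\<Sum>j<p. cmod (e j y)) + cmod z * \<tau> / (?\<eta> ^ 3 * real N) + \<gamma> * cmod z * \<tau> / ?\<eta>\<^sup>2 * cmod (normalized_trace y - ?w)"
    and Db: "op_bounded N (1 / ?\<eta>) D" if "y \<in> space columns" for y
  proof -
    have yj: "y j \<in> carrier_vec N" if "j < p" for j using space_columns[OF \<open>y \<in> space columns\<close>] that by simp
    have b': "Im (1 - of_real (real N / real p) + of_real (real N / real p) * z * ?w) \<le> 0"
      using b unfolding mp_factor_def \<gamma>_def .
    note E = resolvent_sample_cov_estimate[OF N p z yj Q t less_imp_le[OF \<tau>] b']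
    show "op_bounded N (1 / ?\<eta>) D" using E(1) unfolding D_def mp_factor_def \<gamma>_def .
    show "cmod (normalized_trace y - mtrace D / of_nat N)
      \<le> cmod z / ?\<eta> / (real N * real p) * (\<Sum>j<p. cmod (e j y)) + cmod z * \<tau> / (?\<eta> ^ 3 * real N) + \<gamma> * cmod z * \<tau> / ?\<eta>\<^sup>2 * cmod (normalized_trace y - ?w)"
      using E(2) unfolding normalized_trace_def D_def U_def e_def Gj_def mp_factor_def \<gamma>_def .
  qed
  note D = Db[OF y0]
  note Dc = op_boundedD(1)[OF D]
  have Uc: "U \<in> carrier_mat N N" unfolding U_def using cQ by simp
  have Gc: "Gj j y \<in> carrier_mat N N" and Gb: "op_bounded N (1 / ?\<eta>) (Gj j y)" for j y
    unfolding Gj_def using resolvent_psd(1,5)[OF resolvent_sample_cov z] by auto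
  have tr: "mtrace D / of_nat N = mp_rhs (point_distribution N t) z ?b"
    unfolding mp_rhs_def D_def mtrace_spec_mat[OF cQ] using N
    by (subst point_distribution_integral) (auto simp: scaleR_conv_of_real divide_inverse mult_ac)
  have em: "e j \<in> borel_measurable columns" if j: "j < p" for j
  proof -
    have Gm: "(\<lambda>y. Gj j y $$ (a,b)) \<in> borel_measurable columns" if "a < N" "b < N" for a b
      unfolding Gj_def using that by (intro sample_cov_resolvent_measurable) auto
    have GDm: "(\<lambda>y. (Gj j y * D) $$ (a,b)) \<in> borel_measurable columns" if ab: "a < N" "b < N" for a b
      unfolding mat_entry_mult[OF Gc Dc ab] using Gm ab by (intro borel_measurable_sum borel_measurable_times borel_measurable_const) auto
    have q: "(\<lambda>y. cvec (y j) \<bullet> (Gj j y * D *\<^sub>v cvec (y j))) \<in> borel_measurable columns"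
    proof (rule bilinear_form_measurable[where N = N])
      show "Gj j y * D \<in> carrier_mat N N" for y by (rule mult_carrier_mat[OF Gc Dc])
      show "y j \<in> carrier_vec N" if "y \<in> space columns" for y using space_columns[OF that] j by simp
      show "(\<lambda>y. y j $ a) \<in> borel_measurable columns" if "a < N" for a by (rule column_entry_measurable) (use j that in auto)
    qed (rule GDm)
    have "mtrace (U * Gj j y) = (\<Sum>a<N. \<Sum>b<N. U $$ (a,b) * Gj j y $$ (b,a))" for y
    proof -
      have "dim_row (U * Gj j y) = N" using Uc by simp
      then show ?thesis unfolding mtrace_def by (simp only:) (intro sum.cong refl mat_entry_mult[OF Uc Gc]; simp)
    qed
    moreover have "(\<lambda>y. \<Sum>a<N. \<Sum>b<N. U $$ (a,b) * Gj j y $$ (b,a)) \<in> borel_measurable columns"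
      using Gm by (intro borel_measurable_sum borel_measurable_times borel_measurable_const) auto
    ultimately have "(\<lambda>y. mtrace (U * Gj j y)) \<in> borel_measurable columns" by simp
    with q show ?thesis unfolding e_def[abs_def] by (rule borel_measurable_diff)
  qed
  have eb: "(\<integral>\<^sup>+y. ennreal (cmod (e j y)) \<partial>columns) \<le> ennreal (real N * (\<tau> / ?\<eta>\<^sup>2) * \<rho>)" if j: "j < p" for j
  proof -
    let ?I = "{..<p} - {j}"
    interpret CI: prob_space "PiM ?I (\<lambda>_. \<nu>)" by (rule prob_space_columns)
    have ins: "insert j ?I = {..<p}" using j by auto
    have "(\<integral>\<^sup>+y. ennreal (cmod (e j y)) \<partial>columns) = (\<integral>\<^sup>+x. (\<integral>\<^sup>+v. ennreal (cmod (e j (x(j := v)))) \<partial>\<nu>) \<partial>PiM ?I (\<lambda>_. \<nu>))"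
      using PP.product_nn_integral_insert[of ?I j "\<lambda>y. ennreal (cmod (e j y))"] em[OF j] unfolding ins
      by (simp add: measurable_compose[OF borel_measurable_norm measurable_ennreal])
    also have "\<dots> \<le> (\<integral>\<^sup>+x. ennreal (real N * (\<tau> * (1 / ?\<eta> * (1 / ?\<eta>))) * \<rho>) \<partial>PiM ?I (\<lambda>_. \<nu>))"
    proof (rule nn_integral_mono)
      fix x :: "nat \<Rightarrow> real Matrix.vec"
      have G: "Gj j (x(j := v)) = Gj j x" for v
        unfolding Gj_def by (subst sample_cov_cong[of _ _ x]) auto
      have TD: "mtrace (cmat (spec_mat N Q t) * (Gj j x * D)) = mtrace (U * Gj j x)"
      proof -
        have Tc: "cmat (spec_mat N Q t) \<in> carrier_mat N N" using Q by simp
        have "mtrace (cmat (spec_mat N Q t) * (Gj j x * D)) = mtrace ((Gj j x * D) * cmat (spec_mat N Q t))"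
          by (rule mtrace_mult_commute[OF Tc mult_carrier_mat[OF Gc Dc]])
        also have "(Gj j x * D) * cmat (spec_mat N Q t) = Gj j x * (D * cmat (spec_mat N Q t))"
          by (rule assoc_mult_mat[OF Gc Dc Tc])
        also have "D * cmat (spec_mat N Q t) = U"
          unfolding D_def U_def cmat_spec_mat[OF Q] spec_mat_mult[OF cQ] by simp
        also have "mtrace (Gj j x * U) = mtrace (U * Gj j x)" by (rule mtrace_mult_commute[OF Gc Uc])
        finally show ?thesis .
      qed
      show "(\<integral>\<^sup>+v. ennreal (cmod (e j (x(j := v)))) \<partial>\<nu>) \<le> ennreal (real N * (\<tau> * (1 / ?\<eta> * (1 / ?\<eta>))) * \<rho>)"
        using column_form[OF op_bounded_mult[OF Gb D], of j x] z unfolding e_def G TD by simp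
    qed
    also have "\<dots> = ennreal (real N * (\<tau> / ?\<eta>\<^sup>2) * \<rho>)"
      by (simp add: CI.emeasure_space_1 power2_eq_square)
    finally show ?thesis .
  qed
  have ei: "integrable columns (e j)" "(\<integral>y. cmod (e j y) \<partial>columns) \<le> real N * (\<tau> / ?\<eta>\<^sup>2) * \<rho>" if j: "j < p" for j
  proof -
    have nn: "0 \<le> real N * (\<tau> / ?\<eta>\<^sup>2) * \<rho>" using \<tau> \<rho> by simp
    show i: "integrable columns (e j)"
      by (rule integrableI_bounded) (use em[OF j] eb[OF j] in \<open>auto simp: order_le_less_trans[OF _ ennreal_less_top]\<close>)
    have "ennreal (\<integral>y. cmod (e j y) \<partial>columns) \<le> ennreal (real N * (\<tau> / ?\<eta>\<^sup>2) * \<rho>)"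
      using eb[OF j] nn_integral_eq_integral[OF integrable_norm[OF i]] by simp
    then show "(\<integral>y. cmod (e j y) \<partial>columns) \<le> real N * (\<tau> / ?\<eta>\<^sup>2) * \<rho>" using nn by simp
  qed
  have linear: "(\<integral>y. A * (\<Sum>j<p. f j y) + B + C * g y \<partial>columns) = A * (\<Sum>j<p. (\<integral>y. f j y \<partial>columns)) + B + C * (\<integral>y. g y \<partial>columns)"
    if f: "\<And>j. j < p \<Longrightarrow> integrable columns (f j)" and g: "integrable columns g" for A B C :: real and f g
  proof -
    have 1: "integrable columns (\<lambda>y. A * (\<Sum>j<p. f j y))"
      using f by (intro integrable_mult_right Bochner_Integration.integrable_sum) auto
    have "(\<integral>y. A * (\<Sum>j<p. f j y) \<partial>columns) = A * (\<Sum>j<p. (\<integral>y. f j y \<partial>columns))"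
      unfolding integral_mult_right_zero using f by (subst Bochner_Integration.integral_sum) auto
    moreover have "integrable columns (\<lambda>y. A * (\<Sum>j<p. f j y) + B)" using 1 by (intro Bochner_Integration.integrable_add) auto
    moreover have "(\<integral>y. A * (\<Sum>j<p. f j y) + B \<partial>columns) = (\<integral>y. A * (\<Sum>j<p. f j y) \<partial>columns) + B"
      using Bochner_Integration.integral_add[OF 1, of "\<lambda>_. B"] C.prob_space by simp
    ultimately show ?thesis
      using Bochner_Integration.integral_add[of columns "\<lambda>y. A * (\<Sum>j<p. f j y) + B" "\<lambda>y. C * g y"] g by simp
  qed
  have "cmod (?w - mtrace D / of_nat N) = cmod (\<integral>y. normalized_trace y - mtrace D / of_nat N \<partial>columns)"
    unfolding mean_trace_def using normalized_trace_integrable by (simp add: C.prob_space)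
  also have "\<dots> \<le> (\<integral>y. cmod (normalized_trace y - mtrace D / of_nat N) \<partial>columns)" by simp
  also have "\<dots> \<le> (\<integral>y. cmod z / ?\<eta> / (real N * real p) * (\<Sum>j<p. cmod (e j y)) + cmod z * \<tau> / (?\<eta> ^ 3 * real N) + \<gamma> * cmod z * \<tau> / ?\<eta>\<^sup>2 * cmod (normalized_trace y - ?w) \<partial>columns)"
    using normalized_trace_integrable ei(1)
    by (intro integral_mono estimate Bochner_Integration.integrable_add integrable_mult_right Bochner_Integration.integrable_sum integrable_norm Bochner_Integration.integrable_diff C.integrable_const) auto
  also have "\<dots> = cmod z / ?\<eta> / (real N * real p) * (\<Sum>j<p. (\<integral>y. cmod (e j y) \<partial>columns)) + cmod z * \<tau> / (?\<eta> ^ 3 * real N)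
      + \<gamma> * cmod z * \<tau> / ?\<eta>\<^sup>2 * (\<integral>y. cmod (normalized_trace y - ?w) \<partial>columns)"
    using normalized_trace_integrable ei(1) by (intro linear) auto
  also have "\<dots> \<le> cmod z / ?\<eta> / (real N * real p) * (\<Sum>j<p. real N * (\<tau> / ?\<eta>\<^sup>2) * \<rho>) + cmod z * \<tau> / (?\<eta> ^ 3 * real N)
      + \<gamma> * cmod z * \<tau> / ?\<eta>\<^sup>2 * (\<delta> + 8 / ?\<eta> * exp (- (\<delta>\<^sup>2 * ?\<eta>\<^sup>2 * (real N)\<^sup>2 / (32 * real p))))"
    using z \<tau> ei(2) by (intro add_mono mult_left_mono sum_mono expected_deviation[OF \<delta>] order_refl) (auto simp: \<gamma>_def)
  also have "cmod z / ?\<eta> / (real N * real p) * (\<Sum>j<p. real N * (\<tau> / ?\<eta>\<^sup>2) * \<rho>) = cmod z * \<tau> / ?\<eta> ^ 3 * \<rho>"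
    using N p by (simp add: power2_eq_square power3_eq_cube)
  finally show ?thesis unfolding tr .
qed

end

section \<open>Asymptotics of the parameters\<close>

text \<open>The odd moments vanish because \<open>x\<close> and \<open>- x\<close> have the same law.\<close>

lemma symmetric_variables_moments:
  fixes x :: "nat \<Rightarrow> 'b \<Rightarrow> real"
  assumes P: "prob_space P" and n: "n \<ge> 1"
    and indep: "prob_space.indep_vars P (\<lambda>_. borel) x {1..n}"
    and ident: "\<And>i. i \<in> {1..n} \<Longrightarrow> distr P borel (x i) = distr P borel (x 1)"
    and sym: "distr P borel (x 1) = distr P borel (\<lambda>\<omega>. - x 1 \<omega>)"
    and var: "(\<integral>\<omega>. (x 1 \<omega>)\<^sup>2 \<partial>P) = 1"
    and int4: "integrable P (\<lambda>\<omega>. x 1 \<omega> ^ 4)"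
  shows "symmetric_product_variables P {1..n} x (\<integral>\<omega>. x 1 \<omega> ^ 4 \<partial>P)"
proof -
  interpret prob_space P by fact
  have meas: "x i \<in> borel_measurable P" if "i \<in> {1..n}" for i
    using indep that by (auto simp: indep_vars_def)
  have m1: "x 1 \<in> borel_measurable P" using meas n by simp
  have int1: "integrable P (\<lambda>\<omega>. x 1 \<omega> ^ a)" if "a \<le> 4" for a
  proof (rule Bochner_Integration.integrable_bound)
    show "integrable P (\<lambda>\<omega>. 1 + x 1 \<omega> ^ 4)" using int4 by simp
    show "(\<lambda>\<omega>. x 1 \<omega> ^ a) \<in> borel_measurable P" using m1 by simp
    show "AE \<omega> in P. norm (x 1 \<omega> ^ a) \<le> norm (1 + x 1 \<omega> ^ 4)"
    proof (rule AE_I2)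
      fix \<omega>
      have "\<bar>x 1 \<omega>\<bar> ^ a \<le> 1 + \<bar>x 1 \<omega>\<bar> ^ 4"
      proof (cases "\<bar>x 1 \<omega>\<bar> \<le> 1")
        case True
        then have "\<bar>x 1 \<omega>\<bar> ^ a \<le> 1" by (intro power_le_one) auto
        then show ?thesis by (simp add: add_increasing2)
      next
        case False
        then have "\<bar>x 1 \<omega>\<bar> ^ a \<le> \<bar>x 1 \<omega>\<bar> ^ 4" using that by (intro power_increasing) auto
        then show ?thesis by simp
      qed
      then show "norm (x 1 \<omega> ^ a) \<le> norm (1 + x 1 \<omega> ^ 4)" by (simp add: power_abs abs_of_nonneg)
    qed
  qed
  have pm: "(\<lambda>u::real. u ^ a) \<in> borel_measurable borel" for a by simp
  have mom: "integrable P (\<lambda>\<omega>. x i \<omega> ^ a) \<longleftrightarrow> integrable P (\<lambda>\<omega>. x 1 \<omega> ^ a)"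
    "(\<integral>\<omega>. x i \<omega> ^ a \<partial>P) = (\<integral>\<omega>. x 1 \<omega> ^ a \<partial>P)" if i: "i \<in> {1..n}" for i a
    using integrable_distr_eq[OF meas[OF i] pm, of a] integrable_distr_eq[OF m1 pm, of a]
      integral_distr[OF meas[OF i] pm, of a] integral_distr[OF m1 pm, of a] ident[OF i] by simp_all
  have odd: "(\<integral>\<omega>. x 1 \<omega> ^ a \<partial>P) = 0" if "odd a" for a
  proof -
    have mm: "(\<lambda>\<omega>. - x 1 \<omega>) \<in> borel_measurable P" using m1 by simp
    have "(\<integral>\<omega>. x 1 \<omega> ^ a \<partial>P) = (\<integral>\<omega>. (- x 1 \<omega>) ^ a \<partial>P)"
      using integral_distr[OF m1 pm, of a] integral_distr[OF mm pm, of a] sym by simp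
    also have "\<dots> = - (\<integral>\<omega>. x 1 \<omega> ^ a \<partial>P)" using that by simp
    finally show ?thesis by simp
  qed
  show ?thesis
  proof unfold_locales
    show "finite {1..n}" by simp
    show "indep_vars (\<lambda>_. borel) x {1..n}" by (rule indep)
    fix i assume i: "i \<in> {1..n}"
    show "(\<integral>\<omega>. (x i \<omega>)\<^sup>2 \<partial>P) = 1" unfolding mom(2)[OF i] by (rule var)
    show "(\<integral>\<omega>. x i \<omega> ^ 4 \<partial>P) = (\<integral>\<omega>. x 1 \<omega> ^ 4 \<partial>P)" by (rule mom(2)[OF i])
    fix a :: nat assume a: "a \<le> 4"
    show "integrable P (\<lambda>\<omega>. x i \<omega> ^ a)" unfolding mom(1)[OF i] by (rule int1[OF a])
    show "(\<integral>\<omega>. x i \<omega> ^ a \<partial>P) = 0" if "odd a" unfolding mom(2)[OF i] by (rule odd[OF that])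
  qed
qed

text \<open>For \<open>d \<ge> 2\<close>, the bound \<open>d\<^sup>2 < n\<close> gives \<open>n \<le> (n / d)\<^sup>2 \<le> (n / d) ^ d\<close>. Thus exponential decay in
  the dimension implies exponential decay in \<open>n\<close>.\<close>

lemma binomial_ge_self:
  assumes "1 \<le> d" "real d < sqrt (real n)"
  shows "n \<le> n choose d" "d \<le> n"
proof -
  have d2: "real d ^ 2 \<le> real n"
    using assms by (metis less_imp_le of_nat_0_le_iff real_le_rsqrt real_sqrt_le_iff real_sqrt_pow2 power_mono)
  have "d * 1 \<le> d * d" using assms by (intro mult_le_mono) auto
  then have "real d \<le> real d ^ 2" by (simp add: power2_eq_square flip: of_nat_mult)
  then show dn: "d \<le> n" using d2 by linarith
  show "n \<le> n choose d"
  proof (cases "d = 1")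
    case False
    then have d: "2 \<le> d" using assms by simp
    have one: "1 \<le> real n / real d" using dn d by simp
    have "real n * real d ^ 2 \<le> real n * real n" using d2 by (intro mult_left_mono) auto
    then have "real n \<le> (real n / real d) ^ 2" using d by (simp add: power2_eq_square field_simps)
    also have "\<dots> \<le> (real n / real d) ^ d" by (rule power_increasing[OF d one])
    also have "\<dots> \<le> real (n choose d)" by (rule binomial_ge_n_over_k_pow_k[OF dn])
    finally show ?thesis by simp
  qed simp
qed

text \<open>With \<open>L = ln (sqrt n / d)\<close>, the exponent \<open>2 d (2 C)\<^sup>2 d / n\<close> equals \<open>8 exp (2 ln C - 2 L)\<close>. The
  assumption makes \<open>ln C\<close> at most \<open>L / 2\<close> eventually, and since \<open>ln C \<ge> ln 2\<close> it also forces \<open>L\<close> to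
  tend to infinity.\<close>

lemma overlap_excess_tendsto_0:
  fixes d :: "nat \<Rightarrow> nat" and C :: "nat \<Rightarrow> real"
  assumes d: "\<And>n. n \<ge> 2 \<Longrightarrow> 1 \<le> d n \<and> real (d n) < sqrt (real n)"
    and C: "\<And>n. n \<ge> 2 \<Longrightarrow> C n \<ge> 2" "(\<lambda>n. ln (C n) / ln (sqrt (real n) / real (d n))) \<longlonglongrightarrow> 0"
  shows "(\<lambda>n. (1 + ((2 * C n)\<^sup>2 - 1) * (real (d n) / real n)) ^ (2 * d n) - 1) \<longlonglongrightarrow> 0"
proof -
  define L where "L n = ln (sqrt (real n) / real (d n))" for n
  have L: "L n > 0" if "n \<ge> 2" for n
    unfolding L_def using d[OF that] by (intro ln_gt_zero) (simp add: less_divide_eq)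
  have ev2: "eventually (\<lambda>n::nat. n \<ge> 2) sequentially" by (rule eventually_ge_at_top)
  have "(\<lambda>n. ln 2 / L n) \<longlonglongrightarrow> 0"
  proof (rule tendsto_sandwich[OF _ _ tendsto_const C(2)[folded L_def]])
    show "eventually (\<lambda>n. 0 \<le> ln 2 / L n) sequentially" using ev2 by eventually_elim (use L in \<open>simp add: less_imp_le\<close>)
    show "eventually (\<lambda>n. ln 2 / L n \<le> ln (C n) / L n) sequentially"
      using ev2
    proof eventually_elim
      case (elim n)
      then show ?case using L[of n] C(1)[of n] by (intro divide_right_mono) auto
    qed
  qed
  then have "filterlim (\<lambda>n. inverse (ln 2 / L n)) at_top sequentially"
  proof (rule filterlim_inverse_at_top)
    show "eventually (\<lambda>n. 0 < ln 2 / L n) sequentially" using ev2 by eventually_elim (simp add: L)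
  qed
  then have "filterlim (\<lambda>n. ln 2 * inverse (ln 2 / L n)) at_top sequentially"
    by (intro filterlim_tendsto_pos_mult_at_top[OF tendsto_const]) auto
  then have Ltop: "filterlim L at_top sequentially" by simp
  have e0: "(\<lambda>n. exp (- L n)) \<longlonglongrightarrow> 0"
    using filterlim_compose[OF exp_at_bot filterlim_compose[OF filterlim_uminus_at_bot_at_top Ltop]] by simp
  have half: "eventually (\<lambda>n. ln (C n) / L n < 1 / 2) sequentially"
    using order_tendstoD(2)[OF C(2)[folded L_def], of "1/2"] by simp
  have "(\<lambda>n. exp (8 * exp (- L n)) - 1) \<longlonglongrightarrow> exp (8 * 0) - 1" by (intro tendsto_intros e0)
  then have up: "(\<lambda>n. exp (8 * exp (- L n)) - 1) \<longlonglongrightarrow> 0" by simp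
  show ?thesis
  proof (rule tendsto_sandwich[OF _ _ tendsto_const up])
    have k1: "0 \<le> ((2 * C n)\<^sup>2 - 1) * (real (d n) / real n)" if "n \<ge> 2" for n
    proof -
      have "1 \<le> (2 * C n)\<^sup>2" using C(1)[OF that] by (intro one_le_power) auto
      then show ?thesis by simp
    qed
    show "eventually (\<lambda>n. 0 \<le> (1 + ((2 * C n)\<^sup>2 - 1) * (real (d n) / real n)) ^ (2 * d n) - 1) sequentially"
      using ev2 by eventually_elim (use k1 one_le_power in force)
    show "eventually (\<lambda>n. (1 + ((2 * C n)\<^sup>2 - 1) * (real (d n) / real n)) ^ (2 * d n) - 1 \<le> exp (8 * exp (- L n)) - 1) sequentially"
      using ev2 half
    proof eventually_elim
      case (elim n)
      let ?a = "((2 * C n)\<^sup>2 - 1) * (real (d n) / real n)"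
      have Cn: "C n > 0" "d n \<ge> 1" using C(1)[of n] d[of n] elim by auto
      have "(1 + ?a) ^ (2 * d n) \<le> exp ?a ^ (2 * d n)"
        using k1[of n] elim by (intro power_mono exp_ge_add_one_self) auto
      also have "\<dots> = exp (real (2 * d n) * ?a)" by (rule exp_of_nat_mult[symmetric])
      also have "real (2 * d n) * ?a \<le> real (2 * d n) * ((2 * C n)\<^sup>2 * (real (d n) / real n))"
        by (intro mult_left_mono mult_right_mono) auto
      also have "\<dots> = 8 * ((C n)\<^sup>2 * ((real (d n))\<^sup>2 / real n))" by (simp add: power2_eq_square)
      also have "(C n)\<^sup>2 * ((real (d n))\<^sup>2 / real n) = exp (2 * ln (C n) - 2 * L n)"
      proof -
        have u: "sqrt (real n) / real (d n) > 0" using Cn elim by simp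
        have "exp (2 * ln (C n) - 2 * L n) = (exp (ln (C n)))\<^sup>2 / (exp (L n))\<^sup>2"
          by (simp add: exp_diff exp_double)
        also have "\<dots> = (C n)\<^sup>2 / (sqrt (real n) / real (d n))\<^sup>2" unfolding L_def using Cn u by simp
        also have "\<dots> = (C n)\<^sup>2 * ((real (d n))\<^sup>2 / real n)" using elim by (simp add: power_divide)
        finally show ?thesis by simp
      qed
      also have "8 * exp (2 * ln (C n) - 2 * L n) \<le> 8 * exp (- L n)"
        using elim L[of n] by (simp add: field_simps)
      finally show ?case by (simp add: mult_left_mono)
    qed
  qed
qed

lemma exp_linear_summable:
  assumes "c > 0"
  shows "summable (\<lambda>n. exp (- (c * real n)))"
proof -
  have "exp (- (c * real n)) = exp (- c) ^ n" for n by (simp add: exp_of_nat_mult[symmetric] mult.commute)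
  then show ?thesis using assms by (simp add: summable_geometric)
qed

section \<open>The limit theorem\<close>

lemma sample_cov_columns:
  assumes Z: "Z \<in> carrier_mat N p"
  shows "c \<cdot>\<^sub>m (Z * transpose_mat Z) = sample_cov N c {..<p} (\<lambda>j\<in>{..<p}. col Z j)"
proof (rule eq_matI)
  fix a b assume "a < dim_row (sample_cov N c {..<p} (\<lambda>j\<in>{..<p}. col Z j))" "b < dim_col (sample_cov N c {..<p} (\<lambda>j\<in>{..<p}. col Z j))"
  then have ab: "a < N" "b < N" by (auto simp: sample_cov_def)
  have ZT: "transpose_mat Z \<in> carrier_mat p N" using Z by simp
  show "(c \<cdot>\<^sub>m (Z * transpose_mat Z)) $$ (a,b) = sample_cov N c {..<p} (\<lambda>j\<in>{..<p}. col Z j) $$ (a,b)"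
    using ab Z mat_entry_mult[OF Z ZT ab] by (simp add: sample_cov_def cong: sum.cong_simp)
qed (use Z in \<open>auto simp: sample_cov_def\<close>)

text \<open>The countable set of points on which the almost sure convergence is established.\<close>

lemma rational_upper_half_plane:
  defines "A \<equiv> {z. Im z > 0 \<and> Re z \<in> \<rat> \<and> Im z \<in> \<rat>}"
  shows "countable A" "k > 0 \<Longrightarrow> \<i> * of_nat k \<in> A" "Im z > 0 \<Longrightarrow> \<epsilon> > 0 \<Longrightarrow> \<exists>a\<in>A. cmod (a - z) < \<epsilon>"
proof -
  have "A \<subseteq> (\<lambda>(a,b). Complex a b) ` (\<rat> \<times> \<rat>)"
  proof
    fix z assume "z \<in> A"
    then show "z \<in> (\<lambda>(a,b). Complex a b) ` (\<rat> \<times> \<rat>)"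
      by (intro image_eqI[of _ _ "(Re z, Im z)"]) (auto simp: A_def)
  qed
  then show "countable A" by (rule countable_subset) (auto intro: countable_rat)
  show "\<i> * of_nat k \<in> A" if "k > 0" using that by (simp add: A_def)
  show "\<exists>a\<in>A. cmod (a - z) < \<epsilon>" if z: "Im z > 0" and \<epsilon>: "\<epsilon> > 0"
  proof -
    obtain q where q: "q \<in> \<rat>" "Re z < q" "q < Re z + \<epsilon> / 2" using Rats_dense_in_real[of "Re z" "Re z + \<epsilon> / 2"] \<epsilon> by auto
    obtain r where r: "r \<in> \<rat>" "Im z < r" "r < Im z + \<epsilon> / 2" using Rats_dense_in_real[of "Im z" "Im z + \<epsilon> / 2"] \<epsilon> by auto
    have "cmod (Complex q r - z) \<le> \<bar>Re (Complex q r - z)\<bar> + \<bar>Im (Complex q r - z)\<bar>" by (rule cmod_le)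
    also have "\<dots> < \<epsilon>" using q r by simp
    finally show ?thesis using q r z by (intro bexI[of _ "Complex q r"]) (auto simp: A_def)
  qed
qed

theorem theorem2:
  fixes d p N :: "nat \<Rightarrow> nat"
    and \<gamma> :: real
    and P :: "nat \<Rightarrow> 'b measure"
    and x :: "nat \<Rightarrow> nat \<Rightarrow> 'b \<Rightarrow> real"
    and C :: "nat \<Rightarrow> real"
    and T :: "nat \<Rightarrow> real mat"
    and H :: "real measure"
    and e :: "nat \<Rightarrow> nat \<Rightarrow> nat list"
    and M :: "'a measure"
    and Z :: "nat \<Rightarrow> 'a \<Rightarrow> real mat"
  assumes d: "\<And>n. n \<ge> 2 \<Longrightarrow> 1 \<le> d n \<and> real (d n) < sqrt (real n)"
    and N: "\<And>n. N n = n choose d n"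
    and p: "\<And>n. n \<ge> 2 \<Longrightarrow> 1 \<le> p n"
    and \<gamma>: "0 < \<gamma>" "(\<lambda>n. real (N n) / real (p n)) \<longlonglongrightarrow> \<gamma>"
    \<comment> \<open>the random variables: \<open>x n 1, \<dots>, x n n\<close> are i.i.d.\<close>
    and P: "\<And>n. n \<ge> 2 \<Longrightarrow> prob_space (P n)"
    and x_indep: "\<And>n. n \<ge> 2 \<Longrightarrow> prob_space.indep_vars (P n) (\<lambda>_. borel) (x n) {1..n}"
    and x_ident: "\<And>n i. n \<ge> 2 \<Longrightarrow> i \<in> {1..n} \<Longrightarrow>
                    distr (P n) borel (x n i) = distr (P n) borel (x n 1)"
    and x_sym: "\<And>n. n \<ge> 2 \<Longrightarrow>
                  distr (P n) borel (x n 1) = distr (P n) borel (\<lambda>\<omega>. - x n 1 \<omega>)"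
    and x_var: "\<And>n. n \<ge> 2 \<Longrightarrow> (\<integral>\<omega>. (x n 1 \<omega>)\<^sup>2 \<partial>P n) = 1"
    and x_moments: "\<And>n k. n \<ge> 2 \<Longrightarrow> k \<ge> 1 \<Longrightarrow>
                      integrable (P n) (\<lambda>\<omega>. x n 1 \<omega> ^ (2 * k)) \<and>
                      (\<integral>\<omega>. x n 1 \<omega> ^ (2 * k) \<partial>P n) \<le> (C n * real k) ^ k"
    and C: "\<And>n. n \<ge> 2 \<Longrightarrow> C n \<ge> 2"
           "(\<lambda>n. ln (C n) / ln (sqrt (real n) / real (d n))) \<longlonglongrightarrow> 0"
    \<comment> \<open>the deterministic matrices\<close>
    and T: "\<And>n. n \<ge> 2 \<Longrightarrow> T n \<in> carrier_mat (N n) (N n) \<and> psd_mat (T n)"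
    and T_bdd: "bdd_above ((\<lambda>n. op_norm (T n)) ` {2..})"
    and H: "real_distribution H" "weak_conv (\<lambda>n. esd (T n)) (cdf H)"
    \<comment> \<open>the bijection identifying positions with index tuples\<close>
    and e: "\<And>n. n \<ge> 2 \<Longrightarrow> bij_betw (e n) {..<N n} (index_tuples n (d n))"
    \<comment> \<open>the random matrices: the columns of \<open>Z n\<close> are i.i.d.\<close>
    and M: "prob_space M"
    and Z_dim: "\<And>n \<omega>. n \<ge> 2 \<Longrightarrow> \<omega> \<in> space M \<Longrightarrow> Z n \<omega> \<in> carrier_mat (N n) (p n)"
    and Z_indep: "\<And>n. n \<ge> 2 \<Longrightarrow>
                    prob_space.indep_vars M (\<lambda>_. borel_vec (N n)) (\<lambda>j \<omega>. col (Z n \<omega>) j) {..<p n}"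
    and Z_law: "\<And>n j. n \<ge> 2 \<Longrightarrow> j < p n \<Longrightarrow>
                  distr M (borel_vec (N n)) (\<lambda>\<omega>. col (Z n \<omega>) j) =
                  distr (P n) (borel_vec (N n))
                    (\<lambda>\<omega>. psd_sqrt (T n) *\<^sub>v tensor_vec (N n) (e n) (\<lambda>i. x n i \<omega>))"
  shows "\<exists>\<mu>. real_distribution \<mu> \<and>
           (AE \<omega> in M. weak_conv
              (\<lambda>n. esd ((1 / real (p n)) \<cdot>\<^sub>m (Z n \<omega> * transpose_mat (Z n \<omega>)))) (cdf \<mu>)) \<and>
           (\<forall>z. Im z > 0 \<longrightarrow>
              stieltjes \<mu> z =
              (\<integral>t. 1 / (z - complex_of_real t *
                    (1 - complex_of_real \<gamma> + complex_of_real \<gamma> * z * stieltjes \<mu> z)) \<partial>H))"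
proof -
  interpret M: prob_space M by (rule M)
  have dn: "d n \<le> n" and Nn: "n \<le> N n" if "n \<ge> 2" for n
    using binomial_ge_self[of "d n" n] d[OF that] N[of n] by auto
  obtain \<tau>0 where \<tau>0: "\<And>n. n \<ge> 2 \<Longrightarrow> op_norm (T n) \<le> \<tau>0"
    using T_bdd by (auto simp: bdd_above_def)
  define \<tau> where "\<tau> = max \<tau>0 1"
  have \<tau>: "0 < \<tau>" by (simp add: \<tau>_def)
  have "\<exists>Q t. orth_mat (N n) Q \<and> T n = spec_mat (N n) Q t \<and> (\<forall>i<N n. 0 \<le> t i \<and> t i \<le> \<tau>)" if n: "n \<ge> 2" for n
  proof -
    obtain Q t where Q: "orth_mat (N n) Q" "T n = spec_mat (N n) Q t" and t: "\<And>i. i < N n \<Longrightarrow> 0 \<le> t i"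
      using psd_diagonalizable T[OF n] by metis
    have "t i \<le> \<tau>" if "i < N n" for i
      using eigenvalue_le_op_norm[OF Q(1) that, of t] \<tau>0[OF n] unfolding Q(2)[symmetric] \<tau>_def by simp
    then show ?thesis using Q t by blast
  qed
  then obtain Q t where Q: "\<And>n. n \<ge> 2 \<Longrightarrow> orth_mat (N n) (Q n)" and TQ: "\<And>n. n \<ge> 2 \<Longrightarrow> T n = spec_mat (N n) (Q n) (t n)"
    and t: "\<And>n i. n \<ge> 2 \<Longrightarrow> i < N n \<Longrightarrow> 0 \<le> t n i \<and> t n i \<le> \<tau>" by metis
  \<comment> \<open>the bound on \<open>E x\<^sup>4\<close> that the moment condition gives for the exponent \<open>2\<close>\<close>
  define k where "k n = (2 * C n)\<^sup>2" for n
  define r where "r n = (1 + (k n - 1) * (real (d n) / real n)) ^ (2 * d n) - 1" for n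
  define \<rho> where "\<rho> n = sqrt (2 * r n)" for n
  have r0: "r \<longlonglongrightarrow> 0" unfolding r_def k_def by (rule overlap_excess_tendsto_0[OF d C])
  define \<nu> where "\<nu> n = distr (P n) (borel_vec (N n)) (\<lambda>\<omega>. psd_sqrt (T n) *\<^sub>v tensor_vec (N n) (e n) (\<lambda>i. x n i \<omega>))" for n
  have cm: "column_model (\<nu> n) (N n) (p n) (Q n) (t n) \<tau> (\<rho> n) z" if n: "n \<ge> 2" and z: "Im z > 0" for n z
  proof -
    let ?\<kappa> = "\<integral>\<omega>. x n 1 \<omega> ^ 4 \<partial>P n"
    have m4: "integrable (P n) (\<lambda>\<omega>. x n 1 \<omega> ^ 4)" "?\<kappa> \<le> k n"
      using x_moments[OF n, of 2] by (simp_all add: k_def power_mult_distrib mult.commute)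
    have k2: "2 \<le> k n"
      using power_mono[of 4 "2 * C n" 2] C(1)[OF n] by (simp add: k_def)
    have sp: "symmetric_product_variables (P n) {1..n} (x n) ?\<kappa>"
      using n by (intro symmetric_variables_moments P x_indep x_ident x_sym x_var m4) auto
    have \<kappa>0: "0 \<le> ?\<kappa>" by (rule integral_nonneg_AE) simp
    have one: "op_bounded (N n) 1 (1\<^sub>m (N n))" by (auto simp: op_bounded_def)
    have d': "1 \<le> d n" "d n \<le> n" using d[OF n] dn[OF n] by auto
    have \<nu>': "\<nu> n = distr (P n) (borel_vec (N n)) (\<lambda>\<omega>. psd_sqrt (spec_mat (N n) (Q n) (t n)) *\<^sub>v tensor_vec (N n) (e n) (\<lambda>i. x n i \<omega>))"
      unfolding \<nu>_def TQ[OF n] ..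
    have L1a: "prob_space (\<nu> n)"
      unfolding \<nu>'
    proof (rule column_quadratic_form_L1(1)[where x = "x n" and \<kappa> = ?\<kappa> and n = n and d = "d n" and k = "k n" and m = 1 and M = "1\<^sub>m (N n)" and \<tau> = \<tau>])
    qed (rule sp e[OF n] N d' k2 \<kappa>0 m4(2) Q[OF n] \<tau> one t[OF n] zero_less_one_class.zero_less_one; assumption?)+
    have L1b: "(\<integral>\<^sup>+y. ennreal (cmod (cvec y \<bullet> (A *\<^sub>v cvec y) - mtrace (cmat (spec_mat (N n) (Q n) (t n)) * A))) \<partial>\<nu> n)
        \<le> ennreal (real (N n) * (\<tau> * m) * \<rho> n)" if "op_bounded (N n) m A" "0 < m" for A m
      unfolding \<nu>' \<rho>_def r_def
    proof (rule column_quadratic_form_L1(2)[where \<kappa> = ?\<kappa>])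
    qed (rule sp e[OF n] N d' k2 \<kappa>0 m4(2) Q[OF n] \<tau> that t[OF n]; assumption?)+
    have k1: "1 \<le> 1 + (k n - 1) * (real (d n) / real n)" using k2 by simp
    show ?thesis
    proof (intro column_model.intro column_model_axioms.intro)
      show "prob_space (\<nu> n)" by (rule L1a)
      show "sets (\<nu> n) = sets (borel_vec (N n))" by (simp add: \<nu>_def)
      show "0 < N n" "0 < p n" using Nn[OF n] p[OF n] n by auto
      show "0 \<le> \<rho> n" using one_le_power[OF k1] by (simp add: \<rho>_def r_def)
    qed (rule Q[OF n] t[OF n] \<tau> z L1b; assumption)+
  qed
  define cols where "cols n \<omega> = (\<lambda>j\<in>{..<p n}. col (Z n \<omega>) j)" for n \<omega>
  define F where "F n z \<omega> = column_model.normalized_trace (N n) (p n) z (cols n \<omega>)" for n z \<omega>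
  define w where "w n z = column_model.mean_trace (\<nu> n) (N n) (p n) z" for n z
  have Nn0: "0 < N n" "0 < p n" if "n \<ge> 2" for n using Nn[OF that] p[OF that] that by auto
  \<comment> \<open>the joint law of the columns is the product measure of the model\<close>
  have colm: "cols n \<in> measurable M (PiM {..<p n} (\<lambda>_. \<nu> n))"
    and law: "distr M (PiM {..<p n} (\<lambda>_. \<nu> n)) (cols n) = PiM {..<p n} (\<lambda>_. \<nu> n)" if n: "n \<ge> 2" for n
  proof -
    let ?X = "\<lambda>j \<omega>. col (Z n \<omega>) j"
    have rv: "?X j \<in> measurable M (borel_vec (N n))" if "j \<in> {..<p n}" for j
      using Z_indep[OF n] that by (auto simp: M.indep_vars_def)
    have ne: "{..<p n} \<noteq> {}" using Nn0[OF n] by (auto simp: lessThan_empty_iff)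
    have seq: "sets (PiM {..<p n} (\<lambda>_. borel_vec (N n))) = sets (PiM {..<p n} (\<lambda>_. \<nu> n))"
      by (intro sets_PiM_cong) (auto simp: \<nu>_def)
    have "cols n \<in> measurable M (PiM {..<p n} (\<lambda>_. borel_vec (N n)))"
      unfolding cols_def[abs_def] by (rule measurable_restrict) (rule rv)
    then show "cols n \<in> measurable M (PiM {..<p n} (\<lambda>_. \<nu> n))" using measurable_cong_sets[OF refl seq, of M] by blast
    have "distr M (PiM {..<p n} (\<lambda>_. \<nu> n)) (cols n) = distr M (PiM {..<p n} (\<lambda>_. borel_vec (N n))) (cols n)"
      using seq by (intro distr_cong) auto
    also have "\<dots> = PiM {..<p n} (\<lambda>j. distr M (borel_vec (N n)) (?X j))"
      unfolding cols_def[abs_def]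
      by (rule iffD1[OF M.indep_vars_iff_distr_eq_PiM']) (rule ne rv Z_indep[OF n]; assumption?)+
    also have "\<dots> = PiM {..<p n} (\<lambda>_. \<nu> n)"
      by (intro PiM_cong refl) (simp add: Z_law[OF n] \<nu>_def)
    finally show "distr M (PiM {..<p n} (\<lambda>_. \<nu> n)) (cols n) = PiM {..<p n} (\<lambda>_. \<nu> n)" .
  qed
  define g where "g n = real (N n) / real (p n)" for n
  have gl: "g \<longlonglongrightarrow> \<gamma>" unfolding g_def by (rule \<gamma>(2))
  have gl2: "eventually (\<lambda>n. \<gamma> / 2 < g n) sequentially" using \<gamma>(1) by (intro order_tendstoD(1)[OF gl]) simp
  have ev2: "eventually (\<lambda>n::nat. n \<ge> 2) sequentially" by (rule eventually_ge_at_top)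
  \<comment> \<open>the exponent of the concentration bound grows at least linearly in \<open>n\<close>\<close>
  have expo: "eventually (\<lambda>n. exp (- (\<delta>\<^sup>2 * (Im z)\<^sup>2 * (real (N n))\<^sup>2 / (32 * real (p n)))) \<le> exp (- (\<delta>\<^sup>2 * (Im z)\<^sup>2 * \<gamma> / 64 * real n))) sequentially"
    for \<delta> :: real and z :: complex
    using ev2 gl2
  proof eventually_elim
    case (elim n)
    have "\<gamma> / 2 * real n \<le> g n * real (N n)" using elim Nn[of n] \<gamma>(1) by (intro mult_mono) auto
    then have "\<delta>\<^sup>2 * (Im z)\<^sup>2 / 32 * (\<gamma> / 2 * real n) \<le> \<delta>\<^sup>2 * (Im z)\<^sup>2 / 32 * (g n * real (N n))"
      by (intro mult_left_mono) auto
    then show ?case by (simp add: g_def power2_eq_square mult_ac)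
  qed
  have AEF: "AE \<omega> in M. (\<lambda>n. F n z \<omega> - w n z) \<longlonglongrightarrow> 0" if z: "Im z > 0" for z
  proof -
    have "AE \<omega> in M. eventually (\<lambda>n. cmod (F n z \<omega> - w n z) < \<delta>) sequentially" if \<delta>: "\<delta> > 0" for \<delta>
    proof -
      \<comment> \<open>the exceptional sets of Borel--Cantelli; nothing is measurable a priori for \<open>n < 2\<close>\<close>
      define B where "B n = (if n \<ge> 2 then {\<omega> \<in> space M. \<delta> \<le> cmod (F n z \<omega> - w n z)} else {})" for n
      have Bm: "B n \<in> sets M" and Bb: "measure M (B n) \<le> 4 * exp (- (\<delta>\<^sup>2 * (Im z)\<^sup>2 * (real (N n))\<^sup>2 / (32 * real (p n))))" for n
      proof -
        have "B n \<in> sets M \<and> measure M (B n) \<le> 4 * exp (- (\<delta>\<^sup>2 * (Im z)\<^sup>2 * (real (N n))\<^sup>2 / (32 * real (p n))))" if n: "n \<ge> 2"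
        proof -
          interpret cm: column_model "\<nu> n" "N n" "p n" "Q n" "t n" \<tau> "\<rho> n" z by (rule cm[OF n z])
          let ?E = "{y \<in> space cm.columns. \<delta> \<le> cmod (cm.normalized_trace y - cm.mean_trace)}"
          have Em: "?E \<in> sets cm.columns" by measurable
          have BE: "B n = cols n -` ?E \<inter> space M"
            using n measurable_space[OF colm[OF n]] unfolding B_def F_def w_def by auto
          have "measure M (B n) = measure (distr M cm.columns (cols n)) ?E"
            unfolding BE by (rule measure_distr[OF colm[OF n] Em, symmetric])
          also have "\<dots> \<le> 4 * exp (- (\<delta>\<^sup>2 * (Im z)\<^sup>2 * (real (N n))\<^sup>2 / (32 * real (p n))))"
            unfolding law[OF n] by (rule cm.normalized_trace_concentration[OF \<delta>])
          finally show ?thesis unfolding BE using measurable_sets[OF colm[OF n] Em] by simp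
        qed
        then show "B n \<in> sets M" "measure M (B n) \<le> 4 * exp (- (\<delta>\<^sup>2 * (Im z)\<^sup>2 * (real (N n))\<^sup>2 / (32 * real (p n))))"
          by (cases "n \<ge> 2"; simp add: B_def)+
      qed
      have c: "0 < \<delta>\<^sup>2 * (Im z)\<^sup>2 * \<gamma> / 64" using \<delta> z \<gamma>(1) by simp
      have "summable (\<lambda>n. measure M (B n))"
      proof (rule summable_comparison_test_ev)
        show "summable (\<lambda>n. 4 * exp (- (\<delta>\<^sup>2 * (Im z)\<^sup>2 * \<gamma> / 64 * real n)))"
          by (intro summable_mult exp_linear_summable c)
        show "eventually (\<lambda>n. norm (measure M (B n)) \<le> 4 * exp (- (\<delta>\<^sup>2 * (Im z)\<^sup>2 * \<gamma> / 64 * real n))) sequentially"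
          using expo[of \<delta> z]
        proof eventually_elim
          case (elim n)
          show ?case unfolding real_norm_def abs_of_nonneg[OF measure_nonneg]
            by (rule order_trans[OF Bb mult_left_mono[OF elim]]) simp
        qed
      qed
      then have "AE \<omega> in M. eventually (\<lambda>n. \<omega> \<in> space M - B n) sequentially"
        using Bm by (intro borel_cantelli_AE1) (auto simp: M.emeasure_eq_measure)
      then show ?thesis
      proof eventually_elim
        case (elim \<omega>)
        show ?case using elim ev2 by eventually_elim (auto simp: B_def not_le)
      qed
    qed
    then have "AE \<omega> in M. \<forall>i. eventually (\<lambda>n. cmod (F n z \<omega> - w n z) < 1 / real (Suc i)) sequentially"
      unfolding AE_all_countable by simp
    then show ?thesis
    proof eventually_elim
      case (elim \<omega>)
      show ?case
      proof (rule tendstoI)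
        fix \<epsilon> :: real assume "\<epsilon> > 0"
        then obtain i where "1 / real (Suc i) < \<epsilon>" by (rule nat_approx_posE)
        with elim show "eventually (\<lambda>n. dist (F n z \<omega> - w n z) 0 < \<epsilon>) sequentially"
          by (auto elim!: eventually_mono dest!: spec[of _ i])
      qed
    qed
  qed
  have wr: "(\<lambda>n. w n z - mp_rhs (point_distribution (N n) (t n)) z (mp_factor (g n) z (w n z))) \<longlonglongrightarrow> 0" if z: "Im z > 0" for z
  proof (rule tendstoI)
    fix \<epsilon> :: real assume \<epsilon>: "\<epsilon> > 0"
    define L where "L = \<gamma> * cmod z * \<tau> / (Im z)\<^sup>2"
    \<comment> \<open>\<open>L\<close> is the limit of the coefficient of \<open>\<delta>\<close> in the error bound; \<open>+ 1\<close> avoids division by \<open>0\<close>\<close>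
    define \<delta> where "\<delta> = \<epsilon> / (2 * (L + 1))"
    have L: "0 \<le> L" using \<gamma>(1) \<tau> by (simp add: L_def)
    have \<delta>: "\<delta> > 0" using \<epsilon> L by (simp add: \<delta>_def)
    define bnd where "bnd n = cmod z * \<tau> / Im z ^ 3 * \<rho> n + cmod z * \<tau> / (Im z ^ 3 * real (N n))
      + g n * cmod z * \<tau> / (Im z)\<^sup>2 * (\<delta> + 8 / Im z * exp (- (\<delta>\<^sup>2 * (Im z)\<^sup>2 * (real (N n))\<^sup>2 / (32 * real (p n)))))" for n
    have \<rho>0: "\<rho> \<longlonglongrightarrow> 0"
    proof -
      have "(\<lambda>n. sqrt (2 * r n)) \<longlonglongrightarrow> sqrt (2 * 0)" by (intro tendsto_intros r0)
      then show ?thesis by (simp add: \<rho>_def[abs_def])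
    qed
    have "filterlim N at_top sequentially"
      by (rule filterlim_at_top_mono[OF filterlim_ident]) (rule eventually_mono[OF ev2 Nn])
    then have Ntop: "filterlim (\<lambda>n. Im z ^ 3 * real (N n)) at_top sequentially"
      using z by (intro filterlim_tendsto_pos_mult_at_top[OF tendsto_const] filterlim_compose[OF filterlim_real_sequentially]) auto
    have E0: "(\<lambda>n. exp (- (\<delta>\<^sup>2 * (Im z)\<^sup>2 * (real (N n))\<^sup>2 / (32 * real (p n))))) \<longlonglongrightarrow> 0"
    proof (rule tendsto_sandwich[OF _ expo tendsto_const])
      have "0 < \<delta>\<^sup>2 * (Im z)\<^sup>2 * \<gamma> / 64" using \<delta> z \<gamma>(1) by simp
      from summable_LIMSEQ_zero[OF exp_linear_summable[OF this]]
      show "(\<lambda>n. exp (- (\<delta>\<^sup>2 * (Im z)\<^sup>2 * \<gamma> / 64 * real n))) \<longlonglongrightarrow> 0" .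
    qed simp
    have "bnd \<longlonglongrightarrow> cmod z * \<tau> / Im z ^ 3 * 0 + 0 + L * (\<delta> + 8 / Im z * 0)"
      unfolding bnd_def[abs_def] L_def using z
      by (intro tendsto_add tendsto_mult tendsto_const tendsto_divide \<rho>0 gl E0 real_tendsto_divide_at_top[OF tendsto_const Ntop]) auto
    moreover have "L * \<delta> < \<epsilon>" 
    proof -
      have "L * \<delta> \<le> (L + 1) * \<delta>" using \<delta> by (intro mult_right_mono) auto
      also have "\<dots> = \<epsilon> / 2" using L by (simp add: \<delta>_def divide_simps)
      finally show ?thesis using \<epsilon> by linarith
    qed
    ultimately have "eventually (\<lambda>n. bnd n < \<epsilon>) sequentially" by (intro order_tendstoD(2)) auto
    then show "eventually (\<lambda>n. dist (w n z - mp_rhs (point_distribution (N n) (t n)) z (mp_factor (g n) z (w n z))) 0 < \<epsilon>) sequentially"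
      using ev2
    proof eventually_elim
      case (elim n)
      interpret cm: column_model "\<nu> n" "N n" "p n" "Q n" "t n" \<tau> "\<rho> n" z by (rule cm[OF elim(2) z])
      have "cmod (w n z - mp_rhs (point_distribution (N n) (t n)) z (mp_factor (g n) z (w n z))) \<le> bnd n"
        unfolding w_def bnd_def g_def by (rule cm.mean_trace_equation[OF \<delta>])
      then show ?case using elim(1) by simp
    qed
  qed
  define A where "A = {z. Im z > 0 \<and> Re z \<in> \<rat> \<and> Im z \<in> \<rat>}"
  note A = rational_upper_half_plane[folded A_def]
  have A0: "Im z > 0" if "z \<in> A" for z using that by (simp add: A_def)
  have good: "AE \<omega> in M. \<forall>z\<in>A. (\<lambda>n. F n z \<omega> - w n z) \<longlonglongrightarrow> 0"
    using AEF A0 by (intro AE_ball_countable'[OF _ A(1)]) auto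
  \<comment> \<open>the assumptions concern \<open>n \<ge> 2\<close>, so the sequences are shifted by \<open>2\<close>\<close>
  define h where "h n = point_distribution (N (n + 2)) (t (n + 2))" for n
  have h: "real_distribution (h n)" for n unfolding h_def by (rule point_distribution_real)
  have hs: "AE s in h n. 0 \<le> s \<and> s \<le> \<tau>" for n
    unfolding h_def point_distribution_def using Nn0[of "n + 2"] t[of "n + 2"]
    by (subst AE_distr_iff) (auto simp: AE_measure_pmf_iff lessThan_empty_iff)
  have hc: "cdf (h n) = esd (T (n + 2))" for n
    unfolding h_def using esd_spec_mat[OF Q[of "n + 2"] Nn0(1)[of "n + 2"]] TQ[of "n + 2"] by simp
  have hH: "weak_conv_m h H"
    unfolding weak_conv_m_def weak_conv_def hc
    using H(2) LIMSEQ_ignore_initial_segment[of _ _ 2] by (auto simp: weak_conv_def)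
  have supp: "AE s in H. 0 \<le> s \<and> s \<le> \<tau>" by (rule weak_limit_bounded[OF h H(1) hH hs])
  let ?S = "\<lambda>n \<omega>. (1 / real (p n)) \<cdot>\<^sub>m (Z n \<omega> * transpose_mat (Z n \<omega>))"
  \<comment> \<open>the deterministic limit theorem, applied to one realisation at a time\<close>
  have limit: "\<exists>\<mu>. real_distribution \<mu> \<and> weak_conv (\<lambda>n. esd (?S n \<omega>)) (cdf \<mu>) \<and> (AE s in \<mu>. 0 \<le> s) \<and>
      (\<forall>z. Im z > 0 \<longrightarrow> stieltjes \<mu> z = mp_rhs H z (mp_factor \<gamma> z (stieltjes \<mu> z)))"
    if \<omega>: "\<omega> \<in> space M" and conv: "\<forall>z\<in>A. (\<lambda>n. F n z \<omega> - w n z) \<longlonglongrightarrow> 0" for \<omega>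
  proof -
    have S: "?S n \<omega> = sample_cov (N n) (1 / real (p n)) {..<p n} (cols n \<omega>)" if "n \<ge> 2" for n
      unfolding cols_def by (rule sample_cov_columns[OF Z_dim[OF that \<omega>]])
    have "\<exists>\<mu>. real_distribution \<mu> \<and> cdf \<mu> = esd (?S (n + 2) \<omega>) \<and> (AE s in \<mu>. 0 \<le> s) \<and> (\<forall>z. Im z > 0 \<longrightarrow> stieltjes \<mu> z = F (n + 2) z \<omega>)" for n
    proof -
      have n: "n + 2 \<ge> 2" by simp
      have FT: "F (n + 2) z \<omega> = mtrace (resolvent (?S (n + 2) \<omega>) z) / of_nat (N (n + 2))" if "Im z > 0" for z
        unfolding F_def column_model.normalized_trace_def[OF cm[OF n that]] S[OF n] ..
      have "?S (n + 2) \<omega> \<in> carrier_mat (N (n + 2)) (N (n + 2))" "psd_mat (?S (n + 2) \<omega>)"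
        unfolding S[OF n] by (auto intro: psd_sample_cov)
      from psd_spectral_distribution[OF this Nn0(1)[OF n]] show ?thesis using FT by auto
    qed
    then obtain \<mu> where \<mu>: "\<And>n. real_distribution (\<mu> n)" "\<And>n. cdf (\<mu> n) = esd (?S (n + 2) \<omega>)" "\<And>n. AE s in \<mu> n. 0 \<le> s"
      "\<And>n z. Im z > 0 \<Longrightarrow> stieltjes (\<mu> n) z = F (n + 2) z \<omega>" by metis
    have "\<exists>\<nu>. real_distribution \<nu> \<and> weak_conv_m \<mu> \<nu> \<and> (AE s in \<nu>. 0 \<le> s) \<and>
        (\<forall>z. Im z > 0 \<longrightarrow> stieltjes \<nu> z = mp_rhs H z (mp_factor \<gamma> z (stieltjes \<nu> z)))"
    proof (rule mp_limit[where h = h and \<tau> = \<tau> and g = "\<lambda>n. g (n + 2)" and A = A and w = "\<lambda>n. w (n + 2)"])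
      show "(\<lambda>n. g (n + 2)) \<longlonglongrightarrow> \<gamma>" by (rule LIMSEQ_ignore_initial_segment[OF gl])
      show "Im (z * w (n + 2) z) \<le> 0" if "z \<in> A" for n z
        using column_model.mean_trace_bounds(2)[OF cm[of "n + 2" z]] A0[OF that] by (simp add: w_def)
      show "cmod (w (n + 2) z) \<le> 1 / Im z" if "z \<in> A" for n z
        using column_model.mean_trace_bounds(1)[OF cm[of "n + 2" z]] A0[OF that] by (simp add: w_def)
      show "(\<lambda>n. stieltjes (\<mu> n) z - w (n + 2) z) \<longlonglongrightarrow> 0" if "z \<in> A" for z
        using LIMSEQ_ignore_initial_segment[OF conv[rule_format, OF that], of 2] \<mu>(4)[OF A0[OF that]] by simp
      show "(\<lambda>n. w (n + 2) z - mp_rhs (h n) z (mp_factor (g (n + 2)) z (w (n + 2) z))) \<longlonglongrightarrow> 0" if "z \<in> A" for z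
        unfolding h_def by (rule LIMSEQ_ignore_initial_segment[OF wr[OF A0[OF that]], of 2])
    qed (use \<mu> h hs \<tau> H(1) hH A A0 in \<open>auto simp: g_def\<close>)
    then obtain \<nu>' where \<nu>': "real_distribution \<nu>'" "weak_conv_m \<mu> \<nu>'" "AE s in \<nu>'. 0 \<le> s"
      "\<forall>z. Im z > 0 \<longrightarrow> stieltjes \<nu>' z = mp_rhs H z (mp_factor \<gamma> z (stieltjes \<nu>' z))" by blast
    have "weak_conv (\<lambda>n. esd (?S n \<omega>)) (cdf \<nu>')"
      unfolding weak_conv_def
    proof (intro allI impI)
      fix s assume "isCont (cdf \<nu>') s"
      then have "(\<lambda>n. esd (?S (n + 2) \<omega>) s) \<longlonglongrightarrow> cdf \<nu>' s"
        using \<nu>'(2) by (simp add: weak_conv_m_def weak_conv_def \<mu>(2))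
      then show "(\<lambda>n. esd (?S n \<omega>) s) \<longlonglongrightarrow> cdf \<nu>' s" by (rule LIMSEQ_offset)
    qed
    then show ?thesis using \<nu>' by blast
  qed
  have "\<exists>\<omega>\<in>space M. \<forall>z\<in>A. (\<lambda>n. F n z \<omega> - w n z) \<longlonglongrightarrow> 0"
  proof (rule ccontr)
    assume "\<not> ?thesis"
    then have no: "\<forall>\<omega>\<in>space M. \<not> (\<forall>z\<in>A. (\<lambda>n. F n z \<omega> - w n z) \<longlonglongrightarrow> 0)" by blast
    have "AE \<omega> in M. False"
      by (rule eventually_mono[OF eventually_conj[OF good AE_space]]) (use no in blast)
    then show False by simp
  qed
  then obtain \<mu> where \<mu>: "real_distribution \<mu>" "AE s in \<mu>. 0 \<le> s"
    "\<And>z. Im z > 0 \<Longrightarrow> stieltjes \<mu> z = mp_rhs H z (mp_factor \<gamma> z (stieltjes \<mu> z))"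
    using limit by blast
  have "AE \<omega> in M. weak_conv (\<lambda>n. esd (?S n \<omega>)) (cdf \<mu>)"
    using good AE_space
  proof eventually_elim
    case (elim \<omega>)
    from limit[OF elim(2,1)] obtain \<mu>' where \<mu>': "real_distribution \<mu>'" "weak_conv (\<lambda>n. esd (?S n \<omega>)) (cdf \<mu>')" "AE s in \<mu>'. 0 \<le> s"
      "\<forall>z. Im z > 0 \<longrightarrow> stieltjes \<mu>' z = mp_rhs H z (mp_factor \<gamma> z (stieltjes \<mu>' z))" by blast
    have "\<mu>' = \<mu>"
      by (rule mp_unique[OF \<mu>'(1,3) \<mu>(1,2) H(1) supp less_imp_le[OF \<tau>] less_imp_le[OF \<gamma>(1)]]) (use \<mu>'(4) \<mu>(3) in auto)
    then show ?case using \<mu>'(2) by simp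
  qed
  then show ?thesis
    using \<mu>(1,3) unfolding mp_rhs_def mp_factor_def by blast
qed

end
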